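(* Let $(U,V)$ be a pair of real Banach spaces such that (C) $U$ is a subspace of $V$ with compact inclusion $U\hookrightarrow V$. Let $\mathfrak{F}\in\mathcal{C}^1(\mathbb{R}\times U,V)$ satisfy: (F1) $\mathfrak{F}(\lambda,0)=0$ for all $\lambda\in\mathbb{R}$; (F2) $D_u\mathfrak{F}(\lambda,u)\in\Phi_0(U,V)$ for all $(\lambda,u)\in\mathbb{R}\times U$; (F3) $\mathfrak{F}$ is proper on closed and bounded subsets of $\mathbb{R}\times U$; (F4) the map $\mathfrak{N}(\lambda,u):=\mathfrak{F}(\lambda,u)-D_u\mathfrak{F}(\lambda,0)u$ admits a continuous extension to $\mathbb{R}\times V$; (F5) $\lambda_0$ is an isolated eigenvalue of $\mathfrak{L}(\lambda):=D_u\mathfrak{F}(\lambda,0)$ such that $N[\mathfrak{L}(\lambda_0)]=\mathrm{span}[\varphi_0]$ for some $\varphi_0\in U$ with $\|\varphi_0\|=1$. Suppose that, for sufficiently small $\rho>0$, with $\lambda_-=\lambda_0-\rho$ and $\lambda_+=\lambda_0+\rho$, the integer $\chi[\mathfrak{L}_\omega,[\lambda_-,\lambda_+]]$ is odd, where $\mathfrak{L}_\omega:[\lambda_-,\lambda_+]\to\Phi_0(U,V)$ is any analytic admissible curve $\mathcal{A}$-homotopic to $\mathfrak{L}(\lambda)$, $\lambda\in[\lambda_-,\lambda_+]$. Then, for each $\nu\in\{-,+\}$, the unilateral component $\mathfrak{C}^\nu$ satisfies some of the following alternatives: (i) $\mathfrak{C}^\nu$ is not compact in $\mathbb{R}\times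 U$. (ii) There exists $\lambda_1\neq\lambda_0$ such that $(\lambda_1,0)\in\mathfrak{C}^\nu$. (iii) There exist $\lambda\in\mathbb{R}$ and $z\in Z\setminus\{0\}$ such that $(\lambda,z)\in\mathfrak{C}^\nu$.
   Context: $\Phi_0(U,V)$: bounded linear Fredholm operators of index zero; $GL(U,V)$: topological isomorphisms; $\Sigma(\mathfrak{L})=\{\lambda:\mathfrak{L}(\lambda)\notin GL(U,V)\}$. $\mathcal{T}=\{(\lambda,0):\lambda\in\mathbb{R}\}$; $\mathcal{S}=[\mathfrak{F}^{-1}(0)\setminus\mathcal{T}]\cup\{(\lambda,0):\lambda\in\Sigma(\mathfrak{L})\}$. Cones: fix a closed subspace $Z\subset U$ with $U=N[\mathfrak{L}(\lambda_0)]\oplus Z$ and $\varphi_0^*\in U'$ with $Z=N[\varphi_0^*]$ and $\langle\varphi_0^*,\varphi_0\rangle=1$. Fix a continuous functional $\psi:U\to\mathbb{R}$ with $\psi(0)=0$ and $C_1\|u\|\leq\psi(u)\leq C_2\|u\|$ for all $u\in U$, $0<C_1<C_2$, and $\eta\in(0,1/C_2)$. For $\varepsilon>0$: $Q_{\varepsilon,\eta}=\{|\lambda-\lambda_0|<\varepsilon,\ |\langle\varphi_0^*,u\rangle|>\eta\psi(u)\}$, $Q_{\varepsilon,\eta}^+=\{|\lambda-\lambda_0|<\varepsilon,\ \langle\varphi_0^*,u\rangle>\eta\psi(u)\}$, $Q_{\varepsilon,\eta}^-=\{|\lambda-\lambda_0|<\varepsilon,\ \langle\varphi_0^*,u\rangle<-\eta\psi(u)\}$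 (subsets of $\mathbb{R}\times U$). Unilateral components: under the hypotheses of the theorem there is a connected component $\mathfrak{C}$ of $\mathcal{S}$ with $(\lambda_0,0)\in\mathfrak{C}$ and, for $\varepsilon,\delta>0$ so small that $[\mathcal{S}\setminus\{(\lambda_0,0)\}]\cap B_\delta(\lambda_0,0)\subset Q_{\varepsilon,\eta}$ (such $\varepsilon,\delta$ exist), there are closed connected subsets $\mathfrak{C}_\delta^\pm\subset\mathfrak{C}\cap B_\delta(\lambda_0,0)$ with $\mathfrak{C}_\delta^\pm\subset Q_{\varepsilon,\eta}^\pm\cup\{(\lambda_0,0)\}$, $\mathfrak{C}_\delta^+\cap\mathfrak{C}_\delta^-=\{(\lambda_0,0)\}$, each linking $(\lambda_0,0)$ to $\partial B_\delta(\lambda_0,0)$. Then $\mathfrak{C}^\pm:=\mathscr{C}^\pm\cup\{(\lambda_0,0)\}$, where $\mathscr{C}^+$ (resp. $\mathscr{C}^-$) is the connected component of $\mathcal{S}\setminus\{(\lambda_0,0)\}$ containing $\mathfrak{C}_\delta^+\setminus\{(\lambda_0,0)\}$ (resp. $\mathfrak{C}_\delta^-\setminus\{(\lambda_0,0)\}$). $\mathcal{A}$-homotopy: a continuous path $[a,b]\to\Phi_0(U,V)$ is admissible if its endpoints lie in $GL(U,V)$; two admissible paths are $\mathcal{A}$-homotopic if they are homotopic through a continuous homotopy in $\Phi_0(U,V)$ whose endpoints stay in $GL(U,V)$. Every admissible path is $\mathcal{A}$-homotopic to an analytic one. Generalized algebraic multiplicity $\chi$: for a $\mathcal{C}^r$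 curve $\mathfrak{L}$ in $\Phi_0(U,V)$, $\mu\in\Sigma(\mathfrak{L})$ is $\kappa$-algebraic ($1\leq\kappa\leq r$) if there are $\epsilon,C>0$ with $\mathfrak{L}(\lambda)\in GL(U,V)$ and $\|\mathfrak{L}(\lambda)^{-1}\|<C|\lambda-\mu|^{-\kappa}$ for $0<|\lambda-\mu|<\epsilon$, $\kappa$ minimal. Put $\mathfrak{L}_j=\frac1{j!}\mathfrak{L}^{(j)}(\mu)$. $\mu$ is $\kappa$-transversal if $\bigoplus_{j=1}^{\kappa}\mathfrak{L}_j\big(\bigcap_{i=0}^{j-1}N[\mathfrak{L}_i]\big)\oplus R[\mathfrak{L}_0]=V$ with $\mathfrak{L}_\kappa\big(\bigcap_{i=0}^{\kappa-1}N[\mathfrak{L}_i]\big)\neq\{0\}$; then $\chi[\mathfrak{L},\mu]:=\sum_{j=1}^{\kappa}j\dim\mathfrak{L}_j\big(\bigcap_{i=0}^{j-1}N[\mathfrak{L}_i]\big)$. In general there is an $\mathcal{L}(U)$-valued polynomial $\Phi$ with $\Phi(\mu)=I_U$ such that $\mu$ is $\kappa$-transversal for $\mathfrak{L}^\Phi(\lambda)=\mathfrak{L}(\lambda)\Phi(\lambda)$, and $\chi[\mathfrak{L},\mu]:=\chi[\mathfrak{L}^\Phi,\mu]$, independently of $\Phi$. For analytic admissible $\mathfrak{L}_\omega$ on $[a,b]$, $\Sigma(\mathfrak{L}_\omega)$ is finite, consists of algebraic eigenvalues, and $\chi[\mathfrak{L}_\omega,[a,b]]:=\sum_{\mu\i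n\Sigma(\mathfrak{L}_\omega)}\chi[\mathfrak{L}_\omega,\mu]$.
   Formalization: The sets C_δ^± are not determined by their listed properties and the claim fails for some choices; it is proved that, for all admissible ε, δ, some choice of C_δ^± with all listed properties gives C^± satisfying (i), (ii) or (iii), with B_δ the closed ball. *)

theory Defs
  imports "HOL-Analysis.Analysis"
begin

definition complementary :: "'a::real_vector set \<Rightarrow> 'a set \<Rightarrow> bool" where
  "complementary A B \<longleftrightarrow>
     subspace A \<and> subspace B \<and> A \<inter> B = {0} \<and> (\<forall>v. \<exists>a\<in>A. \<exists>b\<in>B. v = a + b)"

definition fin_dim :: "'a::real_vector set \<Rightarrow> bool" where
  "fin_dim S \<longleftrightarrow> (\<exists>B. finite B \<and> S = span B)"

definition fin_codim :: "'a::real_vector set \<Rightarrow> bool" where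
  "fin_codim S \<longleftrightarrow> (\<exists>W. fin_dim W \<and> complementary S W)"

definition codim :: "'a::real_vector set \<Rightarrow> nat" where
  "codim S = (THE n. \<exists>W. fin_dim W \<and> complementary S W \<and> n = dim W)"

definition null_space :: "('u::real_normed_vector \<Rightarrow>\<^sub>L 'v::real_normed_vector) \<Rightarrow> 'u set" where
  "null_space T = {u. blinfun_apply T u = 0}"

definition fredholm :: "('u::real_normed_vector \<Rightarrow>\<^sub>L 'v::real_normed_vector) \<Rightarrow> bool" where
  "fredholm T \<longleftrightarrow> fin_dim (null_space T) \<and> closed (range (blinfun_apply T))
                 \<and> fin_codim (range (blinfun_apply T))"

definition fredholm_index :: "('u::real_normed_vector \<Rightarrow>\<^sub>L 'v::real_normed_vector) \<Rightarrow> int" where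
  "fredholm_index T = int (dim (null_space T)) - int (codim (range (blinfun_apply T)))"

definition Phi0 :: "('u::real_normed_vector \<Rightarrow>\<^sub>L 'v::real_normed_vector) set" where
  "Phi0 = {T. fredholm T \<and> fredholm_index T = 0}"

definition is_inverse :: "('u::real_normed_vector \<Rightarrow>\<^sub>L 'v::real_normed_vector) \<Rightarrow> ('v \<Rightarrow>\<^sub>L 'u) \<Rightarrow> bool" where
  "is_inverse T R \<longleftrightarrow> R o\<^sub>L T = id_blinfun \<and> T o\<^sub>L R = id_blinfun"

definition GL :: "('u::real_normed_vector \<Rightarrow>\<^sub>L 'v::real_normed_vector) set" where
  "GL = {T. \<exists>R. is_inverse T R}"

definition blinfun_inverse :: "('u::real_normed_vector \<Rightarrow>\<^sub>L 'v::real_normed_vector) \<Rightarrow> ('v \<Rightarrow>\<^sub>L 'u)" where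
  "blinfun_inverse T = (THE R. is_inverse T R)"

definition Spec :: "(real \<Rightarrow> ('u::real_normed_vector \<Rightarrow>\<^sub>L 'v::real_normed_vector)) \<Rightarrow> real set" where
  "Spec L = {l. L l \<notin> GL}"

definition compact_operator :: "('u::real_normed_vector \<Rightarrow>\<^sub>L 'v::real_normed_vector) \<Rightarrow> bool" where
  "compact_operator T \<longleftrightarrow> (\<forall>B. bounded B \<longrightarrow> compact (closure (blinfun_apply T ` B)))"


definition admissible :: "real \<Rightarrow> real \<Rightarrow> (real \<Rightarrow> ('u::real_normed_vector \<Rightarrow>\<^sub>L 'v::real_normed_vector)) \<Rightarrow> bool" where
  "admissible a b L \<longleftrightarrow>
     continuous_on {a..b} L \<and> L ` {a..b} \<subseteq> Phi0 \<and> L a \<in> GL \<and> L b \<in> GL"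

definition A_homotopic :: "real \<Rightarrow> real \<Rightarrow> (real \<Rightarrow> ('u::real_normed_vector \<Rightarrow>\<^sub>L 'v::real_normed_vector))
    \<Rightarrow> (real \<Rightarrow> ('u \<Rightarrow>\<^sub>L 'v)) \<Rightarrow> bool" where
  "A_homotopic a b L M \<longleftrightarrow> admissible a b L \<and> admissible a b M
     \<and> homotopic_with_canon (\<lambda>h. h a \<in> GL \<and> h b \<in> GL) {a..b} Phi0 L M"

text \<open>Real analyticity with values in a normed space; at a point of \<open>S\<close> only the values on \<open>S\<close>
  matter, so that at the end points of a compact interval the condition is one-sided.\<close>

definition real_analytic_on :: "(real \<Rightarrow> 'b::real_normed_vector) \<Rightarrow> real set \<Rightarrow> bool" where
  "real_analytic_on f S \<longleftrightarrow> (\<forall>x\<in>S. \<exists>r>0. \<exists>c. \<forall>y\<in>S. \<bar>y - x\<bar> < r \<longrightarrow>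
     (\<lambda>n. (y - x) ^ n *\<^sub>R c n) sums f y)"


definition taylor_coeff :: "(real \<Rightarrow> 'b::real_normed_vector) \<Rightarrow> real \<Rightarrow> nat \<Rightarrow> 'b" where
  "taylor_coeff f m j = (1 / fact j) *\<^sub>R ((\<lambda>g t. vector_derivative g (at t)) ^^ j) f m"

definition inverse_bound :: "(real \<Rightarrow> ('u::real_normed_vector \<Rightarrow>\<^sub>L 'v::real_normed_vector)) \<Rightarrow> real \<Rightarrow> nat \<Rightarrow> bool" where
  "inverse_bound L m k \<longleftrightarrow> (\<exists>\<epsilon>>0. \<exists>C>0. \<forall>l. 0 < \<bar>l - m\<bar> \<and> \<bar>l - m\<bar> < \<epsilon> \<longrightarrow>
     L l \<in> GL \<and> norm (blinfun_inverse (L l)) < C / \<bar>l - m\<bar> ^ k)"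

definition algebraic_eigenvalue :: "(real \<Rightarrow> ('u::real_normed_vector \<Rightarrow>\<^sub>L 'v::real_normed_vector)) \<Rightarrow> real \<Rightarrow> nat \<Rightarrow> bool" where
  "algebraic_eigenvalue L m k \<longleftrightarrow> m \<in> Spec L \<and> 1 \<le> k \<and> inverse_bound L m k
     \<and> (\<forall>k'. 1 \<le> k' \<and> k' < k \<longrightarrow> \<not> inverse_bound L m k')"

text \<open>The space \<open>L\<^sub>j(N[L\<^sub>0] \<inter> \<dots> \<inter> N[L\<^sub>j\<^sub>-\<^sub>1])\<close>; for \<open>j = 0\<close> the intersection is empty and
  this is the range \<open>R[L\<^sub>0]\<close>.\<close>

definition transv_space :: "(real \<Rightarrow> ('u::real_normed_vector \<Rightarrow>\<^sub>L 'v::real_normed_vector)) \<Rightarrow> real \<Rightarrow> nat \<Rightarrow> 'v set" where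
  "transv_space L m j =
     blinfun_apply (taylor_coeff L m j) ` (\<Inter>i<j. null_space (taylor_coeff L m i))"

definition transversal :: "(real \<Rightarrow> ('u::real_normed_vector \<Rightarrow>\<^sub>L 'v::real_normed_vector)) \<Rightarrow> real \<Rightarrow> nat \<Rightarrow> bool" where
  "transversal L m k \<longleftrightarrow> 1 \<le> k
     \<and> (\<forall>v. \<exists>!w. w \<in> (\<Pi>\<^sub>E j\<in>{..k}. transv_space L m j) \<and> v = (\<Sum>j\<le>k. w j))
     \<and> transv_space L m k \<noteq> {0}"

definition chi_transversal :: "(real \<Rightarrow> ('u::real_normed_vector \<Rightarrow>\<^sub>L 'v::real_normed_vector)) \<Rightarrow> real \<Rightarrow> nat \<Rightarrow> nat" where
  "chi_transversal L m k = (\<Sum>j=1..k. j * dim (transv_space L m j))"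

definition operator_polynomial :: "(real \<Rightarrow> ('u::real_normed_vector \<Rightarrow>\<^sub>L 'u)) \<Rightarrow> bool" where
  "operator_polynomial \<Phi> \<longleftrightarrow> (\<exists>n A. \<forall>t. \<Phi> t = (\<Sum>k\<le>n. t ^ k *\<^sub>R A k))"

text \<open>The multiplicity at an algebraic eigenvalue of a curve that is smooth near it. The value does
  not depend on the transversalizing polynomial.\<close>

definition chi :: "(real \<Rightarrow> ('u::real_normed_vector \<Rightarrow>\<^sub>L 'v::real_normed_vector)) \<Rightarrow> real \<Rightarrow> nat" where
  "chi L m = (THE n. \<exists>k \<Phi>. algebraic_eigenvalue L m k \<and> operator_polynomial \<Phi> \<and> \<Phi> m = id_blinfun
     \<and> transversal (\<lambda>t. L t o\<^sub>L \<Phi> t) m k \<and> n = chi_transversal (\<lambda>t. L t o\<^sub>L \<Phi> t) m k)"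

definition chi_interval :: "(real \<Rightarrow> ('u::real_normed_vector \<Rightarrow>\<^sub>L 'v::real_normed_vector)) \<Rightarrow> real \<Rightarrow> real \<Rightarrow> nat" where
  "chi_interval L a b = (\<Sum>m \<in> Spec L \<inter> {a..b}. chi L m)"


definition C1_map :: "('a::real_normed_vector \<Rightarrow> 'b::real_normed_vector) \<Rightarrow> bool" where
  "C1_map f \<longleftrightarrow> (\<exists>f' :: 'a \<Rightarrow> ('a \<Rightarrow>\<^sub>L 'b).
     (\<forall>x. (f has_derivative blinfun_apply (f' x)) (at x)) \<and> continuous_on UNIV f')"

definition proper_on_closed_bounded :: "('a::metric_space \<Rightarrow> 'b::topological_space) \<Rightarrow> bool" where
  "proper_on_closed_bounded f \<longleftrightarrow>
     (\<forall>B K. closed B \<and> bounded B \<and> compact K \<longrightarrow> compact (B \<inter> f -` K))"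

definition Du :: "(real \<times> 'u::real_normed_vector \<Rightarrow> 'v::real_normed_vector) \<Rightarrow> real \<Rightarrow> 'u \<Rightarrow> ('u \<Rightarrow>\<^sub>L 'v)" where
  "Du F l u = Blinfun (frechet_derivative (\<lambda>w. F (l, w)) (at u))"

definition linearization :: "(real \<times> 'u::real_normed_vector \<Rightarrow> 'v::real_normed_vector) \<Rightarrow> real \<Rightarrow> ('u \<Rightarrow>\<^sub>L 'v)" where
  "linearization F l = Du F l 0"

definition nontrivial_solutions :: "(real \<times> 'u::real_normed_vector \<Rightarrow> 'v::real_normed_vector) \<Rightarrow> (real \<times> 'u) set" where
  "nontrivial_solutions F =
     (F -` {0} - {(l, 0) | l. True}) \<union> {(l, 0) | l. l \<in> Spec (linearization F)}"


definition cone_both :: "real \<Rightarrow> ('u::real_normed_vector \<Rightarrow>\<^sub>L real) \<Rightarrow> ('u \<Rightarrow> real) \<Rightarrow> real \<Rightarrow> real \<Rightarrow> (real \<times> 'u) set" where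
  "cone_both l0 p \<psi> \<epsilon> \<eta> = {(l, u). \<bar>l - l0\<bar> < \<epsilon> \<and> \<bar>blinfun_apply p u\<bar> > \<eta> * \<psi> u}"

definition cone_plus :: "real \<Rightarrow> ('u::real_normed_vector \<Rightarrow>\<^sub>L real) \<Rightarrow> ('u \<Rightarrow> real) \<Rightarrow> real \<Rightarrow> real \<Rightarrow> (real \<times> 'u) set" where
  "cone_plus l0 p \<psi> \<epsilon> \<eta> = {(l, u). \<bar>l - l0\<bar> < \<epsilon> \<and> blinfun_apply p u > \<eta> * \<psi> u}"

definition cone_minus :: "real \<Rightarrow> ('u::real_normed_vector \<Rightarrow>\<^sub>L real) \<Rightarrow> ('u \<Rightarrow> real) \<Rightarrow> real \<Rightarrow> real \<Rightarrow> (real \<times> 'u) set" where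
  "cone_minus l0 p \<psi> \<epsilon> \<eta> = {(l, u). \<bar>l - l0\<bar> < \<epsilon> \<and> blinfun_apply p u < - (\<eta> * \<psi> u)}"

text \<open>A closed connected piece of the component of \<open>S\<close> through \<open>x\<close> that stays in \<open>Q \<union> {x}\<close> and
  links \<open>x\<close> to the boundary of the ball. The ball is the closed one, since a closed subset of the
  open ball cannot reach its boundary.\<close>

definition local_branch :: "'a::metric_space set \<Rightarrow> 'a \<Rightarrow> real \<Rightarrow> 'a set \<Rightarrow> 'a set \<Rightarrow> bool" where
  "local_branch S x \<delta> Q K \<longleftrightarrow> closed K \<and> connected K
     \<and> K \<subseteq> connected_component_set S x \<inter> cball x \<delta> \<and> K \<subseteq> Q \<union> {x}
     \<and> x \<in> K \<and> K \<inter> sphere x \<delta> \<noteq> {}"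

definition unilateral_component :: "'a::topological_space set \<Rightarrow> 'a \<Rightarrow> 'a set \<Rightarrow> 'a set \<Rightarrow> bool" where
  "unilateral_component S x K C \<longleftrightarrow> (\<exists>D \<in> components (S - {x}). K - {x} \<subseteq> D \<and> C = D \<union> {x})"

end

theory Submission
  imports Defs
begin

text \<open>
  Write \<open>s\<close> for the value of the functional \<open>\<phi>s\<close> on \<open>u\<close> and \<open>z = u - s \<phi>0\<close>. Near \<open>l0\<close> the linearization
  factors through an isomorphism as \<open>u \<mapsto> z + s q(l)\<close>, so its invertibility is decided by the scalar
  \<open>d(l) = \<phi>s (q(l))\<close>. If \<open>d\<close> had the same sign on both sides of \<open>l0\<close>, the linearization would be
  homotopic to a constant curve of isomorphisms, which has multiplicity zero; hence \<open>d\<close> changes sign.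

  Because of (F4) and a parametrix of the linearization along a compact interval, the equation
  \<open>F = 0\<close> is equivalent to \<open>u = k(l, u)\<close> with \<open>k\<close> completely continuous. Using \<open>s\<close> instead of \<open>l\<close> as the
  continuation parameter, the solutions \<open>(l, z)\<close> in a slice \<open>s = \<sigma>\<close> with \<open>\<sigma> > 0\<close> small are cut out by a map
  that is homotopic to an isomorphism, by the sign change of \<open>d\<close>. If the solutions with \<open>s > 0\<close> had a
  compact, relatively open piece \<open>A\<close> attached to \<open>(l0, 0)\<close>, one could add a scalar equation separating
  \<open>A\<close> from the remaining solutions and obtain a compact perturbation of an isomorphism that coincides
  with it far away but has no zero, contradicting the Schauder fixed point theorem.

  Consequently, in the one-point compactification of the set of solutions with \<open>s > 0\<close>, completed by
  \<open>(l0, 0)\<close>, a continuum joins \<open>(l0, 0)\<close> to infinity. Removing both ends from an irreducible such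
  continuum leaves a connected set, and its component is the unilateral branch. The branch for the
  opposite cone is obtained from the pair \<open>(-\<phi>0, -\<phi>s)\<close>.
\<close>

text \<open>Parity enters only through the signs of d at two points, so a single fixed point theorem
  can replace degree theory, and the multiplicity has to be evaluated on one curve only. The
  parameter s is preferred to l because a slice s = \<sigma> > 0 contains no trivial solution and
  because the half-spaces s > 0 and s < 0 carry the two branches. Where a component of the punctured
  solution set meets s = 0, the point has u = 0, which is alternative (ii), or u is a non-zero
  element of Z, which is (iii); so only components with s > 0 throughout need an argument, and for
  those non-compactness must be proved. The obstacle is that deleting (l0, 0) from a non-compact
  connected set may leave many pieces, each of them compact once (l0, 0) is put back; the
  irreducible continuum is there to exclude this.\<close>

section \<open>The Schauder fixed point theorem\<close>

text \<open>Brouwer's theorem in approximate form, for the self-map of the unit cube with components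
  g_i of the sum of all c_j y_j. Working with coefficient vectors lets the dimension n be a variable
  and allows linearly dependent y_j. Approximate fixed points suffice, since Schauder's theorem
  passes to a limit anyway.\<close>

lemma kuhn_approximate_fixed_point:
  fixes y :: "nat \<Rightarrow> 'a::real_normed_vector" and g :: "nat \<Rightarrow> 'a \<Rightarrow> real"
  assumes cont: "\<And>i. i < n \<Longrightarrow> continuous_on UNIV (g i)"
    and g01: "\<And>i x. i < n \<Longrightarrow> g i x \<in> {0..1}"
    and "e > 0"
  obtains c where "\<And>i. i < n \<Longrightarrow> \<bar>c i - g i (\<Sum>j<n. c j *\<^sub>R y j)\<bar> < e"
proof -
  define X where "X c = (\<Sum>j<n. c j *\<^sub>R y j)" for c :: "nat \<Rightarrow> real"
  define K where "K = X ` {c. \<forall>j. c j \<in> {0..1}}"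
  have "compact K"
  proof -
    have "compact {\<Sum>j<m. c j *\<^sub>R y j |c. \<forall>j. c j \<in> {0..1::real}}" (is "compact (?S m)") for m
    proof (induction m)
      case 0
      have "?S 0 = {0}"
        by (auto intro: exI[of _ "\<lambda>_. 0"])
      then show ?case by simp
    next
      case (Suc m)
      have "?S (Suc m) = {a + b |a b. a \<in> ?S m \<and> b \<in> (\<lambda>t. t *\<^sub>R y m) ` {0..1}}" (is "_ = ?T")
      proof
        show "?S (Suc m) \<subseteq> ?T"
        proof clarsimp
          fix c :: "nat \<Rightarrow> real" assume "\<forall>j. 0 \<le> c j \<and> c j \<le> 1"
          then show "\<exists>a b. (\<Sum>j<m. c j *\<^sub>R y j) + c m *\<^sub>R y m = a + b \<and>
              (\<exists>c. a = (\<Sum>j<m. c j *\<^sub>R y j) \<and> (\<forall>j. 0 \<le> c j \<and> c j \<le> 1)) \<and>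
              b \<in> (\<lambda>t. t *\<^sub>R y m) ` {0..1}"
            by (intro exI[of _ "\<Sum>j<m. c j *\<^sub>R y j"] exI[of _ "c m *\<^sub>R y m"] exI[of _ c] conjI refl imageI)
              auto
        qed
        show "?T \<subseteq> ?S (Suc m)"
        proof clarsimp
          fix c :: "nat \<Rightarrow> real" and t :: real
          assume "\<forall>j. 0 \<le> c j \<and> c j \<le> 1" "0 \<le> t" "t \<le> 1"
          then show "\<exists>d. (\<Sum>j<m. c j *\<^sub>R y j) + t *\<^sub>R y m = (\<Sum>j<m. d j *\<^sub>R y j) + d m *\<^sub>R y m
              \<and> (\<forall>j. 0 \<le> d j \<and> d j \<le> 1)"
            by (intro exI[of _ "c(m := t)"]) auto
        qed
      qed
      moreover have "compact ?T"
        by (intro compact_sums Suc compact_continuous_image continuous_intros) auto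
      ultimately show ?case by simp
    qed
    moreover have "K = ?S n"
      by (auto simp: K_def X_def)
    ultimately show ?thesis by simp
  qed
  \<comment> \<open>Lipschitz constant of \<open>X\<close> for the sup distance of coefficients; the
    summand 1 keeps it positive.\<close>
  define M where "M = 1 + (\<Sum>j<n. norm (y j))"
  have "M \<ge> 1"
    unfolding M_def by (simp add: sum_nonneg)
  have Xdist: "dist (X c) (X d) \<le> M * r" if "\<And>j. j < n \<Longrightarrow> \<bar>c j - d j\<bar> \<le> r" "r \<ge> 0" for c d r
  proof -
    have "dist (X c) (X d) = norm (\<Sum>j<n. (c j - d j) *\<^sub>R y j)"
      by (simp add: dist_norm X_def sum_subtractf algebra_simps)
    also have "\<dots> \<le> (\<Sum>j<n. r * norm (y j))"
      by (intro sum_norm_le) (simp add: that(1) mult_right_mono)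
    also have "\<dots> \<le> M * r"
      using \<open>r \<ge> 0\<close> by (simp add: M_def sum_distrib_left[symmetric] algebra_simps)
    finally show ?thesis .
  qed
  have "\<exists>d>0. \<forall>i<m. \<forall>x\<in>K. \<forall>x'\<in>K. dist x' x < d \<longrightarrow> dist (g i x') (g i x) < e / 2"
    if "m \<le> n" for m
    using that
  proof (induction m)
    case 0
    then show ?case by (auto intro: exI[of _ 1])
  next
    case (Suc m)
    then obtain d where d: "d > 0" "\<forall>i<m. \<forall>x\<in>K. \<forall>x'\<in>K. dist x' x < d \<longrightarrow> dist (g i x') (g i x) < e / 2"
      by auto
    have "uniformly_continuous_on K (g m)"
      using Suc.prems cont[of m] \<open>compact K\<close>
      by (intro compact_uniformly_continuous) (auto intro: continuous_on_subset)
    then obtain d' where d': "d' > 0" "\<forall>x\<in>K. \<forall>x'\<in>K. dist x' x < d' \<longrightarrow> dist (g m x') (g m x) < e / 2"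
      unfolding uniformly_continuous_on_def using \<open>e > 0\<close> by (metis half_gt_zero)
    show ?case
      using d d' by (intro exI[of _ "min d d'"]) (auto simp: less_Suc_eq)
  qed
  from this[of n] obtain d where "d > 0"
    "\<forall>i<n. \<forall>x\<in>K. \<forall>x'\<in>K. dist x' x < d \<longrightarrow> dist (g i x') (g i x) < e / 2"
    by auto
  then have d: "d > 0"
    "\<And>i x x'. i < n \<Longrightarrow> x \<in> K \<Longrightarrow> x' \<in> K \<Longrightarrow> dist x' x < d \<Longrightarrow> dist (g i x') (g i x) < e / 2"
    by auto
  \<comment> \<open>The grid is so fine that neighbouring vertices differ by less than e/2 in each
    coefficient and have images under \<open>X\<close> closer than the modulus
    \<open>d\<close>.\<close>
  obtain p0 :: nat where p0: "max (2 / e) (M / d) < p0"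
    using reals_Archimedean2 by blast
  define p where "p = Suc p0"
  have p: "p > 0" "1 / real p < e / 2" "M * (1 / real p) < d"
  proof -
    have *: "real p0 < real p" by (simp add: p_def)
    then have "2 / e < p" "M / d < p" using p0 by linarith+
    moreover show "p > 0" by (simp add: p_def)
    ultimately show "1 / real p < e / 2" "M * (1 / real p) < d"
      using \<open>e > 0\<close> \<open>d > 0\<close> by (simp_all add: field_simps)
  qed
  define q' where "q' x = (\<lambda>i. if i < n then real (x i) / real p else 0)" for x :: "nat \<Rightarrow> nat"
  \<comment> \<open>Label 1 says that \<open>g i\<close> pulls the i-th coordinate down. On the
    faces the labels are those that Kuhn's lemma prescribes: 0 where x_i = 0 and 1 where x_i =
    p.\<close>
  define label where "label x i = (if x i = p \<or> (x i \<noteq> 0 \<and> g i (X (q' x)) < q' x i) then 1 else 0::nat)"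
    for x i
  obtain q where q: "\<forall>i<n. q i < p"
    and ex: "\<forall>i<n. \<exists>r s. (\<forall>j<n. q j \<le> r j \<and> r j \<le> q j + 1) \<and> (\<forall>j<n. q j \<le> s j \<and> s j \<le> q j + 1) \<and> label r i \<noteq> label s i"
    by (rule kuhn_lemma[of p n label, OF p(1)]) (use p(1) in \<open>auto simp: label_def\<close>)
  have inK: "X (q' x) \<in> K" if "\<forall>j<n. x j \<le> p" for x
    using that p(1) by (auto simp: K_def q'_def intro!: imageI)
  have near: "\<bar>q' x j - q' q j\<bar> \<le> 1 / p" if "\<forall>j<n. q j \<le> x j \<and> x j \<le> q j + 1" for x j
  proof (cases "j < n")
    case True
    then have "real (q j) \<le> x j" "real (x j) \<le> q j + 1" using that by (auto simp flip: of_nat_Suc)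
    then have "\<bar>real (x j) - real (q j)\<bar> / p \<le> 1 / p" by (intro divide_right_mono) auto
    then show ?thesis using True by (simp add: q'_def flip: diff_divide_distrib)
  qed (auto simp: q'_def)
  have gnear: "\<bar>g i (X (q' x)) - g i (X (q' q))\<bar> < e / 2"
    if "\<forall>j<n. q j \<le> x j \<and> x j \<le> q j + 1" "i < n" for x i
  proof -
    have "dist (X (q' x)) (X (q' q)) \<le> M * (1 / p)"
      by (intro Xdist near that) auto
    moreover have "\<forall>j<n. x j \<le> p"
    proof (intro allI impI)
      fix j assume "j < n"
      then have "x j \<le> q j + 1" "q j < p" using that q by auto
      then show "x j \<le> p" by linarith
    qed
    ultimately show ?thesis
      using d(2)[OF \<open>i < n\<close>, of "X (q' q)" "X (q' x)"] p(3) inK[of q] inK[of x] q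
      by (auto simp: dist_real_def less_imp_le)
  qed
  have lab0: "q' x i \<le> g i (X (q' x))" if "label x i = 0" "i < n" for x i
    using that g01[OF \<open>i < n\<close>, of "X (q' x)"] by (auto simp: label_def q'_def split: if_splits)
  have lab1: "g i (X (q' x)) \<le> q' x i" if "label x i \<noteq> 0" "i < n" for x i
    using that g01[OF \<open>i < n\<close>, of "X (q' x)"] p(1) by (auto simp: label_def q'_def split: if_splits)
  show ?thesis
  proof (rule that[of "q' q"])
    fix i assume i: "i < n"
    then obtain r s where rs: "\<forall>j<n. q j \<le> r j \<and> r j \<le> q j + 1" "\<forall>j<n. q j \<le> s j \<and> s j \<le> q j + 1"
      "label r i \<noteq> label s i"
      using ex by blast
    then have "\<exists>r s. (\<forall>j<n. q j \<le> r j \<and> r j \<le> q j + 1) \<and> (\<forall>j<n. q j \<le> s j \<and> s j \<le> q j + 1)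
        \<and> label r i = 0 \<and> label s i \<noteq> 0"
      by (cases "label r i = 0") (metis, metis label_def)
    then obtain r s where rs: "\<forall>j<n. q j \<le> r j \<and> r j \<le> q j + 1" "\<forall>j<n. q j \<le> s j \<and> s j \<le> q j + 1"
      "label r i = 0" "label s i \<noteq> 0"
      by blast
    \<comment> \<open>Both labels occur in one cell: at \<open>r\<close> the map does not decrease
      the coordinate, at \<open>s\<close> it does not increase it, so the coordinate is nearly fixed
      at the corner \<open>q\<close>.\<close>
    show "\<bar>q' q i - g i (\<Sum>j<n. q' q j *\<^sub>R y j)\<bar> < e"
      using near[OF rs(1), of i] near[OF rs(2), of i] gnear[OF rs(1) i] gnear[OF rs(2) i]
        lab0[OF rs(3) i] lab1[OF rs(4) i] p(2)
      unfolding X_def[symmetric] by linarith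
  qed
qed

text \<open>A partition of unity over a finite e/2-net of \<open>K\<close> replaces h by a map into
  a finite hull. The coefficient map of that hull has approximate fixed points, and compactness of
  \<open>K\<close> turns these into a genuine one.\<close>

theorem schauder_fixed_point:
  fixes h :: "'a::real_normed_vector \<Rightarrow> 'a"
  assumes cont: "continuous_on UNIV h" and K: "compact K" "range h \<subseteq> K"
  obtains x where "h x = x"
proof -
  have approx: "\<exists>x. dist (h x) x < e" if "e > 0" for e
  proof -
    obtain F where F: "finite F" "K \<subseteq> (\<Union>y\<in>F. ball y (e/2))"
      using compactE_image[OF K(1), of K "\<lambda>y. ball y (e/2)"] \<open>e > 0\<close>
      by (metis UN_I centre_in_ball half_gt_zero open_ball subsetI)
    obtain n and y :: "nat \<Rightarrow> 'a" where y: "F = y ` {..<n}"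
      using finite_imp_nat_seg_image_inj_on[OF F(1)] by (auto simp: lessThan_def)
    define m where "m i x = max 0 (e/2 - dist (h x) (y i))" for i x
    define s where "s x = (\<Sum>i<n. m i x)" for x
    define g where "g i x = m i x / s x" for i x
    have m0: "m i x \<ge> 0" for i x by (auto simp: m_def)
    have s0: "s x > 0" for x
    proof -
      have "h x \<in> K" using K by auto
      then obtain i where "i < n" "dist (y i) (h x) < e / 2"
        using F y by force
      then have "m i x > 0" by (auto simp: m_def dist_commute)
      then show ?thesis
        unfolding s_def using \<open>i < n\<close> m0 by (intro sum_pos2[of _ i]) auto
    qed
    have m_le: "m i x \<le> s x" if "i < n" for i x
      unfolding s_def using that m0 by (intro member_le_sum) auto
    have mcont: "continuous_on UNIV (m i)" for i
      unfolding m_def by (intro continuous_intros cont)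
    then have scont: "continuous_on UNIV s"
      unfolding s_def by (intro continuous_intros)
    \<comment> \<open>Chosen so that coefficient errors below e/2/M change the combination of the
      y_i by less than e/2.\<close>
    define M where "M = 1 + (\<Sum>i<n. norm (y i))"
    have "M > 0" unfolding M_def by (simp add: add_pos_nonneg sum_nonneg)
    obtain c where c: "\<And>i. i < n \<Longrightarrow> \<bar>c i - g i (\<Sum>j<n. c j *\<^sub>R y j)\<bar> < e / 2 / M"
    proof (rule kuhn_approximate_fixed_point[of n g "e/2/M" y])
      show "continuous_on UNIV (g i)" for i
        unfolding g_def using s0 by (intro continuous_intros mcont scont) (auto simp: less_imp_neq[symmetric])
      show "g i x \<in> {0..1}" if "i < n" for i x
        using m0[of i x] s0[of x] m_le[OF that, of x] by (auto simp: g_def)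
    qed (use \<open>e > 0\<close> \<open>M > 0\<close> in auto)
    define x where "x = (\<Sum>j<n. c j *\<^sub>R y j)"
    \<comment> \<open>The Schauder projection of \<open>h x\<close>; it is within e/2 of
      \<open>h x\<close> because only net points that close carry weight.\<close>
    define p where "p = (\<Sum>j<n. g j x *\<^sub>R y j)"
    have "norm (x - p) = norm (\<Sum>j<n. (c j - g j x) *\<^sub>R y j)"
      by (simp add: x_def p_def sum_subtractf algebra_simps)
    also have "\<dots> \<le> (\<Sum>j<n. e / 2 / M * norm (y j))"
    proof (intro sum_norm_le)
      fix j assume "j \<in> {..<n}"
      then show "norm ((c j - g j x) *\<^sub>R y j) \<le> e / 2 / M * norm (y j)"
        using c[of j] unfolding norm_scaleR real_norm_def x_def
        by (intro mult_right_mono) auto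
    qed
    also have "\<dots> = e / 2 / M * (M - 1)"
      by (simp add: M_def sum_distrib_left)
    also have "\<dots> < e / 2"
      using \<open>M > 0\<close> \<open>e > 0\<close> by (simp add: field_simps)
    finally have 1: "norm (x - p) < e / 2" .
    have gsum: "(\<Sum>j<n. g j x) = 1"
      using s0[of x] by (simp add: g_def s_def flip: sum_divide_distrib)
    have "norm (h x - p) = norm (\<Sum>j<n. g j x *\<^sub>R (h x - y j))"
      by (simp add: p_def algebra_simps sum_subtractf gsum flip: scaleR_sum_left)
    also have "\<dots> \<le> (\<Sum>j<n. g j x * (e / 2))"
    proof (intro sum_norm_le)
      fix j assume "j \<in> {..<n}"
      show "norm (g j x *\<^sub>R (h x - y j)) \<le> g j x * (e / 2)"
      proof (cases "g j x = 0")
        case False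
        then have "dist (h x) (y j) < e / 2"
          by (auto simp: g_def m_def split: if_splits)
        moreover have "g j x \<ge> 0" using m0 s0 by (simp add: g_def less_imp_le)
        ultimately show ?thesis
          using mult_left_mono[of "norm (h x - y j)" "e / 2" "g j x"] by (simp add: dist_norm)
      qed simp
    qed
    also have "\<dots> = e / 2"
      by (simp add: gsum flip: sum_distrib_right sum_divide_distrib)
    finally have "norm (h x - x) < e"
      using 1 norm_triangle_sub[of "h x - x" "h x - p"] by (simp add: norm_minus_commute)
    then show ?thesis by (auto simp: dist_norm)
  qed
  have "\<exists>x. \<forall>n. dist (h (x n)) (x n) < inverse (real (Suc n))"
    by (intro choice allI approx) auto
  then obtain x where x: "\<And>n. dist (h (x n)) (x n) < inverse (real (Suc n))" by blast
  have "\<forall>n. h (x n) \<in> K" using K by auto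
  then obtain l r where r: "l \<in> K" "strict_mono r" "((\<lambda>n. h (x n)) \<circ> r) \<longlonglongrightarrow> l"
    using K(1) unfolding compact_def by meson
  have "(\<lambda>n. dist (h (x n)) (x n)) \<longlonglongrightarrow> 0"
    by (rule real_tendsto_sandwich[OF _ _ tendsto_const LIMSEQ_inverse_real_of_nat])
      (use x in \<open>auto intro!: always_eventually less_imp_le\<close>)
  then have "(\<lambda>n. h (x n) - x n) \<longlonglongrightarrow> 0"
    by (simp add: dist_norm tendsto_norm_zero_iff)
  then have "((\<lambda>n. h (x n) - x n) \<circ> r) \<longlonglongrightarrow> 0"
    using r(2) LIMSEQ_subseq_LIMSEQ by blast
  from tendsto_diff[OF r(3) this] have xl: "(x \<circ> r) \<longlonglongrightarrow> l"
    by (simp add: o_def)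
  have "(h \<circ> (x \<circ> r)) \<longlonglongrightarrow> h l"
    using cont xl by (auto simp: continuous_on_eq_continuous_at continuous_at_sequentially)
  then have "h l = l"
    using r(3) LIMSEQ_unique by (auto simp: o_def)
  then show ?thesis by (rule that)
qed

section \<open>Isomorphisms between Banach spaces\<close>

lemma is_inverse_unique: "is_inverse T R \<Longrightarrow> is_inverse T R' \<Longrightarrow> R = R'"
  unfolding is_inverse_def by (metis blinfun_apply_blinfun_compose blinfun_apply_id_blinfun blinfun_eqI)

lemma is_inverse_blinfun_inverse: "T \<in> GL \<Longrightarrow> is_inverse T (blinfun_inverse T)"
  unfolding GL_def blinfun_inverse_def by (auto intro: theI is_inverse_unique)

lemma blinfun_inverse_eqI: "is_inverse T R \<Longrightarrow> blinfun_inverse T = R"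
  using is_inverse_unique is_inverse_blinfun_inverse unfolding GL_def by blast

lemma blinfun_inverse_left [simp]: "T \<in> GL \<Longrightarrow> blinfun_inverse T (T x) = x"
  using is_inverse_blinfun_inverse[of T] unfolding is_inverse_def
  by (metis blinfun_apply_blinfun_compose blinfun_apply_id_blinfun)

lemma blinfun_inverse_right [simp]: "T \<in> GL \<Longrightarrow> T (blinfun_inverse T y) = y"
  using is_inverse_blinfun_inverse[of T] unfolding is_inverse_def
  by (metis blinfun_apply_blinfun_compose blinfun_apply_id_blinfun)

lemma GL_I:
  assumes "\<And>x. blinfun_apply R (blinfun_apply T x) = x" "\<And>y. blinfun_apply T (blinfun_apply R y) = y"
  shows "T \<in> GL"
  using assms unfolding GL_def is_inverse_def by (auto intro!: exI[of _ R] blinfun_eqI)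

lemma blinfun_inverse_in_GL: "T \<in> GL \<Longrightarrow> blinfun_inverse T \<in> GL"
  by (rule GL_I[of T]) auto

lemma blinfun_compose_in_GL: "S \<in> GL \<Longrightarrow> T \<in> GL \<Longrightarrow> S o\<^sub>L T \<in> GL"
  by (rule GL_I[of "blinfun_inverse T o\<^sub>L blinfun_inverse S"]) auto

lemma GL_eq_0_iff: "T \<in> GL \<Longrightarrow> T x = 0 \<longleftrightarrow> x = 0"
  by (metis blinfun.zero_right blinfun_inverse_left)

text \<open>The maximum with 0 is for the trivial space, where the bound holds even with a negative
  \<open>M\<close>.\<close>

lemma bij_with_bound_in_GL:
  fixes T :: "'u::real_normed_vector \<Rightarrow>\<^sub>L 'v::real_normed_vector"
  assumes surj: "\<And>y. \<exists>x. T x = y" and bound: "\<And>x. norm x \<le> M * norm (T x)"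
  shows "T \<in> GL" "norm (blinfun_inverse T) \<le> max 0 M"
proof -
  have inj: "x = y" if "T x = T y" for x y
    using bound[of "x - y"] that by (simp add: blinfun.diff_right)
  define R where "R y = (SOME x. T x = y)" for y
  have TR: "T (R y) = y" for y
    unfolding R_def using surj by (rule someI_ex)
  have "bounded_linear R"
  proof (rule bounded_linear_intro[where K = M])
    show "R (x + y) = R x + R y" for x y
      by (rule inj) (simp add: TR blinfun.add_right)
    show "R (r *\<^sub>R x) = r *\<^sub>R R x" for r x
      by (rule inj) (simp add: TR blinfun.scaleR_right)
    show "norm (R x) \<le> norm x * M" for x
      using bound[of "R x"] by (simp add: TR mult.commute)
  qed
  then have R: "blinfun_apply (Blinfun R) = R"
    by (rule bounded_linear_Blinfun_apply)
  have RT: "R (T x) = x" for x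
    by (rule inj) (rule TR)
  show "T \<in> GL"
    by (rule GL_I[of "Blinfun R"]) (auto simp: R TR RT)
  have "blinfun_inverse T = Blinfun R"
    by (rule blinfun_inverse_eqI) (auto simp: is_inverse_def R TR RT intro!: blinfun_eqI)
  moreover have "norm (Blinfun R) \<le> max 0 M"
  proof (rule norm_blinfun_bound)
    fix y
    have "norm (R y) \<le> M * norm y" using bound[of "R y"] by (simp add: TR)
    also have "\<dots> \<le> max 0 M * norm y" by (rule mult_right_mono) auto
    finally show "norm (Blinfun R y) \<le> max 0 M * norm y" by (simp add: R)
  qed auto
  ultimately show "norm (blinfun_inverse T) \<le> max 0 M" by simp
qed

text \<open>In place of the Neumann series: with R the inverse of T, the map x -> R y - R ((S - T)
  x) is a contraction with constant 1/2, and its fixed point solves S x = y. The factor 2 is 1 / (1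
  - 1/2).\<close>

lemma GL_perturbation:
  fixes T S :: "'u::banach \<Rightarrow>\<^sub>L 'v::real_normed_vector"
  assumes T: "T \<in> GL" and small: "norm (S - T) * norm (blinfun_inverse T) \<le> 1/2"
  shows "S \<in> GL" "norm (blinfun_inverse S) \<le> 2 * norm (blinfun_inverse T)"
proof -
  let ?R = "blinfun_inverse T"
  have Q: "norm (?R ((S - T) x)) \<le> 1/2 * norm x" for x
  proof -
    have "norm (?R ((S - T) x)) \<le> norm ?R * (norm (S - T) * norm x)"
      by (meson norm_blinfun mult_left_mono norm_ge_zero order_trans)
    also have "\<dots> = (norm (S - T) * norm ?R) * norm x" by simp
    also have "\<dots> \<le> 1/2 * norm x" using small by (intro mult_right_mono) auto
    finally show ?thesis .
  qed
  have surj: "\<exists>x. S x = y" for y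
  proof -
    have "\<exists>!x. ?R y - ?R ((S - T) x) = x"
    proof (rule banach_fix_type[of "1/2"])
      show "\<forall>x x'. dist (?R y - ?R ((S - T) x)) (?R y - ?R ((S - T) x')) \<le> 1 / 2 * dist x x'"
      proof (intro allI)
        fix x x'
        have "dist (?R y - ?R ((S - T) x)) (?R y - ?R ((S - T) x')) = norm (?R ((S - T) (x - x')))"
          by (simp add: dist_norm blinfun.diff_right norm_minus_commute)
        then show "dist (?R y - ?R ((S - T) x)) (?R y - ?R ((S - T) x')) \<le> 1 / 2 * dist x x'"
          using Q[of "x - x'"] by (simp add: dist_norm)
      qed
    qed auto
    then obtain x where "?R y - ?R ((S - T) x) = x" by blast
    then have "T (?R y - ?R ((S - T) x)) = T x" by simp
    then have "S x = y"
      by (simp add: T blinfun.diff_right blinfun.diff_left)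
    then show ?thesis by blast
  qed
  have bound: "norm x \<le> (2 * norm ?R) * norm (S x)" for x
  proof -
    have "x = ?R (S x) - ?R ((S - T) x)"
      by (simp add: T blinfun.diff_right blinfun.diff_left)
    then have "norm x \<le> norm (?R (S x)) + norm (?R ((S - T) x))"
      by (metis norm_triangle_ineq4)
    also have "\<dots> \<le> norm ?R * norm (S x) + 1/2 * norm x"
      by (intro add_mono norm_blinfun Q)
    finally show ?thesis by simp
  qed
  show "S \<in> GL" "norm (blinfun_inverse S) \<le> 2 * norm ?R"
    using bij_with_bound_in_GL[OF surj bound] by auto
qed

lemma GL_neighbourhood:
  fixes T :: "'u::banach \<Rightarrow>\<^sub>L 'v::real_normed_vector"
  assumes T: "T \<in> GL"
  shows "\<exists>e>0. \<forall>S. dist S T < e \<longrightarrow> S \<in> GL \<and> norm (blinfun_inverse S) \<le> 2 * norm (blinfun_inverse T)"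
proof (intro exI conjI allI impI)
  let ?e = "1 / (2 * (1 + norm (blinfun_inverse T)))"
  show "?e > 0" by (simp add: add_pos_nonneg)
  fix S assume "dist S T < ?e"
  then have "norm (S - T) * norm (blinfun_inverse T) \<le> ?e * norm (blinfun_inverse T)"
    by (intro mult_right_mono) (auto simp: dist_norm)
  also have "\<dots> \<le> 1/2" by (simp add: field_simps add_pos_nonneg)
  finally show "S \<in> GL" "norm (blinfun_inverse S) \<le> 2 * norm (blinfun_inverse T)"
    using GL_perturbation[OF T] by auto
qed

lemma open_GL: "open (GL :: ('u::banach \<Rightarrow>\<^sub>L 'v::real_normed_vector) set)"
  using GL_neighbourhood unfolding open_dist by metis

lemma continuous_on_blinfun_inverse:
  "continuous_on (GL :: ('u::banach \<Rightarrow>\<^sub>L 'v::real_normed_vector) set) blinfun_inverse"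
  unfolding continuous_on_iff
proof (intro ballI allI impI)
  fix T :: "'u \<Rightarrow>\<^sub>L 'v" and \<epsilon> :: real assume T: "T \<in> GL" and "\<epsilon> > 0"
  obtain e where e: "e > 0" "\<And>S. dist S T < e \<Longrightarrow> norm (blinfun_inverse S) \<le> 2 * norm (blinfun_inverse T)"
    using GL_neighbourhood[OF T] by blast
  define m where "m = 2 * norm (blinfun_inverse T) * norm (blinfun_inverse T) + 1"
  have "m > 0" unfolding m_def by (simp add: add_nonneg_pos)
  show "\<exists>d>0. \<forall>S\<in>GL. dist S T < d \<longrightarrow> dist (blinfun_inverse S) (blinfun_inverse T) < \<epsilon>"
  proof (intro exI[of _ "min e (\<epsilon> / m)"] conjI ballI impI)
    show "0 < min e (\<epsilon> / m)" using e \<open>m > 0\<close> \<open>\<epsilon> > 0\<close> by auto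
    fix S assume S: "S \<in> GL" "dist S T < min e (\<epsilon> / m)"
    \<comment> \<open>The resolvent identity turns the bound on nearby inverses into
      continuity.\<close>
    have "blinfun_inverse S - blinfun_inverse T = blinfun_inverse S o\<^sub>L (T - S) o\<^sub>L blinfun_inverse T"
      by (rule blinfun_eqI) (simp add: S T blinfun.diff_left blinfun.diff_right)
    then have "dist (blinfun_inverse S) (blinfun_inverse T)
        \<le> norm (blinfun_inverse S o\<^sub>L (T - S)) * norm (blinfun_inverse T)"
      by (simp add: dist_norm norm_blinfun_compose)
    also have "\<dots> \<le> (norm (blinfun_inverse S) * norm (T - S)) * norm (blinfun_inverse T)"
      by (intro mult_right_mono norm_blinfun_compose) auto
    also have "\<dots> \<le> (2 * norm (blinfun_inverse T) * norm (T - S)) * norm (blinfun_inverse T)"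
      using e(2)[of S] S by (intro mult_right_mono) auto
    also have "\<dots> = (m - 1) * norm (T - S)" by (simp add: m_def)
    also have "\<dots> \<le> m * norm (T - S)" by (intro mult_right_mono) auto
    also have "\<dots> < \<epsilon>"
      using S(2) \<open>m > 0\<close> by (simp add: dist_norm norm_minus_commute field_simps)
    finally show "dist (blinfun_inverse S) (blinfun_inverse T) < \<epsilon>" .
  qed
qed

text \<open>Baire's theorem puts a ball into the closure of some T (cball 0 n). Differences of its
  points are approximate images with controlled preimages, and correcting the remaining error,
  halved each time, bounds the inverse.\<close>

theorem bounded_inverse_theorem:
  fixes T :: "'u::banach \<Rightarrow>\<^sub>L 'v::banach"
  assumes bij: "bij (blinfun_apply T)"
  shows "T \<in> GL"
proof -
  define C where "C n = closure (T ` cball 0 (real n))" for n :: nat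
  have "\<exists>n. interior (C n) \<noteq> {}"
  proof (rule ccontr)
    assume *: "\<nexists>n. interior (C n) \<noteq> {}"
    have "euclidean interior_of \<Union>(range C) = {}"
    proof (rule Baire_category_alt)
      show "completely_metrizable_space (euclidean :: 'v topology) \<or>
         locally_compact_space (euclidean :: 'v topology) \<and> regular_space (euclidean :: 'v topology)"
        by (simp add: completely_metrizable_space_euclidean)
    qed (use * in \<open>auto simp: C_def\<close>)
    moreover have "\<Union>(range C) = UNIV"
    proof (rule set_eqI, simp)
      fix y
      obtain x where x: "T x = y" using bij by (metis bij_pointE)
      obtain n :: nat where "norm x \<le> n" using real_arch_simple by blast
      then have "y \<in> C n" unfolding C_def
        using x by (intro subsetD[OF closure_subset]) auto
      then show "\<exists>n. y \<in> C n" by blast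
    qed
    ultimately show False by simp
  qed
  then obtain n y0 where "y0 \<in> interior (C n)" by blast
  then obtain r where r: "r > 0" "cball y0 r \<subseteq> C n"
    by (meson mem_interior_cball)
  \<comment> \<open>A vector y is rescaled to length r and written as a difference of two points of
    the ball around \<open>y0\<close>, each close to the image of a vector of norm at most n;
    scaling back multiplies 2 n by norm y / r.\<close>
  define M where "M = 2 * real n / r"
  have M0: "M \<ge> 0" using r by (simp add: M_def)
  have approx: "\<exists>x. norm x \<le> M * norm y \<and> norm (y - T x) \<le> norm y / 2" for y
  proof (cases "y = 0")
    case False
    define t where "t = r / norm y"
    have t: "t > 0" using False r by (simp add: t_def)
    have "y0 + t *\<^sub>R y \<in> C n" "y0 \<in> C n"
      using r False by (auto simp: subset_iff dist_norm t_def)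
    moreover have e4: "r / 4 > 0" using r by simp
    ultimately have "\<exists>y'\<in>T ` cball 0 (real n). dist y' (y0 + t *\<^sub>R y) < r / 4"
      "\<exists>y'\<in>T ` cball 0 (real n). dist y' y0 < r / 4"
      unfolding C_def closure_approachable by blast+
    then obtain a b where ab: "norm a \<le> n" "norm b \<le> n"
      "dist (T a) (y0 + t *\<^sub>R y) < r / 4" "dist (T b) y0 < r / 4"
      by auto
    define x where "x = inverse t *\<^sub>R (a - b)"
    have "norm (a - b) \<le> 2 * n" using ab norm_triangle_ineq4[of a b] by linarith
    then have "norm x \<le> inverse t * (2 * n)"
      using t by (simp add: x_def)
    also have "\<dots> = M * norm y" using r by (simp add: t_def M_def)
    finally have 1: "norm x \<le> M * norm y" .
    have "y - T x = inverse t *\<^sub>R ((y0 + t *\<^sub>R y - T a) - (y0 - T b))"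
      using t by (simp add: x_def blinfun.scaleR_right blinfun.diff_right algebra_simps)
    moreover have "norm ((y0 + t *\<^sub>R y - T a) - (y0 - T b)) \<le> r / 2"
      using ab(3,4) norm_triangle_ineq4[of "y0 + t *\<^sub>R y - T a" "y0 - T b"]
      by (simp add: dist_norm norm_minus_commute)
    ultimately have "norm (y - T x) \<le> inverse t * (r / 2)"
      using t by simp
    also have "\<dots> = norm y / 2" using r by (simp add: t_def)
    finally show ?thesis using 1 by blast
  qed (auto intro: exI[of _ 0])
  then obtain p where p: "\<And>y. norm (p y) \<le> M * norm y" "\<And>y. norm (y - T (p y)) \<le> norm y / 2"
    by metis
  have bound: "norm x \<le> (2 * M) * norm (T x)" for x
  proof -
    \<comment> \<open>\<open>y k\<close> is the error left after k corrections; the corrections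
      \<open>p (y k)\<close> are dominated by a geometric series and sum to the preimage.\<close>
    define y where "y k = ((\<lambda>y. y - T (p y)) ^^ k) (T x)" for k
    have y0: "y 0 = T x" and yS: "y (Suc k) = y k - T (p (y k))" for k
      by (auto simp: y_def)
    have ybd: "norm (y k) \<le> norm (T x) * (1/2) ^ k" for k
    proof (induction k)
      case (Suc k)
      then show ?case using p(2)[of "y k"] by (simp add: yS)
    qed (simp add: y0)
    have pbd: "norm (p (y k)) \<le> M * norm (T x) * (1/2) ^ k" for k
      using p(1)[of "y k"] mult_left_mono[OF ybd[of k] M0] by (simp add: mult.assoc)
    have sums: "(\<lambda>k. M * norm (T x) * (1/2::real) ^ k) sums (M * norm (T x) * 2)"
      using sums_mult[OF geometric_sums[of "1/2::real"], of "M * norm (T x)"] by simp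
    have sn: "summable (\<lambda>k. norm (p (y k)))"
      by (rule summable_comparison_test[OF _ sums_summable[OF sums]]) (use pbd in auto)
    have sp: "summable (\<lambda>k. p (y k))"
      by (rule summable_norm_cancel[OF sn])
    have "(\<Sum>k<m. T (p (y k))) = T x - y m" for m
      by (induction m) (auto simp: yS y0)
    moreover have "y \<longlonglongrightarrow> 0"
    proof (rule Lim_null_comparison)
      show "\<forall>\<^sub>F k in sequentially. norm (y k) \<le> norm (T x) * (1/2) ^ k"
        using ybd by simp
      show "(\<lambda>k. norm (T x) * (1/2) ^ k) \<longlonglongrightarrow> 0"
        by (auto intro!: tendsto_eq_intros LIMSEQ_power_zero)
    qed
    ultimately have "(\<lambda>k. T (p (y k))) sums (T x)"
      unfolding sums_def using tendsto_diff[OF tendsto_const[of "T x"]] by fastforce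
    moreover have "(\<lambda>k. T (p (y k))) sums T (\<Sum>k. p (y k))"
      using blinfun.bounded_linear_right sp by (rule bounded_linear.sums[OF _ summable_sums])
    ultimately have "T x = T (\<Sum>k. p (y k))" by (rule sums_unique2)
    then have "x = (\<Sum>k. p (y k))" using bij by (metis bij_pointE)
    then have "norm x \<le> (\<Sum>k. norm (p (y k)))" using summable_norm[OF sn] by simp
    also have "\<dots> \<le> M * norm (T x) * 2"
      using suminf_le[OF pbd sn sums_summable[OF sums]] sums_unique[OF sums] by simp
    finally show ?thesis by (simp add: algebra_simps)
  qed
  show ?thesis
    by (rule bij_with_bound_in_GL[OF _ bound]) (metis bij bij_pointE)
qed

text \<open>Partial functionals are encoded as graphs: subspaces of the product with the reals on
  which r \<le> norm x. On a subspace this one-sided bound gives \<bar>r\<bar> \<le> norm x, so such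
  a graph is automatically single-valued. The resulting functional takes the value norm \<phi> at
  \<phi> and is rescaled at the end.\<close>

theorem hahn_banach_point:
  fixes \<phi> :: "'u::real_normed_vector"
  assumes "\<phi> \<noteq> 0"
  obtains f :: "'u \<Rightarrow>\<^sub>L real" where "f \<phi> = 1"
proof -
  define \<A> where "\<A> = {G :: ('u \<times> real) set. subspace G \<and> (\<phi>, norm \<phi>) \<in> G \<and> (\<forall>(x,r)\<in>G. r \<le> norm x)}"
  have "span {(\<phi>, norm \<phi>)} \<in> \<A>"
  proof -
    have "r \<le> norm x" if xr: "(x, r) \<in> span {(\<phi>, norm \<phi>)}" for x r
    proof -
      obtain k where "x = k *\<^sub>R \<phi>" "r = k * norm \<phi>"
        using xr by (auto simp: span_singleton)
      then show ?thesis using mult_right_mono[OF abs_ge_self[of k], of "norm \<phi>"] by simp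
    qed
    then show ?thesis unfolding \<A>_def by (auto intro: span_base)
  qed
  then have "\<exists>M\<in>\<A>. \<forall>X\<in>\<A>. M \<subseteq> X \<longrightarrow> X = M"
  proof (intro subset_Zorn_nonempty)
    fix \<C> assume ne: "\<C> \<noteq> {}" and ch: "subset.chain \<A> \<C>"
    have sub: "\<C> \<subseteq> \<A>" and lin: "\<And>X Y. X \<in> \<C> \<Longrightarrow> Y \<in> \<C> \<Longrightarrow> X \<subseteq> Y \<or> Y \<subseteq> X"
      using ch by (auto simp: subset_chain_def)
    have "subspace (\<Union>\<C>)"
    proof (rule subspaceI)
      show "0 \<in> \<Union>\<C>" using ne sub by (force simp: \<A>_def intro: subspace_0)
      show "x + y \<in> \<Union>\<C>" if xy: "x \<in> \<Union>\<C>" "y \<in> \<Union>\<C>" for x y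
      proof -
        obtain X Y where XY: "X \<in> \<C>" "Y \<in> \<C>" "x \<in> X" "y \<in> Y" using xy by blast
        then obtain W where "W \<in> \<C>" "x \<in> W" "y \<in> W" using lin[of X Y] by blast
        then show ?thesis using sub by (auto simp: \<A>_def intro!: bexI[of _ W] subspace_add)
      qed
      show "c *\<^sub>R x \<in> \<Union>\<C>" if "x \<in> \<Union>\<C>" for c x
        using that sub unfolding \<A>_def by (blast intro: subspace_scale)
    qed
    then show "\<Union>\<C> \<in> \<A>" using ne sub unfolding \<A>_def by blast
  qed auto
  then obtain M where "M \<in> \<A>" and maximal: "\<And>X. X \<in> \<A> \<Longrightarrow> M \<subseteq> X \<Longrightarrow> X = M" by blast
  then have M: "subspace M" "(\<phi>, norm \<phi>) \<in> M" "\<And>x r. (x, r) \<in> M \<Longrightarrow> r \<le> norm x"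
    by (auto simp: \<A>_def)
  have Mabs: "\<bar>r\<bar> \<le> norm x" if "(x, r) \<in> M" for x r
    using M(3)[OF that] M(3)[of "-x" "-r"] subspace_neg[OF M(1) that] by auto
  have total: "\<exists>r. (x0, r) \<in> M" for x0
  proof -
    \<comment> \<open>A value at \<open>x0\<close> has to lie above every q - norm (y - x0) and
      below every norm (x + x0) - r. By \<open>key\<close> the two ranges leave room, and the
      supremum of the lower bounds is taken.\<close>
    define Q where "Q = (\<lambda>(y, q). q - norm (y - x0)) ` M"
    have key: "q - norm (y - x0) \<le> norm (x + x0) - r" if "(x, r) \<in> M" "(y, q) \<in> M" for x r y q
    proof -
      have "r + q \<le> norm (x + y)" using M(3) subspace_add[OF M(1) that] by simp
      also have "x + y = (x + x0) + (y - x0)" by simp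
      also have "norm \<dots> \<le> norm (x + x0) + norm (y - x0)" by (rule norm_triangle_ineq)
      finally show ?thesis by simp
    qed
    have Qne: "Q \<noteq> {}" using M(2) by (auto simp: Q_def)
    have Qle: "z \<le> norm (x + x0) - r" if "z \<in> Q" "(x, r) \<in> M" for z x r
      using that key by (auto simp: Q_def)
    then have Qbdd: "bdd_above Q" using M(2) by (meson bdd_aboveI)
    define a where "a = Sup Q"
    have a1: "a \<le> norm (x + x0) - r" if "(x, r) \<in> M" for x r
      unfolding a_def by (rule cSup_least[OF Qne]) (use Qle that in blast)
    have a2: "q - norm (y - x0) \<le> a" if "(y, q) \<in> M" for y q
      unfolding a_def by (rule cSup_upper[OF _ Qbdd]) (use that in \<open>auto simp: Q_def image_def intro!: bexI[of _ "(y,q)"]\<close>)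
    have "span (insert (x0, a) M) \<in> \<A>"
    proof -
      have "r \<le> norm x" if xr: "(x, r) \<in> span (insert (x0, a) M)" for x r
      proof -
        obtain t where "(x, r) - t *\<^sub>R (x0, a) \<in> span M"
          using xr by (auto simp: span_insert)
        then have t: "(x - t *\<^sub>R x0, r - t * a) \<in> M" (is "(?x, ?r) \<in> M")
          by (metis M(1) span_eq_iff diff_Pair real_scaleR_def scaleR_Pair)
        consider "t = 0" | "t > 0" | "t < 0" by linarith
        then show ?thesis
        proof cases
          case 1 then show ?thesis using t M(3) by simp
        next
          case 2
          have "((1/t) *\<^sub>R ?x, (1/t) * ?r) \<in> M" using subspace_scale[OF M(1) t, of "1/t"] by simp
          from a1[OF this] have "a * t \<le> (norm ((1/t) *\<^sub>R ?x + x0) - (1/t) * ?r) * t"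
            using 2 by (intro mult_right_mono) auto
          also have "\<dots> = norm (t *\<^sub>R ((1/t) *\<^sub>R ?x + x0)) - ?r"
            using 2 by (simp only: norm_scaleR) (simp add: algebra_simps)
          also have "t *\<^sub>R ((1/t) *\<^sub>R ?x + x0) = x"
            using 2 by (simp add: scaleR_add_right del: scaleR_right_diff_distrib)
          finally show ?thesis by (simp add: algebra_simps)
        next
          case 3
          define s where "s = - t"
          have s: "s > 0" "t = - s" using 3 by (auto simp: s_def)
          have "((1/s) *\<^sub>R ?x, (1/s) * ?r) \<in> M" using subspace_scale[OF M(1) t, of "1/s"] by simp
          from a2[OF this] have "((1/s) * ?r - norm ((1/s) *\<^sub>R ?x - x0)) * s \<le> a * s"
            using s(1) by (intro mult_right_mono) auto
          moreover have "((1/s) * ?r - norm ((1/s) *\<^sub>R ?x - x0)) * s = ?r - norm (s *\<^sub>R ((1/s) *\<^sub>R ?x - x0))"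
            using s(1) by (simp only: norm_scaleR) (simp add: algebra_simps)
          moreover have "s *\<^sub>R ((1/s) *\<^sub>R ?x - x0) = x"
            using s by (simp add: algebra_simps)
          ultimately show ?thesis using s(2) by (simp add: algebra_simps)
        qed
      qed
      then show ?thesis using M(2) by (auto simp: \<A>_def intro: span_base)
    qed
    from maximal[OF this] have "span (insert (x0, a) M) = M"
      by (meson order_trans span_superset subset_insertI)
    then show ?thesis by (metis insertI1 span_base)
  qed
  define g where "g x = (THE r. (x, r) \<in> M)" for x
  have uniq: "r = q" if "(x, r) \<in> M" "(x, q) \<in> M" for x r q
    using Mabs[of 0 "r - q"] subspace_diff[OF M(1) that] by simp
  have gM: "(x, g x) \<in> M" for x
    unfolding g_def using total[of x] uniq by (metis theI)
  have geq: "g x = r" if "(x, r) \<in> M" for x r using uniq[OF gM that] .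
  have "bounded_linear g"
  proof (rule bounded_linear_intro[where K = 1])
    show "g (x + y) = g x + g y" for x y
      using subspace_add[OF M(1) gM[of x] gM[of y]] by (intro geq) simp
    show "g (r *\<^sub>R x) = r *\<^sub>R g x" for r x
      using subspace_scale[OF M(1) gM[of x], of r] by (intro geq) simp
    show "norm (g x) \<le> norm x * 1" for x using Mabs[OF gM] by simp
  qed
  then have "blinfun_apply ((1 / norm \<phi>) *\<^sub>R Blinfun g) \<phi> = 1"
    using geq[OF M(2)] assms by (simp add: bounded_linear_Blinfun_apply blinfun.scaleR_left)
  then show ?thesis by (rule that)
qed

section \<open>Fredholm operators of index zero\<close>

text \<open>Projection along S onto W2 is linear, and injective on W1 because its kernel S meets W1
  trivially. This is what gives the definite description in \<open>codim\<close> a meaning.\<close>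

lemma complementary_dim_le:
  fixes S :: "'a::real_vector set"
  assumes W: "fin_dim W1" "fin_dim W2" and c1: "complementary S W1" and c2: "complementary S W2"
  shows "dim W1 \<le> dim W2"
proof -
  have sub: "subspace S" "subspace W1" "subspace W2" and int1: "S \<inter> W1 = {0}" and int2: "S \<inter> W2 = {0}"
    and ex: "\<And>v. \<exists>a\<in>S. \<exists>b\<in>W2. v = a + b"
    using c1 c2 by (auto simp: complementary_def)
  define q where "q v = (SOME b. b \<in> W2 \<and> v - b \<in> S)" for v
  have q: "q v \<in> W2" "v - q v \<in> S" for v
  proof -
    obtain a b where "a \<in> S" "b \<in> W2" "v = a + b" using ex[of v] by blast
    then have "\<exists>b. b \<in> W2 \<and> v - b \<in> S" by (intro exI[of _ b]) auto
    from someI_ex[OF this] show "q v \<in> W2" "v - q v \<in> S" by (auto simp: q_def)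
  qed
  have uniq: "q v = b" if "b \<in> W2" "v - b \<in> S" for v b
  proof -
    have "q v - b \<in> W2" by (rule subspace_diff[OF sub(3) q(1) that(1)])
    moreover have "(v - b) - (v - q v) \<in> S" by (rule subspace_diff[OF sub(1) that(2) q(2)])
    ultimately have "q v - b \<in> S \<inter> W2" by simp
    then show ?thesis using int2 by auto
  qed
  have lin: "linear q"
  proof (rule linearI)
    show "q (x + y) = q x + q y" for x y
      using subspace_add[OF sub(1) q(2)[of x] q(2)[of y]] subspace_add[OF sub(3) q(1)[of x] q(1)[of y]]
      by (intro uniq) (auto simp: algebra_simps)
    show "q (r *\<^sub>R x) = r *\<^sub>R q x" for r x
      using subspace_scale[OF sub(1) q(2)[of x]] subspace_scale[OF sub(3) q(1)[of x]]
      by (intro uniq) (auto simp: algebra_simps)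
  qed
  obtain B1 where B1: "B1 \<subseteq> W1" "independent B1" "W1 \<subseteq> span B1" "card B1 = dim W1"
    using basis_exists by blast
  obtain B2 where B2: "B2 \<subseteq> W2" "independent B2" "W2 \<subseteq> span B2" "card B2 = dim W2"
    using basis_exists by blast
  obtain C2 where "finite C2" "W2 = span C2" using W(2) by (auto simp: fin_dim_def)
  then have "finite B2" using B2 independent_span_bound by blast
  have "span B1 = W1" using B1 sub(2) by (metis span_minimal subset_antisym)
  have inj: "inj_on q (span B1)"
  proof (rule inj_onI)
    fix x y assume "x \<in> span B1" "y \<in> span B1" "q x = q y"
    then have "q (x - y) = 0" "x - y \<in> W1"
      using \<open>span B1 = W1\<close> sub(2) lin by (auto simp: linear_diff subspace_diff)
    then have "x - y \<in> S \<inter> W1" using q(2)[of "x - y"] by simp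
    then show "x = y" using int1 by auto
  qed
  have "independent (q ` B1)" using linear_independent_injective_image[OF lin B1(2) inj] .
  moreover have "q ` B1 \<subseteq> span B2" using q B2(3) by auto
  ultimately have "card (q ` B1) \<le> card B2"
    using independent_span_bound[OF \<open>finite B2\<close>] by blast
  moreover have "card (q ` B1) = card B1"
    by (rule card_image) (rule inj_on_subset[OF inj span_superset])
  ultimately show ?thesis using B1 B2 by simp
qed

lemma codim_eq:
  assumes "fin_dim W" "complementary S W"
  shows "codim S = dim W"
  unfolding codim_def using assms complementary_dim_le by (intro the_equality) (auto intro: antisym)

lemma fin_dim_basis:
  assumes "fin_dim W"
  obtains B where "finite B" "independent B" "W = span B" "card B = dim W"
proof -
  obtain C where C: "finite C" "W = span C" using assms by (auto simp: fin_dim_def)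
  obtain B where B: "B \<subseteq> W" "independent B" "W \<subseteq> span B" "card B = dim W"
    using basis_exists by blast
  have "finite B" using B C independent_span_bound by blast
  moreover have "W = span B"
    using B C by (metis span_minimal subset_antisym subspace_span)
  ultimately show ?thesis using B that by blast
qed

section \<open>Invertible perturbations of index-zero operators\<close>

lemma Phi0_bases:
  assumes "T \<in> Phi0"
  obtains B C where "finite B" "independent B" "null_space T = span B"
    "finite C" "independent C" "complementary (range T) (span C)" "card C = card B"
proof -
  have f: "fredholm T" "fredholm_index T = 0" using assms by (auto simp: Phi0_def)
  obtain B where B: "finite B" "independent B" "null_space T = span B" "card B = dim (null_space T)"
    using f(1) fin_dim_basis unfolding fredholm_def by metis
  obtain W where W: "fin_dim W" "complementary (range T) W"
    using f(1) unfolding fredholm_def fin_codim_def by blast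
  obtain C where C: "finite C" "independent C" "W = span C" "card C = dim W"
    using fin_dim_basis[OF W(1)] .
  have "dim W = dim (null_space T)"
    using f(2) codim_eq[OF W] by (simp add: fredholm_index_def)
  then show ?thesis using that B C W by metis
qed

lemma subspace_null_space: "subspace (null_space T)"
  by (auto simp: null_space_def subspace_def blinfun.add_right blinfun.scaleR_right)

lemma subspace_range_blinfun: "subspace (range (blinfun_apply T))"
  by (rule linear_subspace_image) (auto intro: bounded_linear.linear blinfun.bounded_linear_right)

text \<open>Induction on the kernel dimension: adding the rank-one map u -> f(u) v, with f(\<phi>) =
  1 for a kernel vector \<phi> and v from the complement of the range, lowers the dimensions of
  kernel and cokernel by one. Compactness is recorded as one compact set containing the image of the
  unit ball, the form in which parametrices use it.\<close>

lemma finite_rank_perturbation_in_GL: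
  fixes T :: "'u::banach \<Rightarrow>\<^sub>L 'v::banach"
  assumes "finite B" "independent B" "null_space T = span B"
    "finite C" "independent C" "complementary (range T) (span C)" "card C = card B"
  shows "\<exists>K \<K>. T + K \<in> GL \<and> compact \<K> \<and> (\<forall>u. norm u \<le> 1 \<longrightarrow> blinfun_apply K u \<in> \<K>)"
  using assms
proof (induction "card B" arbitrary: T B C)
  case 0
  then have e: "B = {}" "C = {}" by auto
  have "x = y" if "T x = T y" for x y
  proof -
    have "x - y \<in> null_space T" using that by (simp add: null_space_def blinfun.diff_right)
    then show ?thesis using 0(4) e by simp
  qed
  moreover have "y \<in> range T" for y
    using 0(7) e by (auto simp: complementary_def)
  ultimately have "bij (blinfun_apply T)" by (auto simp: bij_def inj_def)
  then have "T + 0 \<in> GL" using bounded_inverse_theorem by simp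
  then show ?case by (intro exI[of _ 0] exI[of _ "{0}"]) auto
next
  case (Suc n)
  obtain \<phi> B' where B': "B = insert \<phi> B'" "\<phi> \<notin> B'" "card B' = n" using Suc(2) by (metis card_Suc_eq)
  obtain v C' where C': "C = insert v C'" "v \<notin> C'" "card C' = n" using Suc(2,9) by (metis card_Suc_eq)
  have ind: "independent B'" "\<phi> \<notin> span B'" "independent C'" "v \<notin> span C'"
    using Suc(4,7) B'(1,2) C'(1,2) by (simp_all add: independent_insert)
  have compl: "range T \<inter> span C = {0}" "\<And>x. \<exists>a\<in>range T. \<exists>b\<in>span C. x = a + b"
    using Suc(8) by (auto simp: complementary_def)
  have "\<phi> \<noteq> 0" "v \<noteq> 0" using ind span_0 by metis+
  obtain f :: "'u \<Rightarrow>\<^sub>L real" where f: "f \<phi> = 1" using hahn_banach_point[OF \<open>\<phi> \<noteq> 0\<close>] .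
  define K1 where "K1 = blinfun_scaleR_left v o\<^sub>L f"
  have K1: "K1 u = f u *\<^sub>R v" for u by (simp add: K1_def)
  have T\<phi>: "T \<phi> = 0" using Suc(5) B'(1) span_base[of \<phi> B] by (auto simp: null_space_def)
  define T' where "T' = T + K1"
  have T': "T' u = T u + f u *\<^sub>R v" for u by (simp add: T'_def K1 blinfun.add_left)
  \<comment> \<open>f need not vanish on the other kernel vectors; subtracting f(b) \<phi> turns
    them into kernel vectors of \<open>T'\<close>.\<close>
  define g where "g b = b - f b *\<^sub>R \<phi>" for b
  have lin: "linear g"
    by (rule linearI) (auto simp: g_def blinfun.add_right blinfun.scaleR_right algebra_simps)
  have inj: "inj_on g (span B')"
  proof (rule inj_onI)
    fix x y assume xy: "x \<in> span B'" "y \<in> span B'" "g x = g y"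
    then have 1: "x - y = f (x - y) *\<^sub>R \<phi>" by (auto simp: g_def blinfun.diff_right algebra_simps)
    have 2: "x - y \<in> span B'" using xy by (simp add: span_diff)
    have "f (x - y) = 0"
    proof (rule ccontr)
      assume "f (x - y) \<noteq> 0"
      then have "\<phi> = (1 / f (x - y)) *\<^sub>R (x - y)" using 1 by (metis divide_self_if real_vector.scale_one scaleR_scaleR times_divide_eq_left mult_1)
      then show False using 2 ind(2) span_scale by metis
    qed
    then show "x = y" using 1 by simp
  qed
  have null: "null_space T' = span (g ` B')"
  proof
    show "null_space T' \<subseteq> span (g ` B')"
    proof
      fix u assume "u \<in> null_space T'"
      then have Tu: "T u = - f u *\<^sub>R v" by (simp add: null_space_def T' eq_neg_iff_add_eq_0)
      moreover have "- f u *\<^sub>R v \<in> span C" using C' by (intro span_scale span_base) auto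
      ultimately have "T u \<in> range T \<inter> span C" by (metis IntI rangeI)
      then have "T u = 0" using compl by auto
      then have "f u = 0" using Tu \<open>v \<noteq> 0\<close> by simp
      have "u \<in> span B" using Suc(5) \<open>T u = 0\<close> by (auto simp: null_space_def)
      then obtain k where k: "u - k *\<^sub>R \<phi> \<in> span B'" using B'(1) by (auto simp: span_insert)
      have "g (u - k *\<^sub>R \<phi>) = u" using f \<open>f u = 0\<close> by (simp add: g_def blinfun.diff_right blinfun.scaleR_right)
      then show "u \<in> span (g ` B')" using k by (metis imageI lin linear_span_image)
    qed
    have "g b \<in> null_space T'" if "b \<in> B'" for b
    proof -
      have "T b = 0" using Suc(5) B'(1) span_base[of b B] that by (auto simp: null_space_def)
      then show ?thesis using T\<phi> f by (simp add: null_space_def T' g_def blinfun.diff_right blinfun.scaleR_right)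
    qed
    then show "span (g ` B') \<subseteq> null_space T'"
      by (intro span_minimal subspace_null_space) auto
  qed
  have rng: "complementary (range T') (span C')"
    unfolding complementary_def
  proof (intro conjI subspace_range_blinfun subspace_span allI)
    show "range T' \<inter> span C' = {0}"
    proof
      show "range T' \<inter> span C' \<subseteq> {0}"
      proof clarify
        fix u assume u: "T' u \<in> span C'"
        then have "T' u \<in> span C" using C'(1) span_mono by blast
        moreover have "f u *\<^sub>R v \<in> span C" using C'(1) by (intro span_scale span_base) auto
        ultimately have "T u \<in> span C" using T'[of u] by (metis add_diff_cancel_right' span_diff)
        then have "T u = 0" using compl(1) by auto
        then have fv: "f u *\<^sub>R v \<in> span C'" using u by (simp add: T')
        have "f u = 0"
        proof (rule ccontr)
          assume "f u \<noteq> 0"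
          then show False using span_scale[OF fv, of "1 / f u"] ind(4) by simp
        qed
        then show "T' u = 0" using \<open>T u = 0\<close> by (simp add: T')
      qed
      show "{0} \<subseteq> range T' \<inter> span C'"
        by (auto simp: span_0 intro!: image_eqI[of _ _ 0])
    qed
    fix x
    obtain u c where uc: "c \<in> span C" "x = T u + c" using compl(2)[of x] by blast
    then obtain k where k: "c - k *\<^sub>R v \<in> span C'" using C'(1) by (auto simp: span_insert)
    \<comment> \<open>Replacing the \<phi> component of u by k does not change T u, since T \<phi> =
      0, but gives f the value k.\<close>
    have "T' (u - f u *\<^sub>R \<phi> + k *\<^sub>R \<phi>) = T u + k *\<^sub>R v"
      by (simp add: T' blinfun.add_right blinfun.diff_right blinfun.scaleR_right f T\<phi>)
    then have "x = T' (u - f u *\<^sub>R \<phi> + k *\<^sub>R \<phi>) + (c - k *\<^sub>R v)" using uc by simp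
    then show "\<exists>a\<in>range T'. \<exists>b\<in>span C'. x = a + b" using k by blast
  qed
  have "card (g ` B') = n"
    using B'(3) inj by (metis card_image inj_on_subset span_superset)
  moreover have "independent (g ` B')"
    using linear_independent_injective_image[OF lin ind(1) inj] .
  moreover have "finite B'" "finite C'" using Suc(3,6) B'(1) C'(1) by auto
  ultimately obtain K \<K> where K: "T' + K \<in> GL" "compact \<K>" "\<And>u. norm u \<le> 1 \<Longrightarrow> K u \<in> \<K>"
    using Suc(1)[of "g ` B'" T' C'] null rng ind C'(3) by auto
  define \<K>' where "\<K>' = {a + b |a b. a \<in> (\<lambda>t. t *\<^sub>R v) ` {- norm f..norm f} \<and> b \<in> \<K>}"
  have "compact \<K>'"
    unfolding \<K>'_def by (intro compact_sums compact_continuous_image continuous_intros K) auto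
  moreover have "(K1 + K) u \<in> \<K>'" if "norm u \<le> 1" for u
  proof -
    have "\<bar>f u\<bar> \<le> norm f" using norm_blinfun[of f u] mult_left_mono[OF that, of "norm f"] by simp
    then have "f u *\<^sub>R v \<in> (\<lambda>t. t *\<^sub>R v) ` {- norm f..norm f}" by (intro imageI) auto
    then show ?thesis unfolding \<K>'_def using K(3)[OF that] by (auto simp: blinfun.add_left K1)
  qed
  moreover have "T + (K1 + K) \<in> GL" using K(1) by (simp add: T'_def add.assoc)
  ultimately show ?case by blast
qed

lemma Phi0_perturbation_in_GL:
  fixes T :: "'u::banach \<Rightarrow>\<^sub>L 'v::banach"
  assumes "T \<in> Phi0"
  obtains K \<K> where "T + K \<in> GL" "compact \<K>" "\<And>u. norm u \<le> 1 \<Longrightarrow> blinfun_apply K u \<in> \<K>"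
  using Phi0_bases[OF assms] finite_rank_perturbation_in_GL by metis

lemma GL_subset_Phi0: "GL \<subseteq> Phi0"
proof
  fix T :: "'u::real_normed_vector \<Rightarrow>\<^sub>L 'v::real_normed_vector" assume T: "T \<in> GL"
  have null: "null_space T = span {}" using T by (auto simp: null_space_def GL_eq_0_iff)
  have rng: "range (blinfun_apply T) = UNIV" using T by (metis blinfun_inverse_right surjI)
  have c: "complementary (UNIV :: 'v set) (span {})" by (auto simp: complementary_def)
  have fd: "fin_dim (span {} :: 'v set)" "fin_dim (span {} :: 'u set)" unfolding fin_dim_def by blast+
  show "T \<in> Phi0"
    unfolding Phi0_def fredholm_def fredholm_index_def fin_codim_def
    using null rng c fd codim_eq[OF fd(1) c]
    by (auto simp: dim_span dim_eq_card_independent independent_empty simp del: span_empty)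
qed

text \<open>With respect to ker f and the line of \<phi>, T is B after a map that fixes ker f and
  sends \<phi> to q; the determinant of that map is f q. If f q = 0, the kernel is spanned by \<phi>
  - q and the range is B (ker f), of codimension one, so the index is still zero.\<close>

lemma Phi0_rank_one:
  fixes T :: "'u::banach \<Rightarrow>\<^sub>L 'v::banach"
  assumes B: "B \<in> GL" and T: "\<And>u. T u = B (u - blinfun_apply f u *\<^sub>R \<phi> + f u *\<^sub>R q)" and f: "f \<phi> = 1"
  shows "f q \<noteq> 0 \<Longrightarrow> T \<in> GL" "T \<in> Phi0"
proof -
  have T0: "T u = 0 \<longleftrightarrow> u = f u *\<^sub>R (\<phi> - q)" for u
    using B by (auto simp: T GL_eq_0_iff algebra_simps)
  show GL: "T \<in> GL" if q: "f q \<noteq> 0"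
  proof (rule bounded_inverse_theorem)
    have "inj T"
    proof (rule injI)
      fix x y assume "T x = T y"
      then have "T (x - y) = 0" by (simp add: blinfun.diff_right)
      then have *: "x - y = f (x - y) *\<^sub>R (\<phi> - q)" using T0 by blast
      then have "f (x - y) = f (x - y) * (1 - f q)"
        by (metis blinfun.diff_right blinfun.scaleR_right f real_scaleR_def)
      then have "f (x - y) = 0" using q by (simp add: algebra_simps)
      then show "x = y" using * by simp
    qed
    moreover have "\<exists>u. T u = y" for y
    proof -
      define w where "w = blinfun_inverse B y"
      define s where "s = f w / f q"
      define u where "u = w - s *\<^sub>R q + s *\<^sub>R \<phi>"
      have "f u = s" using q by (simp add: u_def s_def blinfun.diff_right blinfun.add_right blinfun.scaleR_right f)
      then have "T u = B w" unfolding T by (simp add: u_def)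
      then show ?thesis using B by (auto simp: w_def)
    qed
    ultimately show "bij T" by (auto simp: bij_def) (metis rangeI)
  qed
  show "T \<in> Phi0"
  proof (cases "f q = 0")
    case True
    define n where "n = \<phi> - q"
    have fn: "f n = 1" using True f by (simp add: n_def blinfun.diff_right)
    then have "n \<noteq> 0" by auto
    have null: "null_space T = span {n}"
    proof
      show "null_space T \<subseteq> span {n}"
        unfolding null_space_def using T0 by (auto simp: n_def span_singleton)
      show "span {n} \<subseteq> null_space T"
        by (rule span_minimal) (auto simp: subspace_null_space, auto simp: null_space_def T0 fn simp flip: n_def)
    qed
    have rng: "range T = {y. f (blinfun_inverse B y) = 0}"
    proof (intro set_eqI iffI)
      fix y assume "y \<in> {y. f (blinfun_inverse B y) = 0}"
      then have "T (blinfun_inverse B y) = y" using B by (simp add: T)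
      then show "y \<in> range T" by (metis rangeI)
    qed (auto simp: T B blinfun.add_right blinfun.diff_right blinfun.scaleR_right f True)
    have clo: "closed (range T)"
    proof -
      have "continuous_on UNIV (\<lambda>y. f (blinfun_inverse B y))" by (intro continuous_intros)
      then show ?thesis unfolding rng by (intro closed_Collect_eq continuous_on_const)
    qed
    have indB: "B \<phi> \<noteq> 0" using B f by (auto simp: GL_eq_0_iff)
    have compl: "complementary (range T) (span {B \<phi>})"
      unfolding complementary_def
    proof (intro conjI subspace_range_blinfun subspace_span allI)
      show "range T \<inter> span {B \<phi>} = {0}"
        by (auto simp: rng span_singleton blinfun.scaleR_right B f)
      fix v
      define c where "c = f (blinfun_inverse B v)"
      have "v - c *\<^sub>R B \<phi> \<in> range T"
        unfolding rng by (simp add: blinfun.diff_right blinfun.scaleR_right B f c_def)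
      moreover have "c *\<^sub>R B \<phi> \<in> span {B \<phi>}" by (auto simp: span_singleton)
      ultimately show "\<exists>a\<in>range T. \<exists>b\<in>span {B \<phi>}. v = a + b"
        by (metis add.commute diff_add_cancel)
    qed
    have fd: "fin_dim (span {B \<phi>})" "fin_dim (span {n})" unfolding fin_dim_def by blast+
    have "dim (span {B \<phi>}) = 1" "dim (span {n}) = 1"
      using indB \<open>n \<noteq> 0\<close> by (auto simp: dim_eq_card_independent dim_span)
    then show ?thesis
      unfolding Phi0_def fredholm_def fredholm_index_def fin_codim_def
      using null clo compl fd codim_eq[OF fd(1) compl] by auto
  qed (use GL GL_subset_Phi0 in blast)
qed

section \<open>Irreducible continua\<close>

text \<open>Suppose P and Q separate the rest. The closed proper subset P with a and b added is
  disconnected by irreducibility, and a and b lie on different sides. The same holds for Q. The two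
  sides containing a and the two sides containing b together separate X.\<close>

lemma irreducible_continuum_delete_two:
  assumes X: "connected_space X" and t1: "t1_space X"
    and ab: "a \<in> topspace X" "b \<in> topspace X" "a \<noteq> b"
    and irr: "\<And>H. closedin X H \<Longrightarrow> connectedin X H \<Longrightarrow> a \<in> H \<Longrightarrow> b \<in> H \<Longrightarrow> H = topspace X"
  shows "connectedin X (topspace X - {a, b})"
proof -
  let ?Y = "topspace X - {a, b}"
  have opY: "openin X ?Y" using t1 ab by (intro openin_diff) (auto simp: closedin_t1_singleton t1_space_closedin_finite)
  have main: False if PQ: "openin X P" "openin X Q" "P \<union> Q = ?Y" "P \<inter> Q = {}" "P \<noteq> {}" "Q \<noteq> {}" for P Q
  proof -
    have half: "\<exists>A B. closedin X A \<and> closedin X B \<and> a \<in> A \<and> b \<in> B \<and> A \<inter> B = {} \<and> A \<union> B = insert a (insert b P)"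
      if PQ: "openin X P" "openin X Q" "P \<union> Q = ?Y" "P \<inter> Q = {}" "P \<noteq> {}" "Q \<noteq> {}" for P Q
    proof -
      let ?H = "insert a (insert b P)"
      have sub: "?H \<subseteq> topspace X" using ab PQ by auto
      have "?H = topspace X - Q" using ab PQ by auto
      then have clo: "closedin X ?H" using PQ(2) by (metis openin_closedin_eq)
      have "?H \<noteq> topspace X" using PQ by auto
      then have "\<not> connectedin X ?H" using irr[OF clo] by blast
      then obtain E1 E2 where E: "closedin X E1" "closedin X E2" "?H \<subseteq> E1 \<union> E2"
        "E1 \<inter> E2 \<inter> ?H = {}" "E1 \<inter> ?H \<noteq> {}" "E2 \<inter> ?H \<noteq> {}"
        unfolding connectedin_closedin using sub by blast
      have cl: "closedin X (E1 \<inter> ?H)" "closedin X (E2 \<inter> ?H)" using E clo by auto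
      \<comment> \<open>A side without a and b lies in P, and its complement is a union of two
        closed sets, so it would be clopen in X.\<close>
      have noab: False if E: "closedin X E1" "closedin X E2" "?H \<subseteq> E1 \<union> E2"
        "E1 \<inter> E2 \<inter> ?H = {}" "E1 \<inter> ?H \<noteq> {}" "E2 \<inter> ?H \<noteq> {}" "a \<in> E1" "b \<in> E1" for E1 E2
      proof -
        have "a \<notin> E2" "b \<notin> E2" using E by auto
        have c2: "closedin X (E2 \<inter> ?H)" using E(2) clo by auto
        have "topspace X - (E2 \<inter> ?H) = (topspace X - P) \<union> (E1 \<inter> ?H)"
          using E(3,4) \<open>a \<notin> E2\<close> \<open>b \<notin> E2\<close> sub by auto
        moreover have "closedin X (E1 \<inter> ?H)" using E(1) clo by (rule closedin_Int)
        moreover have "closedin X (topspace X - P)" using PQ(1) by (metis openin_closedin_eq)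
        ultimately have "closedin X (topspace X - (E2 \<inter> ?H))"
          by (metis closedin_Un)
        then have "openin X (E2 \<inter> ?H)"
          using c2 by (metis openin_closedin_eq closedin_subset)
        then have "E2 \<inter> ?H = {} \<or> E2 \<inter> ?H = topspace X"
          using c2 X connected_space_clopen_in by blast
        then show False using E(6) ab \<open>a \<notin> E2\<close> by blast
      qed
      have iu: "(E1 \<inter> ?H) \<inter> (E2 \<inter> ?H) = {}" "(E1 \<inter> ?H) \<union> (E2 \<inter> ?H) = ?H"
        using E(3,4) by blast+
      have "a \<in> E1 \<or> a \<in> E2" "b \<in> E1 \<or> b \<in> E2" using E(3) by auto
      moreover have "\<not> (a \<in> E1 \<and> b \<in> E1)" using noab[of E1 E2] E by blast
      moreover have "\<not> (a \<in> E2 \<and> b \<in> E2)"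
      proof
        assume "a \<in> E2 \<and> b \<in> E2"
        then show False using noab[of E2 E1] E by (metis Int_commute Un_commute)
      qed
      ultimately consider "a \<in> E1" "b \<in> E2" | "a \<in> E2" "b \<in> E1" by blast
      then show ?thesis
      proof cases
        case 1
        have "closedin X (E1 \<inter> ?H) \<and> closedin X (E2 \<inter> ?H) \<and> a \<in> E1 \<inter> ?H \<and> b \<in> E2 \<inter> ?H
            \<and> (E1 \<inter> ?H) \<inter> (E2 \<inter> ?H) = {} \<and> (E1 \<inter> ?H) \<union> (E2 \<inter> ?H) = ?H"
          by (intro conjI cl) (use 1 iu in \<open>blast+\<close>)
        then show ?thesis by (rule exI[of _ "E1 \<inter> ?H", OF exI[of _ "E2 \<inter> ?H"]])
      next
        case 2
        have "closedin X (E2 \<inter> ?H) \<and> closedin X (E1 \<inter> ?H) \<and> a \<in> E2 \<inter> ?H \<and> b \<in> E1 \<inter> ?H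
            \<and> (E2 \<inter> ?H) \<inter> (E1 \<inter> ?H) = {} \<and> (E2 \<inter> ?H) \<union> (E1 \<inter> ?H) = ?H"
          by (intro conjI cl) (use 2 iu in \<open>blast+\<close>)
        then show ?thesis by (rule exI[of _ "E2 \<inter> ?H", OF exI[of _ "E1 \<inter> ?H"]])
      qed
    qed
    obtain A B where AB: "closedin X A" "closedin X B" "a \<in> A" "b \<in> B" "A \<inter> B = {}" "A \<union> B = insert a (insert b P)"
      using half[OF PQ] by blast
    have QP: "Q \<union> P = ?Y" "Q \<inter> P = {}" using PQ(3,4) by auto
    obtain A' B' where AB': "closedin X A'" "closedin X B'" "a \<in> A'" "b \<in> B'" "A' \<inter> B' = {}" "A' \<union> B' = insert a (insert b Q)"
      using half[OF PQ(2,1) QP PQ(6,5)] by blast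
    have "A \<union> A' \<union> (B \<union> B') = (A \<union> B) \<union> (A' \<union> B')" by blast
    also have "\<dots> = insert a (insert b (P \<union> Q))" unfolding AB(6) AB'(6) by blast
    also have "\<dots> = topspace X" unfolding PQ(3) using ab by blast
    finally have "A \<union> A' \<union> (B \<union> B') = topspace X" .
    moreover have "(A \<union> A') \<inter> (B \<union> B') = {}"
    proof -
      have "A \<inter> B' \<subseteq> {}"
      proof
        fix x assume x: "x \<in> A \<inter> B'"
        then have "x \<in> insert a (insert b P)" "x \<in> insert a (insert b Q)" using AB(6) AB'(6) by blast+
        then have "x = a \<or> x = b" using PQ(4) by blast
        then show "x \<in> {}" using x AB AB' by blast
      qed
      moreover have "A' \<inter> B \<subseteq> {}"
      proof
        fix x assume x: "x \<in> A' \<inter> B"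
        then have "x \<in> insert a (insert b P)" "x \<in> insert a (insert b Q)" using AB(6) AB'(6) by blast+
        then have "x = a \<or> x = b" using PQ(4) by blast
        then show "x \<in> {}" using x AB AB' by blast
      qed
      ultimately show ?thesis using AB(5) AB'(5) by blast
    qed
    moreover have "closedin X (A \<union> A')" "closedin X (B \<union> B')" using AB AB' by auto
    ultimately show False
      using X AB(3,4) unfolding connected_space_closedin by blast
  qed
  show ?thesis
    unfolding connectedin
  proof (intro conjI notI)
    assume "\<exists>E1 E2. openin X E1 \<and> openin X E2 \<and> ?Y \<subseteq> E1 \<union> E2 \<and> E1 \<inter> E2 \<inter> ?Y = {} \<and> E1 \<inter> ?Y \<noteq> {} \<and> E2 \<inter> ?Y \<noteq> {}"
    then obtain E1 E2 where E: "openin X E1" "openin X E2" "?Y \<subseteq> E1 \<union> E2" "E1 \<inter> E2 \<inter> ?Y = {}" "E1 \<inter> ?Y \<noteq> {}" "E2 \<inter> ?Y \<noteq> {}"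
      by blast
    show False
      by (rule main[of "E1 \<inter> ?Y" "E2 \<inter> ?Y"]) (use E opY in \<open>auto intro: openin_Int\<close>)
  qed auto
qed

text \<open>By normality a separation of the intersection spreads to disjoint open sets U and V.
  Each member of the chain meets both, so being connected it is not covered by them, and by
  compactness the nested remainders outside U and V have a common point.\<close>

lemma connectedin_Inter_chain:
  assumes X: "compact_space X" "Hausdorff_space X" and ne: "\<F> \<noteq> {}"
    and cc: "\<And>S. S \<in> \<F> \<Longrightarrow> closedin X S \<and> connectedin X S"
    and linear: "\<And>S T. S \<in> \<F> \<Longrightarrow> T \<in> \<F> \<Longrightarrow> S \<subseteq> T \<or> T \<subseteq> S"
  shows "connectedin X (\<Inter>\<F>)"
  unfolding connectedin_closedin
proof (intro conjI notI)
  show "\<Inter>\<F> \<subseteq> topspace X" using ne cc closedin_subset by blast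
  have clo: "closedin X (\<Inter>\<F>)" using ne cc by blast
  assume "\<exists>E1 E2. closedin X E1 \<and> closedin X E2 \<and> \<Inter>\<F> \<subseteq> E1 \<union> E2 \<and>
            E1 \<inter> E2 \<inter> \<Inter>\<F> = {} \<and> E1 \<inter> \<Inter>\<F> \<noteq> {} \<and> E2 \<inter> \<Inter>\<F> \<noteq> {}"
  then obtain E1 E2 where E: "closedin X E1" "closedin X E2" "\<Inter>\<F> \<subseteq> E1 \<union> E2"
      "E1 \<inter> E2 \<inter> \<Inter>\<F> = {}" "E1 \<inter> \<Inter>\<F> \<noteq> {}" "E2 \<inter> \<Inter>\<F> \<noteq> {}" by blast
  have "normal_space X" using X compact_Hausdorff_or_regular_imp_normal_space by blast
  moreover have "closedin X (E1 \<inter> \<Inter>\<F>)" "closedin X (E2 \<inter> \<Inter>\<F>)" using E clo by auto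
  moreover have "disjnt (E1 \<inter> \<Inter>\<F>) (E2 \<inter> \<Inter>\<F>)" using E by (auto simp: disjnt_def)
  ultimately obtain U V where UV: "openin X U" "openin X V" "E1 \<inter> \<Inter>\<F> \<subseteq> U" "E2 \<inter> \<Inter>\<F> \<subseteq> V" "disjnt U V"
    unfolding normal_space_def by metis
  define \<G> where "\<G> = (\<lambda>S. S - (U \<union> V)) ` \<F>"
  have "\<Inter>\<G> \<noteq> {}"
  proof -
    have "closedin X G" if "G \<in> \<G>" for G
      using that cc UV(1,2) by (auto simp: \<G>_def intro!: closedin_diff openin_Un)
    moreover have "\<Inter>\<H> \<noteq> {}" if H: "finite \<H>" "\<H> \<subseteq> \<G>" for \<H>
    proof (cases "\<H> = {}")
      case False
      obtain \<H>' where H': "\<H>' \<subseteq> \<F>" "finite \<H>'" "\<H> = (\<lambda>S. S - (U \<union> V)) ` \<H>'"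
        using finite_subset_image[OF H[unfolded \<G>_def]] by blast
      have "subset.chain UNIV \<H>'" using H'(1) linear by (auto simp: subset_chain_def)
      then have "\<Inter>\<H>' \<in> \<H>'" using H' False by (intro Inter_in_chain) auto
      moreover have "S - (U \<union> V) \<noteq> {}" if S: "S \<in> \<F>" for S
      proof
        assume "S - (U \<union> V) = {}"
        then have "S \<subseteq> U \<union> V" by blast
        moreover have "U \<inter> S \<noteq> {}" "V \<inter> S \<noteq> {}" using UV(3,4) E(5,6) S by blast+
        moreover have "U \<inter> V \<inter> S = {}" using UV(5) by (auto simp: disjnt_def)
        moreover have "connectedin X S" using cc S by blast
        ultimately show False using UV(1,2) connectedinD by metis
      qed
      ultimately have "\<Inter>\<H>' - (U \<union> V) \<noteq> {}" using subsetD[OF H'(1)] by simp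
      then obtain x where "x \<in> \<Inter>\<H>'" "x \<notin> U \<union> V" by blast
      then have "x \<in> \<Inter>\<H>" unfolding H'(3) by blast
      then show ?thesis by blast
    qed simp
    ultimately have "(\<forall>G\<in>\<G>. closedin X G) \<and> (\<forall>\<H>. finite \<H> \<and> \<H> \<subseteq> \<G> \<longrightarrow> \<Inter>\<H> \<noteq> {})"
      by simp
    then show ?thesis by (rule X(1)[unfolded compact_space_fip, THEN spec, THEN mp])
  qed
  then obtain x where x: "x \<in> \<Inter>\<G>" by blast
  then have "x \<in> \<Inter>\<F>" "x \<notin> U \<union> V" using ne by (auto simp: \<G>_def)
  then show False using E(3) UV(3,4) by blast
qed

lemma irreducible_continuum_exists:
  assumes X: "compact_space X" "Hausdorff_space X" and H0: "closedin X H0" "connectedin X H0" "a \<in> H0" "b \<in> H0"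
  shows "\<exists>H. closedin X H \<and> connectedin X H \<and> a \<in> H \<and> b \<in> H \<and>
    (\<forall>H'. closedin X H' \<and> connectedin X H' \<and> a \<in> H' \<and> b \<in> H' \<and> H' \<subseteq> H \<longrightarrow> H' = H)"
proof -
  define P where "P H \<longleftrightarrow> closedin X H \<and> connectedin X H \<and> a \<in> H \<and> b \<in> H" for H
  \<comment> \<open>Complements, because Zorn's lemma yields maximal elements while a minimal
    continuum is wanted.\<close>
  define \<A> where "\<A> = (\<lambda>H. topspace X - H) ` Collect P"
  have Psub: "H \<subseteq> topspace X" if "P H" for H using that closedin_subset by (auto simp: P_def)
  have "\<exists>M\<in>\<A>. \<forall>Y\<in>\<A>. M \<subseteq> Y \<longrightarrow> Y = M"
  proof (rule subset_Zorn_nonempty)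
    show "\<A> \<noteq> {}" using H0 by (auto simp: \<A>_def P_def)
    fix \<C> assume C: "\<C> \<noteq> {}" "subset.chain \<A> \<C>"
    define \<F> where "\<F> = {H. P H \<and> topspace X - H \<in> \<C>}"
    have sub: "\<C> \<subseteq> \<A>" using C by (auto simp: subset_chain_def)
    have "\<F> \<noteq> {}" using C(1) sub by (auto simp: \<F>_def \<A>_def)
    moreover have "S \<subseteq> T \<or> T \<subseteq> S" if "S \<in> \<F>" "T \<in> \<F>" for S T
    proof -
      have "topspace X - S \<subseteq> topspace X - T \<or> topspace X - T \<subseteq> topspace X - S"
        using that C(2) by (auto simp: subset_chain_def \<F>_def)
      then show ?thesis using that Psub[of S] Psub[of T] by (auto simp: \<F>_def)
    qed
    moreover have FP: "P S" if "S \<in> \<F>" for S using that by (auto simp: \<F>_def)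
    ultimately have "connectedin X (\<Inter>\<F>)" "closedin X (\<Inter>\<F>)"
      using connectedin_Inter_chain[OF X, of \<F>] closedin_Inter[of \<F> X] unfolding P_def by blast+
    then have "P (\<Inter>\<F>)" using FP unfolding P_def by blast
    moreover have "\<Union>\<C> = topspace X - \<Inter>\<F>"
    proof
      show "\<Union>\<C> \<subseteq> topspace X - \<Inter>\<F>"
      proof
        fix x assume "x \<in> \<Union>\<C>"
        then obtain H where "P H" "topspace X - H \<in> \<C>" "x \<in> topspace X - H"
          using sub by (auto simp: \<A>_def)
        then show "x \<in> topspace X - \<Inter>\<F>" by (auto simp: \<F>_def)
      qed
      show "topspace X - \<Inter>\<F> \<subseteq> \<Union>\<C>" by (auto simp: \<F>_def)
    qed
    ultimately show "\<Union>\<C> \<in> \<A>" by (auto simp: \<A>_def)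
  qed
  then obtain H where H: "P H" "\<And>H'. P H' \<Longrightarrow> topspace X - H \<subseteq> topspace X - H' \<Longrightarrow> topspace X - H' = topspace X - H"
    by (auto simp: \<A>_def)
  have "H' = H" if H': "closedin X H'" "connectedin X H'" "a \<in> H'" "b \<in> H'" "H' \<subseteq> H" for H'
  proof -
    have "topspace X - H' = topspace X - H" using H' by (intro H(2)) (auto simp: P_def)
    then show "H' = H" using H' Psub[OF H(1)] by blast
  qed
  then show ?thesis using H(1) unfolding P_def by blast
qed

text \<open>The continuum joining the point to infinity in the one-point compactification is taken
  irreducible, so that it stays connected after both ends are removed.\<close>

lemma noncompact_component_of_punctured_space:
  fixes E :: "'a::metric_space set"
  assumes lc: "locally_compact_space (top_of_set E)" and x0: "x0 \<in> E"
    and noclopen: "\<And>A. compact A \<Longrightarrow> A \<subseteq> E \<Longrightarrow> x0 \<in> A \<Longrightarrow> openin (top_of_set E) A \<Longrightarrow> False"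
  obtains D where "D \<in> components (E - {x0})" "x0 \<in> closure D" "\<not> compact (insert x0 D)"
proof -
  define X where "X = top_of_set E"
  have topX [simp]: "topspace X = E" by (simp add: X_def)
  have HX: "Hausdorff_space X" unfolding X_def by (simp add: Hausdorff_space_subtopology Hausdorff_space_euclidean)
  define Y where "Y = Alexandroff_compactification X"
  have Y: "compact_space Y" "Hausdorff_space Y" "topspace Y = insert None (Some ` E)"
    using lc HX by (auto simp: Y_def Hausdorff_space_Alexandroff_compactification X_def)
  have comp: "compactin X A \<longleftrightarrow> compact A \<and> A \<subseteq> E" for A
    by (auto simp: X_def compactin_subtopology)
  have cloY: "closedin Y (Some ` A)" if "compact A" "A \<subseteq> E" for A
    using that comp compactin_imp_closedin[OF HX, of A] unfolding Y_def by auto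
  \<comment> \<open>In a compact Hausdorff space quasi-components are components, so it is enough to
    exclude a clopen set separating x0 from infinity. The side without infinity is compact and
    relatively open in E, which \<open>noclopen\<close> forbids.\<close>
  have "quasi_component_of Y (Some x0) None"
  proof (rule ccontr)
    assume "\<not> ?thesis"
    then obtain T where T: "closedin Y T" "openin Y T" "\<not> (Some x0 \<in> T \<longleftrightarrow> None \<in> T)"
      using x0 Y(3) by (auto simp: quasi_component_of_def)
    obtain T' where T': "closedin Y T'" "openin Y T'" "Some x0 \<in> T'" "None \<notin> T'"
    proof (cases "None \<in> T")
      case True
      have "closedin Y (topspace Y - T)" "openin Y (topspace Y - T)"
        using T by (auto intro: openin_diff closedin_diff)
      then show ?thesis using True T x0 Y(3) by (intro that[of "topspace Y - T"]) auto
    qed (use T that in blast)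
    have "T' \<subseteq> Some ` E" using closedin_subset[OF T'(1)] T'(4) unfolding Y(3) by blast
    then obtain A where A: "T' = Some ` A" "A \<subseteq> E" by (meson subset_imageE)
    have "openin X A" "compactin X A" using T'(1,2) A(1) unfolding Y_def by auto
    then show False using noclopen[of A] A T'(3) comp by (auto simp: X_def)
  qed
  then have cc: "connected_component_of Y (Some x0) None"
    using quasi_eq_connected_component_of[of Y "Some x0"] Y(1,2) by simp
  then have a: "Some x0 \<in> topspace Y" "None \<in> topspace Y"
    using x0 Y(3) by auto
  have cH: "closedin Y (connected_component_of_set Y (Some x0))"
    "connectedin Y (connected_component_of_set Y (Some x0))"
    "Some x0 \<in> connected_component_of_set Y (Some x0)"
    "None \<in> connected_component_of_set Y (Some x0)"
    using a cc by (simp_all add: closedin_connected_component_of connectedin_connected_component_of connected_component_of_refl)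
  obtain H where H: "closedin Y H" "connectedin Y H" "Some x0 \<in> H" "None \<in> H"
    "\<forall>H'. closedin Y H' \<and> connectedin Y H' \<and> Some x0 \<in> H' \<and> None \<in> H' \<and> H' \<subseteq> H \<longrightarrow> H' = H"
    using irreducible_continuum_exists[OF Y(1,2) cH] by (elim exE conjE)
  have Hsub: "H \<subseteq> topspace Y" using H(1) closedin_subset by blast
  then have topH: "topspace (subtopology Y H) = H" by auto
  have "connectedin (subtopology Y H) (topspace (subtopology Y H) - {Some x0, None})"
  proof (rule irreducible_continuum_delete_two)
    show "connected_space (subtopology Y H)" using H(2) by (simp add: connectedin_def)
    show "t1_space (subtopology Y H)" using Y(2) by (simp add: Hausdorff_imp_t1_space Hausdorff_space_subtopology)
  qed (use H Hsub topH in \<open>auto simp: connectedin_subtopology closedin_closed_subtopology\<close>)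
  then have conn: "connectedin Y (H - {Some x0, None})" unfolding topH connectedin_subtopology by blast
  define D1 where "D1 = {x. Some x \<in> H \<and> x \<noteq> x0}"
  have D1: "Some ` D1 = H - {Some x0, None}" "D1 \<subseteq> E - {x0}"
    using Hsub Y(3) by (auto simp: D1_def)
  have "connectedin X D1"
  proof -
    have "homeomorphic_map X (subtopology Y (Some ` topspace X)) Some"
      using embedding_map_Some[of X] by (simp add: embedding_map_def Y_def)
    moreover have "connectedin (subtopology Y (Some ` topspace X)) (Some ` D1)"
      unfolding connectedin_subtopology D1(1) using conn D1 by (metis Diff_subset image_mono order_trans topX)
    ultimately show ?thesis
      using D1(2) homeomorphic_map_connectedness_eq[of X _ Some D1] by auto
  qed
  then have "connected D1" by (auto simp: X_def connectedin_subtopology)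
  have split: False if "closedin Y A" "closedin Y B" "A \<inter> H \<noteq> {}" "B \<inter> H \<noteq> {}" "H \<subseteq> A \<union> B" "A \<inter> B \<inter> H = {}" for A B
    using H(2) that unfolding connectedin_closedin by blast
  have singl: "closedin Y {None}" "closedin Y {Some x0}"
    using Y(2) a by (simp_all add: closedin_Hausdorff_singleton)
  \<comment> \<open>Otherwise the image of \<open>insert x0 K\<close> and the point at infinity
    would split the continuum H into two closed parts.\<close>
  have unb: "\<not> D1 \<subseteq> K" if K: "compact K" "K \<subseteq> E" for K
  proof
    assume "D1 \<subseteq> K"
    have "closedin Y (Some ` (insert x0 K))" using K x0 by (intro cloY) auto
    then show False
    proof (rule split[OF _ singl(1)])
      show "H \<subseteq> Some ` insert x0 K \<union> {None}"
        using D1(1) \<open>D1 \<subseteq> K\<close> by blast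
    qed (use H in auto)
  qed
  have "D1 \<noteq> {}" using unb[of "{}"] by auto
  have x0cl: "x0 \<in> closure D1"
  proof (rule ccontr)
    assume "x0 \<notin> closure D1"
    define U where "U = E - closure D1"
    have "openin X U" unfolding X_def U_def by (auto simp: openin_open intro!: exI[of _ "- closure D1"])
    then have "openin Y (Some ` U)" by (simp add: Y_def)
    then have "closedin Y (topspace Y - Some ` U)" by (metis openin_closedin_eq)
    then show False
    proof (rule split[OF singl(2)])
      show "H \<subseteq> {Some x0} \<union> (topspace Y - Some ` U)"
      proof
        fix h assume h: "h \<in> H"
        show "h \<in> {Some x0} \<union> (topspace Y - Some ` U)"
        proof (cases h)
          case (Some x)
          have "x \<in> closure D1" if "x \<noteq> x0"
            using h Some that by (intro subsetD[OF closure_subset]) (simp add: D1_def)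
          then have "x \<notin> U \<or> x = x0" by (auto simp: U_def)
          then show ?thesis using Some h Hsub by auto
        qed (use a in auto)
      qed
      show "{Some x0} \<inter> (topspace Y - Some ` U) \<inter> H = {}"
        using \<open>x0 \<notin> closure D1\<close> x0 by (auto simp: U_def)
    qed (use H a in auto)
  qed
  obtain x1 where "x1 \<in> D1" using \<open>D1 \<noteq> {}\<close> by blast
  \<comment> \<open>The component may be larger than \<open>D1\<close> but inherits both properties:
    x0 lies in its closure, and it stays non-compact with x0 added, as \<open>unb\<close> applied to
    \<open>insert x0 D\<close> shows.\<close>
  define D where "D = connected_component_set (E - {x0}) x1"
  have "D1 \<subseteq> D"
    unfolding D_def using \<open>connected D1\<close> \<open>x1 \<in> D1\<close> D1(2) by (intro connected_component_maximal)
  show ?thesis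
  proof (rule that[of D])
    show "D \<in> components (E - {x0})" unfolding D_def using \<open>x1 \<in> D1\<close> D1(2) by (intro componentsI) auto
    show "x0 \<in> closure D" using x0cl \<open>D1 \<subseteq> D\<close> closure_mono by blast
    have "D \<subseteq> E" unfolding D_def using connected_component_subset by blast
    then show "\<not> compact (insert x0 D)" using unb[of "insert x0 D"] \<open>D1 \<subseteq> D\<close> x0 by blast
  qed
qed

section \<open>Linearization and the set of nontrivial solutions\<close>

lemma C1_map_Du:
  fixes F :: "real \<times> 'u::real_normed_vector \<Rightarrow> 'v::real_normed_vector"
  assumes "C1_map F"
  shows "((\<lambda>w. F (l, w)) has_derivative Du F l u) (at u)"
    and "continuous_on UNIV (\<lambda>(l, u). Du F l u)"
    and "continuous_on UNIV F"
proof -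
  obtain F' where F': "\<And>x. (F has_derivative blinfun_apply (F' x)) (at x)" "continuous_on UNIV F'"
    using assms by (auto simp: C1_map_def)
  define e where "e = Blinfun (\<lambda>h::'u. (0::real, h))"
  have e: "blinfun_apply e = (\<lambda>h. (0, h))"
    unfolding e_def by (rule bounded_linear_Blinfun_apply) (intro bounded_linear_Pair bounded_linear_ident bounded_linear_zero)
  have der: "((\<lambda>w. F (l, w)) has_derivative (F' (l, u) o\<^sub>L e)) (at u)" for l u
  proof -
    have d: "((\<lambda>w. (l, w)) has_derivative (\<lambda>h. (0, h))) (at u)"
      by (intro has_derivative_Pair has_derivative_const has_derivative_ident)
    have *: "blinfun_apply (F' (l, u) o\<^sub>L e) = (\<lambda>h. F' (l, u) (0, h))"
      by (rule ext) (simp add: e)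
    show ?thesis unfolding * by (rule has_derivative_compose[OF d F'(1)])
  qed
  have eq: "Du F l u = F' (l, u) o\<^sub>L e" for l u
  proof -
    have "frechet_derivative (\<lambda>w. F (l, w)) (at u) = blinfun_apply (F' (l, u) o\<^sub>L e)"
      using frechet_derivative_at[OF der] by (rule sym)
    then show ?thesis unfolding Du_def by (simp only: blinfun_apply_inverse)
  qed
  show "((\<lambda>w. F (l, w)) has_derivative Du F l u) (at u)" using der eq by simp
  have "(\<lambda>(l, u). Du F l u) = (\<lambda>x. F' x o\<^sub>L e)" using eq by auto
  then show "continuous_on UNIV (\<lambda>(l, u). Du F l u)"
    by (simp only:)
      (intro bounded_bilinear.continuous_on[OF bounded_bilinear_blinfun_compose] F'(2) continuous_on_const)
  show "continuous_on UNIV F"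
    by (rule continuous_at_imp_continuous_on) (use F'(1) has_derivative_continuous in blast)
qed

text \<open>Mean value inequality for w -> F(l, w) - L(l) w. Its derivative Du F l w - Du F l 0 is
  small by joint continuity of Du, so one radius serves all l near l1.\<close>

lemma linearization_remainder:
  fixes F :: "real \<times> 'u::real_normed_vector \<Rightarrow> 'v::real_normed_vector"
  assumes C1: "C1_map F" and F1: "\<forall>l. F (l, 0) = 0" and "\<kappa> > 0"
  shows "\<exists>r>0. \<forall>l u. \<bar>l - l1\<bar> < r \<and> norm u < r \<longrightarrow> norm (F (l, u) - blinfun_apply (linearization F l) u) \<le> \<kappa> * norm u"
proof -
  have "isCont (\<lambda>(l, u). Du F l u) (l1, 0)"
    using C1_map_Du(2)[OF C1] by (simp add: continuous_on_eq_continuous_at)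
  from this[unfolded continuous_at_eps_delta, rule_format, OF half_gt_zero[OF \<open>\<kappa> > 0\<close>]]
  obtain s where s: "s > 0" "\<And>x. dist x (l1, 0) < s \<Longrightarrow> dist (case x of (l, u) \<Rightarrow> Du F l u) (Du F l1 0) < \<kappa> / 2"
    unfolding old.prod.case by blast
  have near: "norm (Du F l u - linearization F l) \<le> \<kappa>" if "\<bar>l - l1\<bar> < s / 2" "norm u < s / 2" for l :: real and u :: 'u
  proof -
    have d: "dist (l, w) (l1, 0) < s" if "norm w < s / 2" for w :: 'u
    proof -
      have "dist (l, w) (l1, 0) \<le> \<bar>l - l1\<bar> + norm w"
        unfolding dist_Pair_Pair using sqrt_sum_squares_le_sum[of "dist l l1" "dist w 0"] by (simp add: dist_real_def)
      then show ?thesis using that \<open>\<bar>l - l1\<bar> < s / 2\<close> by linarith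
    qed
    have "dist (Du F l u) (Du F l1 0) < \<kappa> / 2" "dist (Du F l 0) (Du F l1 0) < \<kappa> / 2"
      using s(2)[OF d[of u]] s(2)[OF d[of 0]] that s(1) by auto
    then have "dist (Du F l u) (Du F l 0) < \<kappa>" by (rule dist_triangle_half_l)
    then show ?thesis by (simp add: dist_norm linearization_def)
  qed
  show ?thesis
  proof (intro exI[of _ "s / 2"] conjI allI impI)
    show "s / 2 > 0" using s by simp
    fix l :: real and u :: 'u assume lu: "\<bar>l - l1\<bar> < s / 2 \<and> norm u < s / 2"
    have "norm ((F (l, u) - linearization F l u) - (F (l, 0) - linearization F l 0)) \<le> \<kappa> * norm (u - 0)"
    proof (rule differentiable_bound[of "ball 0 (s / 2)"])
      fix w :: 'u assume w: "w \<in> ball 0 (s / 2)"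
      show "((\<lambda>w. F (l, w) - linearization F l w) has_derivative (\<lambda>h. (Du F l w - linearization F l) h)) (at w within ball 0 (s / 2))"
        unfolding blinfun.diff_left
        by (intro has_derivative_diff has_derivative_at_withinI[OF C1_map_Du(1)[OF C1]]
            bounded_linear_imp_has_derivative blinfun.bounded_linear_right)
      show "onorm (\<lambda>h. (Du F l w - linearization F l) h) \<le> \<kappa>"
        using near[of l w] lu w by (simp add: norm_blinfun.rep_eq)
    qed (use lu s in auto)
    then show "norm (F (l, u) - linearization F l u) \<le> \<kappa> * norm u" using F1 by simp
  qed
qed

lemma continuous_on_linearization:
  assumes "C1_map F"
  shows "continuous_on UNIV (linearization F)"
proof -
  have "continuous_on UNIV ((\<lambda>(l, u). Du F l u) \<circ> (\<lambda>l. (l, 0)))"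
    by (rule continuous_on_compose)
      (auto intro!: continuous_intros continuous_on_subset[OF C1_map_Du(2)[OF assms]])
  then show ?thesis by (simp add: o_def linearization_def[abs_def])
qed

section \<open>Topology of the set of nontrivial solutions\<close>

lemma mem_nontrivial_solutions_iff:
  assumes "\<forall>l. F (l, 0) = 0"
  shows "(l, u) \<in> nontrivial_solutions F \<longleftrightarrow> F (l, u) = 0 \<and> (u = 0 \<longrightarrow> l \<in> Spec (linearization F))"
  using assms by (auto simp: nontrivial_solutions_def)

text \<open>The critical limit points are (l, 0) with L(l) invertible. Nearby inverses are bounded
  by some m and the remainder by norm u / (2 m), so a nearby solution has norm u \<le> norm u / 2
  and is trivial; its parameter is outside the spectrum too, because invertibility is an open
  condition.\<close>

lemma closed_nontrivial_solutions:
  fixes F :: "real \<times> 'u::banach \<Rightarrow> 'v::banach"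
  assumes C1: "C1_map F" and F1: "\<forall>l. F (l, 0) = 0"
  shows "closed (nontrivial_solutions F)"
proof -
  let ?S = "nontrivial_solutions F" and ?L = "linearization F"
  have "\<exists>e>0. \<forall>y. dist y x < e \<longrightarrow> y \<notin> ?S" if x: "x \<notin> ?S" for x
  proof (cases "F x = 0")
    case False
    have "open (F -` (- {0}))"
      by (rule open_vimage) (use C1_map_Du(3)[OF C1] in auto)
    then obtain e where "e > 0" "\<forall>y. dist y x < e \<longrightarrow> y \<in> F -` (- {0})"
      using False unfolding open_dist by blast
    then have "e > 0" "\<forall>y. dist y x < e \<longrightarrow> F y \<noteq> 0" by auto
    then show ?thesis using mem_nontrivial_solutions_iff[OF F1] by (metis surj_pair)
  next
    case True
    obtain l where l: "x = (l, 0)" "?L l \<in> GL"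
      using True x mem_nontrivial_solutions_iff[OF F1] by (cases x) (auto simp: Spec_def)
    obtain e where e: "e > 0" "\<And>T. dist T (?L l) < e \<Longrightarrow> T \<in> GL"
      "\<And>T. dist T (?L l) < e \<Longrightarrow> norm (blinfun_inverse T) \<le> 2 * norm (blinfun_inverse (?L l))"
      using GL_neighbourhood[OF l(2)] by blast
    define m where "m = 2 * norm (blinfun_inverse (?L l)) + 1"
    have "m > 0" by (simp add: m_def add_nonneg_pos)
    obtain d where d: "d > 0" "\<And>l'. dist l' l < d \<Longrightarrow> dist (?L l') (?L l) < e"
      using continuous_on_linearization[OF C1] \<open>e > 0\<close> unfolding continuous_on_iff by (metis UNIV_I)
    have "1 / (2 * m) > 0" using \<open>m > 0\<close> by simp
    from linearization_remainder[OF C1 F1 this, of l] obtain r where r: "r > 0"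
      "\<And>l' u. \<bar>l' - l\<bar> < r \<Longrightarrow> norm u < r \<Longrightarrow> norm (F (l', u) - ?L l' u) \<le> 1 / (2 * m) * norm u"
      by blast
    have "(l', u) \<notin> ?S" if lu: "dist (l', u) x < min d r" for l' u
    proof
      assume "(l', u) \<in> ?S"
      then have S: "F (l', u) = 0" "u = 0 \<Longrightarrow> ?L l' \<notin> GL"
        using mem_nontrivial_solutions_iff[OF F1] by (auto simp: Spec_def)
      have dl: "dist l' l < min d r" "norm u < min d r"
        using lu dist_fst_le[of "(l', u)" x] dist_snd_le[of "(l', u)" x] unfolding l(1) by auto
      then have gl: "?L l' \<in> GL" "norm (blinfun_inverse (?L l')) \<le> m"
        using e(2,3)[OF d(2)[of l']] by (auto simp: m_def)
      have "norm (?L l' u) \<le> 1 / (2 * m) * norm u"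
        using r(2)[of l' u] dl S(1) by (simp add: dist_real_def)
      then have "m * norm (?L l' u) \<le> norm u / 2"
        using \<open>m > 0\<close> by (simp add: field_simps)
      moreover have "norm u \<le> m * norm (?L l' u)"
      proof -
        have "norm u = norm (blinfun_inverse (?L l') (?L l' u))" using gl by simp
        also have "\<dots> \<le> norm (blinfun_inverse (?L l')) * norm (?L l' u)" by (rule norm_blinfun)
        also have "\<dots> \<le> m * norm (?L l' u)" using gl by (intro mult_right_mono) auto
        finally show ?thesis .
      qed
      ultimately have "norm u \<le> norm u / 2" by linarith
      then have "u = 0" by simp
      then show False using S(2) gl by blast
    qed
    then show ?thesis using d r by (intro exI[of _ "min d r"]) auto
  qed
  then show ?thesis unfolding closed_def open_dist by auto
qed

lemma compact_nontrivial_solutions_Int_cball: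
  fixes F :: "real \<times> 'u::banach \<Rightarrow> 'v::banach"
  assumes C1: "C1_map F" and F1: "\<forall>l. F (l, 0) = 0" and F3: "proper_on_closed_bounded F"
  shows "compact (nontrivial_solutions F \<inter> cball x R)"
proof -
  have "compact (cball x R \<inter> F -` {0})"
    using F3 unfolding proper_on_closed_bounded_def by auto
  moreover have "nontrivial_solutions F \<inter> cball x R = nontrivial_solutions F \<inter> (cball x R \<inter> F -` {0})"
    using mem_nontrivial_solutions_iff[OF F1] by auto
  ultimately show ?thesis
    using closed_nontrivial_solutions[OF C1 F1] by (simp add: closed_Int_compact)
qed

text \<open>B(l) agrees with L(l) on ker f and sends \<phi>0 to a fixed vector v0 spanning a
  complement of the range at l0. Since L(l0) maps ker f bijectively onto its range, B(l0) is
  bijective. The factorization is exact for every l.\<close>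

lemma kernel_reduction:
  fixes F :: "real \<times> 'u::banach \<Rightarrow> 'v::banach"
  assumes C1: "C1_map F" and L0: "linearization F l0 \<in> Phi0"
    and null: "null_space (linearization F l0) = span {\<phi>0}" and f: "blinfun_apply f \<phi>0 = 1"
  obtains B where "continuous_on UNIV B" "B l0 \<in> GL"
    "\<And>l u. blinfun_apply (linearization F l) u = B l (u - f u *\<^sub>R \<phi>0) + f u *\<^sub>R linearization F l \<phi>0"
proof -
  let ?L = "linearization F"
  obtain B0 C where BC: "finite B0" "independent B0" "null_space (?L l0) = span B0"
    "finite C" "independent C" "complementary (range (?L l0)) (span C)" "card C = card B0"
    using Phi0_bases[OF L0] .
  have "\<phi>0 \<noteq> 0" using f by auto
  then have "card B0 = 1"
    using BC(2,3) null dim_span_eq_card_independent[of B0] dim_span_eq_card_independent[of "{\<phi>0}"] by simp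
  then obtain v0 where v0: "C = {v0}" using BC(7) by (metis card_1_singletonE)
  have "v0 \<noteq> 0" using BC(5) v0 by auto
  have compl: "range (?L l0) \<inter> span {v0} = {0}" "\<And>x. \<exists>a\<in>range (?L l0). \<exists>b\<in>span {v0}. x = a + b"
    using BC(6) v0 by (auto simp: complementary_def)
  have L\<phi>: "?L l0 \<phi>0 = 0" using null span_base[of \<phi>0 "{\<phi>0}"] by (auto simp: null_space_def)
  define B where "B l = ?L l + (blinfun_scaleR_left (v0 - ?L l \<phi>0) o\<^sub>L f)" for l
  have B: "B l u = ?L l u + f u *\<^sub>R (v0 - ?L l \<phi>0)" for l u
    by (simp add: B_def blinfun.add_left)
  show ?thesis
  proof (rule that[of B])
    show "continuous_on UNIV B"
      unfolding B_def
      by (intro continuous_on_add continuous_on_linearization[OF C1]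
          bounded_bilinear.continuous_on[OF bounded_bilinear_blinfun_compose]
          bounded_linear.continuous_on[OF bounded_linear_blinfun_scaleR_left] continuous_on_const
          continuous_on_diff bounded_linear.continuous_on[OF blinfun.bounded_linear_left])
    show "?L l u = B l (u - f u *\<^sub>R \<phi>0) + f u *\<^sub>R ?L l \<phi>0" for l u
      by (simp add: B blinfun.diff_right blinfun.scaleR_right f algebra_simps)
    show "B l0 \<in> GL"
    proof (rule bounded_inverse_theorem)
      have inj0: "u = 0" if "B l0 u = 0" for u
      proof -
        have *: "?L l0 u = - f u *\<^sub>R v0" using that by (simp add: B L\<phi> eq_neg_iff_add_eq_0)
        have "?L l0 u \<in> span {v0}" unfolding * by (intro span_scale span_base) simp
        then have "?L l0 u = 0" using compl(1) by blast
        then have "f u = 0" "u \<in> span {\<phi>0}" using * \<open>v0 \<noteq> 0\<close> null by (auto simp: null_space_def)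
        then show "u = 0" using f by (auto simp: span_singleton blinfun.scaleR_right)
      qed
      have "x = y" if "B l0 x = B l0 y" for x y
        using that inj0[of "x - y"] by (simp add: blinfun.diff_right)
      then have "inj (B l0)" by (rule injI)
      moreover have "y \<in> range (B l0)" for y
      proof -
        obtain u c where "y = ?L l0 u + c *\<^sub>R v0" using compl(2)[of y] by (auto simp: span_singleton)
        then have "B l0 (u - f u *\<^sub>R \<phi>0 + c *\<^sub>R \<phi>0) = y"
          by (simp add: B L\<phi> blinfun.add_right blinfun.diff_right blinfun.scaleR_right f)
        then show ?thesis by (intro image_eqI[of _ _ "u - f u *\<^sub>R \<phi>0 + c *\<^sub>R \<phi>0"]) auto
      qed
      ultimately show "bij (B l0)" unfolding bij_def by blast
    qed
  qed
qed

section \<open>Sign change at an eigenvalue of odd multiplicity\<close>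

text \<open>In L(l) u = B(l) (z + s q(l)) the scalar d(l) = f(q(l)) can be replaced by any c. The
  resulting M(l, c) is always in \<open>Phi0\<close> and is invertible for c \<noteq> 0. The path l
  -> (l, d l) is contracted linearly to (b, d b), and equal signs keep c away from 0 at the left
  end.\<close>

lemma same_sign_A_homotopic_const:
  fixes L B :: "real \<Rightarrow> 'u::banach \<Rightarrow>\<^sub>L 'v::banach" and f :: "'u \<Rightarrow>\<^sub>L real"
  assumes ab: "a \<le> b" and contL: "continuous_on {a..b} L" and contB: "continuous_on {a..b} B"
    and B: "\<And>l. l \<in> {a..b} \<Longrightarrow> B l \<in> GL"
    and L: "\<And>l u. blinfun_apply (L l) u = B l (u - f u *\<^sub>R \<phi>0) + f u *\<^sub>R L l \<phi>0"
    and f: "blinfun_apply f \<phi>0 = 1"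
    and sgn: "f (blinfun_inverse (B a) (L a \<phi>0)) * f (blinfun_inverse (B b) (L b \<phi>0)) > 0"
  shows "A_homotopic a b (\<lambda>_. L b) L"
proof -
  define q where "q l = blinfun_inverse (B l) (L l \<phi>0)" for l
  define d where "d l = f (q l)" for l
  \<comment> \<open>The summand (c - d l) \<phi>0 moves the value of f on q(l) from d(l) to c
    without changing the component in ker f.\<close>
  define M where "M l c = B l o\<^sub>L (id_blinfun + (blinfun_scaleR_left (q l + (c - d l) *\<^sub>R \<phi>0 - \<phi>0) o\<^sub>L f))" for l c
  have M: "M l c u = B l (u - f u *\<^sub>R \<phi>0 + f u *\<^sub>R (q l + (c - d l) *\<^sub>R \<phi>0))" for l c u
    by (simp add: M_def blinfun.add_left algebra_simps)
  have fq: "f (q l + (c - d l) *\<^sub>R \<phi>0) = c" for l c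
    by (simp add: blinfun.add_right blinfun.scaleR_right f d_def)
  have MGL: "M l c \<in> GL" if "l \<in> {a..b}" "c \<noteq> 0" for l c
    using Phi0_rank_one(1)[OF B[OF that(1)] M f] fq that(2) by simp
  have MPhi0: "M l c \<in> Phi0" if "l \<in> {a..b}" for l c
    using Phi0_rank_one(2)[OF B[OF that(1)] M f] .
  have M_d: "M l (d l) = L l" if "l \<in> {a..b}" for l
  proof (rule blinfun_eqI)
    fix u
    have "L l u = B l (u - f u *\<^sub>R \<phi>0) + f u *\<^sub>R B l (q l)" using L[of l u] B[OF that] by (simp add: q_def)
    then show "M l (d l) u = L l u" by (simp add: M blinfun.add_right blinfun.scaleR_right)
  qed
  have contq: "continuous_on {a..b} q"
    unfolding q_def
    by (intro bounded_bilinear.continuous_on[OF bounded_bilinear_blinfun_apply] continuous_on_const contL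
        continuous_on_compose2[OF continuous_on_blinfun_inverse contB]) (use B in auto)
  have contd: "continuous_on {a..b} d"
    unfolding d_def by (intro bounded_bilinear.continuous_on[OF bounded_bilinear_blinfun_apply] continuous_on_const contq)
  have contM: "continuous_on ({a..b} \<times> UNIV) (\<lambda>x. M (fst x) (snd x))"
    unfolding M_def
    by (intro bounded_bilinear.continuous_on[OF bounded_bilinear_blinfun_compose] continuous_on_add continuous_on_const
        bounded_linear.continuous_on[OF bounded_linear_blinfun_scaleR_left] continuous_on_diff continuous_on_scaleR
        continuous_on_compose2[OF contB] continuous_on_compose2[OF contq] continuous_on_compose2[OF contd]
        continuous_on_fst continuous_on_snd continuous_on_id) auto
  \<comment> \<open>For fixed l = \<open>snd x\<close> the time \<open>fst x\<close> runs along the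
    segment from (b, d b) to (l, d l).\<close>
  define p where "p x = (fst x * snd x + (1 - fst x) * b, fst x * d (snd x) + (1 - fst x) * d b)" for x :: "real \<times> real"
  have p_in: "fst (p x) \<in> {a..b}" if "x \<in> {0..1} \<times> {a..b}" for x
  proof -
    have "fst x \<in> {0..1}" "snd x \<in> {a..b}" using that by auto
    then have "(1 - fst x) *\<^sub>R b + fst x *\<^sub>R snd x \<in> {a..b}"
      using ab by (intro convexD_alt) auto
    then show ?thesis by (simp add: p_def add.commute)
  qed
  define h where "h x = M (fst (p x)) (snd (p x))" for x
  have contp: "continuous_on ({0..1} \<times> {a..b}) p"
    unfolding p_def
    by (intro continuous_intros continuous_on_compose2[OF contd]) auto
  have conth: "continuous_on ({0..1} \<times> {a..b}) h"
    unfolding h_def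
    by (rule continuous_on_compose2[OF contM contp], rule image_subsetI)
      (use p_in in \<open>simp only: mem_Times_iff UNIV_I simp_thms\<close>)
  have da: "t * d a + (1 - t) * d b \<noteq> 0" if "t \<in> {0..1}" for t
  proof -
    have sg: "d a * d b > 0" using sgn by (simp add: d_def q_def)
    have "convex {x. x * d b > 0}"
    proof -
      have "{x. x * d b > 0} = (if d b > 0 then {0<..} else {..<0})"
        using sg by (auto simp: zero_less_mult_iff)
      then show ?thesis by simp
    qed
    moreover have "d a \<in> {x. x * d b > 0}" "d b \<in> {x. x * d b > 0}"
      using sg by (auto simp: zero_less_mult_iff)
    ultimately have "(1 - t) *\<^sub>R d b + t *\<^sub>R d a \<in> {x. x * d b > 0}"
      using that by (intro convexD_alt) auto
    then show ?thesis by (auto simp: add.commute)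
  qed
  have db: "d b \<noteq> 0" using sgn by (auto simp: d_def q_def)
  have LGL: "L a \<in> GL" "L b \<in> GL"
    using MGL[of a "d a"] MGL[of b "d b"] M_d[of a] M_d[of b] da[of 1] db ab by auto
  have Lsub: "L ` {a..b} \<subseteq> Phi0" using MPhi0 M_d by (auto simp: image_subset_iff) (metis atLeastAtMost_iff)
  have adm: "admissible a b (\<lambda>_. L b)" "admissible a b L"
    using contL LGL Lsub GL_subset_Phi0 by (auto simp: admissible_def)
  have "homotopic_with_canon (\<lambda>h. h a \<in> GL \<and> h b \<in> GL) {a..b} Phi0 (\<lambda>_. L b) L"
  proof (subst homotopic_with)
    show "\<exists>h. continuous_map (prod_topology (top_of_set {0..1::real}) (top_of_set {a..b})) (top_of_set Phi0) h \<and>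
        (\<forall>x\<in>topspace (top_of_set {a..b}). h (0, x) = L b) \<and>
        (\<forall>x\<in>topspace (top_of_set {a..b}). h (1, x) = L x) \<and>
        (\<forall>t\<in>{0..1}. h (t, a) \<in> GL \<and> h (t, b) \<in> GL)"
    proof (intro exI[of _ h] conjI ballI)
      have "h ` ({0..1} \<times> {a..b}) \<subseteq> Phi0" using MPhi0 p_in by (auto simp: h_def)
      moreover have "{0..1::real} \<times> UNIV \<inter> {0..1} \<times> {a..b} = {0..1} \<times> {a..b}" by auto
      ultimately show "continuous_map (prod_topology (top_of_set {0..1}) (top_of_set {a..b})) (top_of_set Phi0) h"
        using conth by (simp add: image_subset_iff_funcset continuous_map_in_subtopology prod_topology_subtopology subtopology_subtopology
          flip: subtopology_Times euclidean_product_topology)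
      show "h (0, x) = L b" for x using M_d[of b] ab by (simp add: h_def p_def)
      show "h (1, x) = L x" if "x \<in> topspace (top_of_set {a..b})" for x using M_d[of x] that by (simp add: h_def p_def)
      fix t :: real assume t: "t \<in> {0..1}"
      show "h (t, a) \<in> GL"
        unfolding h_def using p_in[of "(t, a)"] t ab da[OF t] by (intro MGL) (auto simp: p_def)
      have "t * d b + (1 - t) * d b \<noteq> 0" using db by (simp add: algebra_simps)
      then show "h (t, b) \<in> GL"
        unfolding h_def using p_in[of "(t, b)"] t ab by (intro MGL) (auto simp: p_def)
    qed
  qed (use ab in auto)
  then show ?thesis using adm by (simp add: A_homotopic_def)
qed

lemma chi_interval_const_GL: "T \<in> GL \<Longrightarrow> chi_interval (\<lambda>_. T) a b = 0"
  by (simp add: chi_interval_def Spec_def)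

lemma real_analytic_on_const: "real_analytic_on (\<lambda>_. T) S"
  unfolding real_analytic_on_def
proof (intro ballI)
  fix x assume "x \<in> S"
  have "(\<lambda>n. (y - x) ^ n *\<^sub>R (if n = 0 then T else 0)) sums T" for y
    using sums_If_finite[of "\<lambda>n. n = 0" "\<lambda>n. (y - x) ^ n *\<^sub>R T"]
    by (simp add: if_distrib[of "\<lambda>v. _ *\<^sub>R v"] cong: if_cong)
  then show "\<exists>r>0. \<exists>c. \<forall>y\<in>S. \<bar>y - x\<bar> < r \<longrightarrow> (\<lambda>n. (y - x) ^ n *\<^sub>R c n) sums T"
    by (intro exI[of _ 1] conjI exI[of _ "\<lambda>n. if n = 0 then T else 0"]) auto
qed

text \<open>The parity hypothesis is tested on the constant curve with value L(l0 + \<rho>). It is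
  analytic and its multiplicity is an empty sum, hence even, so it cannot be homotopic to the
  linearization; equal signs of the scalar would make it so.\<close>

lemma odd_multiplicity_sign_change:
  fixes F :: "real \<times> 'u::banach \<Rightarrow> 'v::banach" and f :: "'u \<Rightarrow>\<^sub>L real"
  assumes C1: "C1_map F" and F2: "\<forall>l u. Du F l u \<in> Phi0"
    and iso: "l0 isolated_in Spec (linearization F)"
    and null: "null_space (linearization F l0) = span {\<phi>0}" and f: "blinfun_apply f \<phi>0 = 1"
    and odd: "\<exists>\<rho>0>0. \<forall>\<rho>. 0 < \<rho> \<and> \<rho> < \<rho>0 \<longrightarrow>
          (\<forall>L\<omega>. real_analytic_on L\<omega> {l0 - \<rho>..l0 + \<rho>}
               \<and> A_homotopic (l0 - \<rho>) (l0 + \<rho>) L\<omega> (linearization F)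
             \<longrightarrow> odd (chi_interval L\<omega> (l0 - \<rho>) (l0 + \<rho>)))"
  obtains B \<rho>1 where "continuous_on UNIV B" "\<rho>1 > 0" "\<And>l. \<bar>l - l0\<bar> \<le> \<rho>1 \<Longrightarrow> B l \<in> GL"
    "\<And>l u. blinfun_apply (linearization F l) u = B l (u - f u *\<^sub>R \<phi>0) + f u *\<^sub>R linearization F l \<phi>0"
    "\<And>\<rho>. 0 < \<rho> \<Longrightarrow> \<rho> \<le> \<rho>1 \<Longrightarrow>
      f (blinfun_inverse (B (l0 - \<rho>)) (linearization F (l0 - \<rho>) \<phi>0)) *
      f (blinfun_inverse (B (l0 + \<rho>)) (linearization F (l0 + \<rho>) \<phi>0)) < 0"
proof -
  let ?L = "linearization F"
  have L0: "?L l0 \<in> Phi0" using F2 by (simp add: linearization_def)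
  have "\<exists>B. continuous_on UNIV B \<and> B l0 \<in> GL \<and>
    (\<forall>l u. blinfun_apply (?L l) u = B l (u - f u *\<^sub>R \<phi>0) + f u *\<^sub>R ?L l \<phi>0)"
  proof (rule kernel_reduction[OF C1 L0 null f])
    fix B assume B: "continuous_on UNIV B" "B l0 \<in> GL"
      "\<And>l u. blinfun_apply (?L l) u = B l (u - f u *\<^sub>R \<phi>0) + f u *\<^sub>R ?L l \<phi>0"
    show ?thesis by (intro exI[of _ B] conjI allI B)
  qed
  then obtain B where B: "continuous_on UNIV B" "B l0 \<in> GL"
    and B3: "\<forall>l u. blinfun_apply (?L l) u = B l (u - f u *\<^sub>R \<phi>0) + f u *\<^sub>R ?L l \<phi>0"
    by (elim exE conjE)
  have "open (B -` GL)" by (rule open_vimage[OF open_GL B(1)])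
  then obtain r1 where r1: "r1 > 0" "\<And>l. dist l l0 < r1 \<Longrightarrow> B l \<in> GL"
    using B(2) unfolding open_dist by blast
  obtain r2 where r2: "r2 > 0" "\<And>l. l \<in> Spec ?L \<Longrightarrow> dist l0 l < r2 \<Longrightarrow> l = l0"
    using iso unfolding isolated_in_dist_Ex_iff by blast
  obtain r3 where r3: "r3 > 0" "\<forall>\<rho>. 0 < \<rho> \<and> \<rho> < r3 \<longrightarrow>
          (\<forall>L\<omega>. real_analytic_on L\<omega> {l0 - \<rho>..l0 + \<rho>}
               \<and> A_homotopic (l0 - \<rho>) (l0 + \<rho>) L\<omega> ?L
             \<longrightarrow> odd (chi_interval L\<omega> (l0 - \<rho>) (l0 + \<rho>)))"
    using odd by (elim exE conjE)
  define d where "d l = f (blinfun_inverse (B l) (?L l \<phi>0))" for l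
  \<comment> \<open>A zero of d away from l0 would produce the kernel vector \<phi>0 - q, on which f
    takes the value 1, although L(l) is invertible there.\<close>
  have d_nz: "d l \<noteq> 0" if "dist l l0 < r1" "dist l l0 < r2" "l \<noteq> l0" for l
  proof
    assume "d l = 0"
    define q where "q = blinfun_inverse (B l) (?L l \<phi>0)"
    have fq: "f q = 0" using \<open>d l = 0\<close> by (simp add: d_def q_def)
    have "?L l (\<phi>0 - q) = B l (- q) + ?L l \<phi>0"
      using B3[rule_format, of l "\<phi>0 - q"] by (simp add: blinfun.diff_right f fq)
    also have "\<dots> = 0" using r1(2)[OF that(1)] by (simp add: q_def blinfun.minus_right)
    finally have "?L l (\<phi>0 - q) = 0" .
    moreover have "?L l \<in> GL" using r2(2)[of l] that by (auto simp: Spec_def dist_commute)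
    ultimately have "\<phi>0 - q = 0" by (simp add: GL_eq_0_iff)
    then show False using f fq by auto
  qed
  \<comment> \<open>Halving turns \<rho> \<le> \<rho>1 into strict inequalities for all three
    radii.\<close>
  define \<rho>1 where "\<rho>1 = min r1 (min r2 r3) / 2"
  show ?thesis
  proof (rule that[of B \<rho>1])
    show "\<rho>1 > 0" using r1 r2 r3 by (simp add: \<rho>1_def)
    show "B l \<in> GL" if "\<bar>l - l0\<bar> \<le> \<rho>1" for l
      using that r1 r2(1) r3(1) by (intro r1(2)) (auto simp: \<rho>1_def dist_real_def)
    show "continuous_on UNIV B" by (rule B(1))
    show "?L l u = B l (u - f u *\<^sub>R \<phi>0) + f u *\<^sub>R ?L l \<phi>0" for l u by (rule B3[rule_format])
    fix \<rho> assume \<rho>: "0 < \<rho>" "\<rho> \<le> \<rho>1"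
    then have lt: "\<rho> < r1" "\<rho> < r2" "\<rho> < r3" using r1 r2 r3 by (auto simp: \<rho>1_def)
    have nz: "d (l0 - \<rho>) \<noteq> 0" "d (l0 + \<rho>) \<noteq> 0"
      using lt \<rho> d_nz[of "l0 - \<rho>"] d_nz[of "l0 + \<rho>"] by (auto simp: dist_real_def)
    have "\<not> d (l0 - \<rho>) * d (l0 + \<rho>) > 0"
    proof
      assume pos: "d (l0 - \<rho>) * d (l0 + \<rho>) > 0"
      have BGL: "B l \<in> GL" if "l \<in> {l0 - \<rho>..l0 + \<rho>}" for l
        using that lt by (intro r1(2)) (auto simp: dist_real_def)
      have hom: "A_homotopic (l0 - \<rho>) (l0 + \<rho>) (\<lambda>_. ?L (l0 + \<rho>)) ?L"
      proof (rule same_sign_A_homotopic_const[OF _ _ _ _ B3[rule_format] f])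
        show "continuous_on {l0 - \<rho>..l0 + \<rho>} ?L"
          by (rule continuous_on_subset[OF continuous_on_linearization[OF C1]]) simp
        show "continuous_on {l0 - \<rho>..l0 + \<rho>} B"
          by (rule continuous_on_subset[OF B(1)]) simp
      qed (use \<rho> pos BGL in \<open>simp_all add: d_def\<close>)
      then have "?L (l0 + \<rho>) \<in> GL" by (simp add: A_homotopic_def admissible_def)
      then show False
        using r3(2)[rule_format, OF conjI[OF \<rho>(1) lt(3)] conjI[OF real_analytic_on_const hom]]
        by (simp add: chi_interval_const_GL)
    qed
    moreover have "d (l0 - \<rho>) * d (l0 + \<rho>) \<noteq> 0" using nz by simp
    ultimately show "f (blinfun_inverse (B (l0 - \<rho>)) (?L (l0 - \<rho>) \<phi>0)) *
      f (blinfun_inverse (B (l0 + \<rho>)) (?L (l0 + \<rho>) \<phi>0)) < 0"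
      unfolding d_def by linarith
  qed
qed

section \<open>Parametrices along an interval\<close>

text \<open>The remainders I - P(l) L(l) map the unit ball into one compact set for all l at once.
  This uniformity makes the later fixed point map compact jointly in l and u.\<close>

definition parametrix :: "(real \<Rightarrow> 'u::real_normed_vector \<Rightarrow>\<^sub>L 'v::real_normed_vector) \<Rightarrow> real \<Rightarrow> real \<Rightarrow> (real \<Rightarrow> 'v \<Rightarrow>\<^sub>L 'u) \<Rightarrow> bool"
  where "parametrix L a b P \<longleftrightarrow> continuous_on {a..b} P \<and> (\<forall>l\<in>{a..b}. P l \<in> GL) \<and>
    (\<exists>K. compact K \<and> (\<forall>l\<in>{a..b}. \<forall>u. norm u \<le> 1 \<longrightarrow> u - P l (L l u) \<in> K))"

text \<open>C = P1(c) P2(c)^-1 makes the second family match the first at c. It differs from the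
  identity by a compact operator, since I - C = (I - P1(c) L(c)) - C (I - P2(c) L(c)), so left
  multiplication by C preserves the parametrix property.\<close>

lemma parametrix_transform:
  assumes P1: "parametrix L a1 b1 P1" and P2: "parametrix L a2 b2 P2"
    and c: "c \<in> {a1..b1}" "c \<in> {a2..b2}"
  shows "\<exists>C. parametrix L a2 b2 (\<lambda>l. C o\<^sub>L P2 l) \<and> C o\<^sub>L P2 c = P1 c"
proof -
  obtain K1 where K1: "compact K1" "\<And>l u. l \<in> {a1..b1} \<Longrightarrow> norm u \<le> 1 \<Longrightarrow> u - P1 l (L l u) \<in> K1"
    and g1: "\<And>l. l \<in> {a1..b1} \<Longrightarrow> P1 l \<in> GL"
    using P1 unfolding parametrix_def by blast
  obtain K2 where K2: "compact K2" "\<And>l u. l \<in> {a2..b2} \<Longrightarrow> norm u \<le> 1 \<Longrightarrow> u - P2 l (L l u) \<in> K2"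
    and g2: "\<And>l. l \<in> {a2..b2} \<Longrightarrow> P2 l \<in> GL" "continuous_on {a2..b2} P2"
    using P2 unfolding parametrix_def by blast
  define C where "C = P1 c o\<^sub>L blinfun_inverse (P2 c)"
  have Cc: "C (P2 c v) = P1 c v" for v using g2(1)[OF c(2)] by (simp add: C_def)
  define K where "K = {x + z |x z. x \<in> {x - y |x y. x \<in> K1 \<and> y \<in> C ` K2} \<and> z \<in> C ` K2}"
  have "compact (C ` K2)"
    by (intro compact_continuous_image K2 continuous_intros)
  then have "compact K"
    unfolding K_def by (intro compact_sums compact_differences K1)
  moreover have "u - C (P2 l (L l u)) \<in> K" if "l \<in> {a2..b2}" "norm u \<le> 1" for l u
  proof -
    define x where "x = u - P1 c (L c u)"
    define y where "y = u - P2 c (L c u)"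
    define z where "z = u - P2 l (L l u)"
    have "C y = C u - P1 c (L c u)" by (simp add: y_def blinfun.diff_right Cc)
    then have "x - C y + C z = u - C (P2 l (L l u))" by (simp add: x_def z_def blinfun.diff_right)
    moreover have "x \<in> K1" "y \<in> K2" "z \<in> K2" using K1(2) K2(2) c that by (auto simp: x_def y_def z_def)
    then have "x - C y + C z \<in> K" unfolding K_def by blast
    ultimately show ?thesis by simp
  qed
  moreover have "continuous_on {a2..b2} (\<lambda>l. C o\<^sub>L P2 l)"
    by (intro bounded_bilinear.continuous_on[OF bounded_bilinear_blinfun_compose] continuous_on_const g2)
  moreover have "C o\<^sub>L P2 l \<in> GL" if "l \<in> {a2..b2}" for l
    unfolding C_def using c that by (intro blinfun_compose_in_GL blinfun_inverse_in_GL g1 g2)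
  ultimately have "parametrix L a2 b2 (\<lambda>l. C o\<^sub>L P2 l)"
    unfolding parametrix_def by auto
  moreover have "C o\<^sub>L P2 c = P1 c" by (rule blinfun_eqI) (simp add: Cc)
  ultimately show ?thesis by blast
qed

lemma parametrix_join:
  assumes P1: "parametrix L a c P1" and P2: "parametrix L c b P2" and eq: "P1 c = P2 c" and "a \<le> c" "c \<le> b"
  shows "parametrix L a b (\<lambda>l. if l \<le> c then P1 l else P2 l)"
proof -
  obtain K1 where K1: "compact K1" "\<And>l u. l \<in> {a..c} \<Longrightarrow> norm u \<le> 1 \<Longrightarrow> u - P1 l (L l u) \<in> K1"
    using P1 unfolding parametrix_def by blast
  obtain K2 where K2: "compact K2" "\<And>l u. l \<in> {c..b} \<Longrightarrow> norm u \<le> 1 \<Longrightarrow> u - P2 l (L l u) \<in> K2"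
    using P2 unfolding parametrix_def by blast
  have "continuous_on ({a..c} \<union> {c..b}) (\<lambda>l. if l \<le> c then P1 l else P2 l)"
    using P1 P2 eq by (intro continuous_on_If) (auto simp: parametrix_def dest!: order_antisym)
  moreover have "{a..c} \<union> {c..b} = {a..b}" using assms by auto
  moreover have "\<forall>l\<in>{a..b}. \<forall>u. norm u \<le> 1 \<longrightarrow> u - (if l \<le> c then P1 l else P2 l) (L l u) \<in> K1 \<union> K2"
    using K1 K2 by auto
  moreover have "\<forall>l\<in>{a..b}. (if l \<le> c then P1 l else P2 l) \<in> GL"
    using P1 P2 by (auto simp: parametrix_def)
  ultimately show ?thesis
    unfolding parametrix_def
    by (intro conjI exI[of _ "K1 \<union> K2"] compact_Un K1(1) K2(1)) (simp only:)+
qed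

text \<open>Gluing changes only one of the two families. The mirrored version follows because an
  extension to both sides must leave the middle piece untouched.\<close>

lemma parametrix_glue_right:
  assumes "parametrix L a c P1" "parametrix L c b P2" "a \<le> c" "c \<le> b"
  shows "\<exists>P. parametrix L a b P \<and> (\<forall>l\<in>{a..c}. P l = P1 l)"
proof -
  obtain C where C: "parametrix L c b (\<lambda>l. C o\<^sub>L P2 l)" "C o\<^sub>L P2 c = P1 c"
    using parametrix_transform[OF assms(1,2), of c] assms by auto
  then show ?thesis
    using parametrix_join[OF assms(1) C(1)] assms by (intro exI conjI) auto
qed

lemma parametrix_glue_left:
  assumes "parametrix L a c P1" "parametrix L c b P2" "a \<le> c" "c \<le> b"
  shows "\<exists>P. parametrix L a b P \<and> (\<forall>l\<in>{c..b}. P l = P2 l)"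
proof -
  obtain C where C: "parametrix L a c (\<lambda>l. C o\<^sub>L P1 l)" "C o\<^sub>L P1 c = P2 c"
    using parametrix_transform[OF assms(2,1), of c] assms by auto
  then show ?thesis
    using parametrix_join[OF C(1) assms(2)] assms by (intro exI conjI) auto
qed

text \<open>A compact correction K that makes L(x) + K invertible keeps L(l) + K invertible nearby.
  With P its inverse, I - P L = P K.\<close>

lemma parametrix_local:
  fixes L :: "real \<Rightarrow> 'u::banach \<Rightarrow>\<^sub>L 'v::banach"
  assumes cont: "continuous_on UNIV L" and "L x \<in> Phi0"
  shows "\<exists>d>0. \<forall>a b. a \<le> x \<and> x \<le> b \<and> b - a < d \<longrightarrow> (\<exists>P. parametrix L a b P)"
proof -
  obtain K \<K> where K: "L x + K \<in> GL" "compact \<K>" "\<And>u. norm u \<le> 1 \<Longrightarrow> blinfun_apply K u \<in> \<K>"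
    using Phi0_perturbation_in_GL[OF assms(2)] by metis
  have cont': "continuous_on UNIV (\<lambda>l. L l + K)" by (intro continuous_on_add cont continuous_on_const)
  have "open ((\<lambda>l. L l + K) -` GL)" by (rule open_vimage[OF open_GL cont'])
  then obtain d where d: "d > 0" "\<And>l. dist l x < d \<Longrightarrow> L l + K \<in> GL"
    using K(1) unfolding open_dist by blast
  have "\<exists>P. parametrix L a b P" if ab: "a \<le> x" "x \<le> b" "b - a < d" for a b
  proof
    define P where "P l = blinfun_inverse (L l + K)" for l
    have gl: "L l + K \<in> GL" if "l \<in> {a..b}" for l
      using that ab by (intro d(2)) (auto simp: dist_real_def)
    have contP: "continuous_on {a..b} P"
      unfolding P_def
      by (rule continuous_on_compose2[OF continuous_on_blinfun_inverse continuous_on_subset[OF cont']]) (use gl in auto)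
    have "continuous_on ({a..b} \<times> \<K>) (\<lambda>x. P (fst x) (snd x))"
      by (intro bounded_bilinear.continuous_on[OF bounded_bilinear_blinfun_apply] continuous_on_snd continuous_on_id
          continuous_on_compose2[OF contP] continuous_on_fst) auto
    then have "compact ((\<lambda>x. P (fst x) (snd x)) ` ({a..b} \<times> \<K>))"
      by (intro compact_continuous_image compact_Times K) auto
    moreover have "u - P l (L l u) \<in> (\<lambda>x. P (fst x) (snd x)) ` ({a..b} \<times> \<K>)" if "l \<in> {a..b}" "norm u \<le> 1" for l u
    proof -
      have "P l ((L l + K) u) = u" using gl that by (simp add: P_def)
      then have "u - P l (L l u) = P l (K u)" by (simp add: blinfun.add_left blinfun.add_right algebra_simps)
      then show ?thesis using that K(3) by (intro image_eqI[of _ _ "(l, K u)"]) auto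
    qed
    ultimately show "parametrix L a b P"
      unfolding parametrix_def using contP gl by (auto simp: P_def blinfun_inverse_in_GL)
  qed
  then show ?thesis using d(1) by blast
qed

lemma parametrix_exists:
  fixes L :: "real \<Rightarrow> 'u::banach \<Rightarrow>\<^sub>L 'v::banach"
  assumes cont: "continuous_on UNIV L" and Phi: "\<And>l. L l \<in> Phi0" and "a \<le> b"
  shows "\<exists>P. parametrix L a b P"
  using \<open>a \<le> b\<close>
proof (induction rule: Bolzano)
  case (trans a b c)
  then show ?case using parametrix_glue_right by metis
qed (use parametrix_local[OF cont Phi] in blast)

text \<open>Near l0 the parametrix has to be the inverse of B, because the sign of d is computed
  with it, whereas a compact branch may stretch over a long parameter interval.\<close>

lemma parametrix_extension:
  fixes L :: "real \<Rightarrow> 'u::banach \<Rightarrow>\<^sub>L 'v::banach"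
  assumes cont: "continuous_on UNIV L" and Phi: "\<And>l. L l \<in> Phi0" and P0: "parametrix L c d P0"
    and "a \<le> c" "c \<le> d" "d \<le> b"
  obtains P where "parametrix L a b P" "\<And>l. l \<in> {c..d} \<Longrightarrow> P l = P0 l"
proof -
  obtain P1 P2 where P12: "parametrix L a c P1" "parametrix L d b P2"
    using parametrix_exists[OF cont Phi] assms by metis
  obtain Q where Q: "parametrix L a d Q" "\<forall>l\<in>{c..d}. Q l = P0 l"
    using parametrix_glue_left[OF P12(1) P0] assms by blast
  obtain P where "parametrix L a b P" "\<forall>l\<in>{a..d}. P l = Q l"
    using parametrix_glue_right[OF Q(1) P12(2)] assms by (meson order_trans)
  then show ?thesis using that[of P] Q(2) assms by auto
qed

text \<open>The remainder is f(u) (\<phi>0 - q(l)) with q(l) = B(l)^-1 L(l) \<phi>0: of rank at most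
  one for each l, and continuous in l.\<close>

lemma parametrix_of_reduction:
  fixes L B :: "real \<Rightarrow> 'u::banach \<Rightarrow>\<^sub>L 'v::banach" and f :: "'u \<Rightarrow>\<^sub>L real"
  assumes contL: "continuous_on {a..b} L" and contB: "continuous_on {a..b} B"
    and B: "\<And>l. l \<in> {a..b} \<Longrightarrow> B l \<in> GL"
    and L: "\<And>l u. blinfun_apply (L l) u = B l (u - f u *\<^sub>R \<phi>0) + f u *\<^sub>R L l \<phi>0"
  shows "parametrix L a b (\<lambda>l. blinfun_inverse (B l))"
proof -
  define P where "P l = blinfun_inverse (B l)" for l
  have contP: "continuous_on {a..b} P"
    unfolding P_def by (rule continuous_on_compose2[OF continuous_on_blinfun_inverse contB]) (use B in auto)
  define h where "h x = fst x *\<^sub>R (\<phi>0 - P (snd x) (L (snd x) \<phi>0))" for x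
  let ?D = "{- norm f..norm f} \<times> {a..b}"
  have "continuous_on ?D h"
    unfolding h_def
    by (intro continuous_on_scaleR continuous_on_diff continuous_on_const continuous_on_fst continuous_on_id
        bounded_bilinear.continuous_on[OF bounded_bilinear_blinfun_apply]
        continuous_on_compose2[OF contP] continuous_on_compose2[OF contL] continuous_on_snd) auto
  then have "compact (h ` ?D)" by (intro compact_continuous_image compact_Times) auto
  moreover have "u - P l (L l u) \<in> h ` ?D" if "l \<in> {a..b}" "norm u \<le> 1" for l u
  proof -
    have "P l (L l u) = u - f u *\<^sub>R \<phi>0 + f u *\<^sub>R P l (L l \<phi>0)"
      using L[of l u] B[OF that(1)] by (simp add: P_def blinfun.add_right blinfun.scaleR_right)
    then have "u - P l (L l u) = h (f u, l)" by (simp add: h_def algebra_simps)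
    moreover have "\<bar>f u\<bar> \<le> norm f" using norm_blinfun[of f u] mult_left_mono[OF that(2), of "norm f"] by simp
    then have "f u \<in> {- norm f..norm f}" by auto
    ultimately show ?thesis using that(1) by (intro image_eqI[of _ _ "(f u, l)"]) auto
  qed
  ultimately show ?thesis
    unfolding parametrix_def using contP B by (auto simp: P_def blinfun_inverse_in_GL)
qed

section \<open>Isolated branches of compact vector fields\<close>

text \<open>Below the slice f u = \<sigma> the s component is frozen at \<sigma> in the equation,
  and far out the equation is replaced by an affine model. By \<open>slice\<close>, A meets the
  slice exactly inside the box \<bar>l - l0\<bar> < \<rho>, norm z < \<sigma>; by
  \<open>bdry\<close>, the homotopy to the model has no zeros on the boundary of the box. So the
  zero set of the modified map G falls into two disjoint closed parts. A function \<tau> positive on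
  one and negative on the other makes (\<tau>, G) zero-free, although it equals the bijective affine
  map (R - s, A0) outside a ball.\<close>

lemma no_isolated_branch:
  fixes k :: "real \<times> 'u::real_normed_vector \<Rightarrow> 'u" and f :: "'u \<Rightarrow>\<^sub>L real" and \<phi>0 :: 'u
  assumes contk: "continuous_on ({a..b} \<times> UNIV) k"
    and compk: "\<And>R. \<exists>K. compact K \<and> (\<forall>l\<in>{a..b}. \<forall>u. norm u \<le> R \<longrightarrow> k (l, u) \<in> K)"
    and f: "f \<phi>0 = 1" and n\<phi>: "norm \<phi>0 = 1"
    and pos: "\<sigma> > 0" "\<rho> > 0" and e: "e \<noteq> 0" and ab: "a \<le> l0 - \<rho>" "l0 + \<rho> \<le> b"
    and Z1: "Z1 = {(l, u). l \<in> {a..b} \<and> f u \<ge> \<sigma> \<and> k (l, u) = u}"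
    and A: "compact A" "A \<subseteq> Z1" "A \<subseteq> {a<..<b} \<times> UNIV" and cloA: "closed (Z1 - A)"
    and slice: "\<And>l u. (l, u) \<in> Z1 \<Longrightarrow> f u = \<sigma> \<Longrightarrow> (l, u) \<in> A \<longleftrightarrow> \<bar>l - l0\<bar> < \<rho> \<and> norm (u - \<sigma> *\<^sub>R \<phi>0) < \<sigma>"
    and bdry: "\<And>t l u. t \<in> {0..1} \<Longrightarrow> f u = \<sigma> \<Longrightarrow> \<bar>l - l0\<bar> \<le> \<rho> \<Longrightarrow> norm (u - \<sigma> *\<^sub>R \<phi>0) \<le> \<sigma> \<Longrightarrow>
      \<bar>l - l0\<bar> = \<rho> \<or> norm (u - \<sigma> *\<^sub>R \<phi>0) = \<sigma> \<Longrightarrow>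
      t *\<^sub>R (u - k (l, u)) + (1 - t) *\<^sub>R (u - \<sigma> *\<^sub>R \<phi>0 + (\<sigma> * e * (l - l0)) *\<^sub>R \<phi>0) \<noteq> 0"
  shows False
proof -
  define x0 where "x0 = (l0, 0::'u)"
  define s where "s x = f (snd x)" for x :: "real \<times> 'u"
  define z where "z x = snd x - s x *\<^sub>R \<phi>0" for x :: "real \<times> 'u"
  \<comment> \<open>A point below the slice is lifted to it; all others stay where they are.\<close>
  define uh where "uh x = z x + max (s x) \<sigma> *\<^sub>R \<phi>0" for x :: "real \<times> 'u"
  \<comment> \<open>Control of \<open>k\<close> is available for l in [a, b] only, so l is
    clamped.\<close>
  define cl where "cl l = max a (min b l)" for l
  define \<kappa> where "\<kappa> x = k (cl (fst x), uh x)" for x :: "real \<times> 'u"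
  \<comment> \<open>Affine model of the slice equation, bijective in (l, z). It does not involve s,
    which is left for the additional scalar equation.\<close>
  define A0 where "A0 x = z x + (\<sigma> * e * (fst x - l0)) *\<^sub>R \<phi>0" for x :: "real \<times> 'u"
  have "a \<le> b" using ab pos by linarith
  have cl_in: "cl l \<in> {a..b}" for l using \<open>a \<le> b\<close> by (auto simp: cl_def)
  have cl_id: "cl l = l" if "l \<in> {a..b}" for l using that by (auto simp: cl_def)
  have cs: "continuous_on UNIV s" unfolding s_def by (intro continuous_intros)
  have cz: "continuous_on UNIV z" unfolding z_def by (intro continuous_intros cs)
  have cuh: "continuous_on UNIV uh" unfolding uh_def by (intro continuous_intros cs cz)
  have c\<kappa>: "continuous_on UNIV \<kappa>"
    unfolding \<kappa>_def
    by (rule continuous_on_compose2[OF contk])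
      (auto intro!: continuous_intros cuh simp: cl_def \<open>a \<le> b\<close>)
  have cA0: "continuous_on UNIV A0" unfolding A0_def by (intro continuous_intros cz)
  have sz: "f (z x) = 0" for x by (simp add: z_def s_def blinfun.diff_right blinfun.scaleR_right f)
  have suh: "f (uh x) = max (s x) \<sigma>" for x by (simp add: uh_def sz blinfun.add_right blinfun.scaleR_right f)
  have uh_id: "uh x = snd x" if "s x \<ge> \<sigma>" for x using that by (simp add: uh_def z_def max_def)
  have uh_low: "uh x = z x + \<sigma> *\<^sub>R \<phi>0" if "s x \<le> \<sigma>" for x using that by (simp add: uh_def max_def)

  \<comment> \<open>The modified equation and the splitting of its zero set\<close>
  obtain R0 where R0: "\<And>x. x \<in> A \<Longrightarrow> dist x0 x \<le> R0"
    using compact_imp_bounded[OF A(1)] unfolding bounded_any_center[of A x0] by blast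
  \<comment> \<open>The ball of radius R about (l0, 0) contains A and the box in the slice, where
    norm u is at most 2 \<sigma>.\<close>
  define R where "R = max R0 (\<rho> + 2 * \<sigma>) + 1"
  have R: "R > \<sigma>" "R > 0" "\<And>x. x \<in> A \<Longrightarrow> dist x x0 < R" "R > \<rho> + 2 * \<sigma>"
  proof -
    show "R > \<sigma>" "R > 0" "R > \<rho> + 2 * \<sigma>" using pos by (auto simp: R_def)
    show "dist x x0 < R" if "x \<in> A" for x using R0[OF that] by (simp add: R_def dist_commute)
  qed
  \<comment> \<open>Cutoff: G is built from \<open>k\<close> alone up to radius R and is the affine
    model from radius R + 1 on.\<close>
  define tt where "tt x = max 0 (min 1 (R + 1 - dist x x0))" for x
  have tt: "tt x \<in> {0..1}" for x by (auto simp: tt_def)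
  have ctt: "continuous_on UNIV tt" unfolding tt_def by (intro continuous_intros)
  define G where "G x = tt x *\<^sub>R (uh x - \<kappa> x) + (1 - tt x) *\<^sub>R A0 x" for x
  have cG: "continuous_on UNIV G" unfolding G_def by (intro continuous_intros ctt cuh c\<kappa> cA0)
  have G_in: "G x = snd x - k x" if "s x \<ge> \<sigma>" "dist x x0 \<le> R" "fst x \<in> {a..b}" for x
    using that by (simp add: G_def tt_def \<kappa>_def uh_id cl_id)
  have G_out: "G x = A0 x" if "dist x x0 \<ge> R + 1" for x
    using that by (simp add: G_def tt_def)
  define Zs where "Zs = {x. G x = 0}"
  have cloZs: "closed Zs" unfolding Zs_def by (intro closed_Collect_eq cG continuous_on_const)
  \<comment> \<open>Zeros under the slice in the closed box. There G is one of the convex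
    combinations that \<open>bdry\<close> excludes on the boundary, so these zeros lie in the open
    box.\<close>
  define In where "In = Zs \<inter> {x. s x \<le> \<sigma> \<and> \<bar>fst x - l0\<bar> \<le> \<rho> \<and> norm (z x) \<le> \<sigma>}"
  have In_strict: "\<bar>fst x - l0\<bar> < \<rho> \<and> norm (z x) < \<sigma>" if x: "x \<in> In" for x
  proof (rule ccontr)
    assume "\<not> ?thesis"
    then have eq: "\<bar>fst x - l0\<bar> = \<rho> \<or> norm (z x) = \<sigma>" using x by (auto simp: In_def)
    have sx: "s x \<le> \<sigma>" and le: "\<bar>fst x - l0\<bar> \<le> \<rho>" "norm (z x) \<le> \<sigma>" and G0: "G x = 0"
      using x by (auto simp: In_def Zs_def)
    have "fst x \<in> {a..b}" using le(1) ab by auto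
    then have "\<kappa> x = k (fst x, uh x)" by (simp add: \<kappa>_def cl_id)
    moreover have "uh x - \<sigma> *\<^sub>R \<phi>0 = z x" using uh_low[OF sx] by simp
    moreover have "f (uh x) = \<sigma>" using suh sx by (simp add: max_def)
    ultimately show False
      using bdry[OF tt[of x], of "uh x" "fst x"] le eq G0 by (simp add: G_def A0_def)
  qed
  have cloIn: "closed In"
    unfolding In_def by (intro closed_Int cloZs closed_Collect_conj closed_Collect_le continuous_intros cs cz)
  define Zin where "Zin = A \<union> In"
  have cloZin: "closed Zin" unfolding Zin_def by (intro closed_Un compact_imp_closed A(1) cloIn)
  have A_props: "s x \<ge> \<sigma>" "fst x \<in> {a<..<b}" "fst x \<in> {a..b}" "dist x x0 < R" "x \<in> Zs" "k x = snd x" if x: "x \<in> A" for x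
  proof -
    show 1: "s x \<ge> \<sigma>" "fst x \<in> {a<..<b}" "fst x \<in> {a..b}" "dist x x0 < R" "k x = snd x"
      using subsetD[OF A(2) x] subsetD[OF A(3) x] R(3)[OF x] by (cases x; auto simp: s_def Z1)+
    show "x \<in> Zs" using G_in[of x] 1 by (simp add: Zs_def)
  qed
  have Zin_sub: "Zin \<subseteq> Zs" using A_props(5) by (auto simp: Zin_def In_def)
  \<comment> \<open>Four closed sets make up the remaining zeros: true solutions outside A, points
    at distance at least R, points with l outside (a, b), and points under the slice outside the
    open box. Closedness of both parts is needed to separate them by distances.\<close>
  define O1 where "O1 = (Z1 - A) \<inter> cball x0 R"
  define O2 where "O2 = Zs \<inter> {x. s x \<ge> \<sigma> \<and> dist x x0 \<ge> R}"
  define O3 where "O3 = Zs \<inter> {x. s x \<ge> \<sigma> \<and> (fst x \<le> a \<or> fst x \<ge> b)}"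
  define O4 where "O4 = Zs \<inter> {x. s x \<le> \<sigma> \<and> (\<bar>fst x - l0\<bar> \<ge> \<rho> \<or> norm (z x) \<ge> \<sigma>)}"
  have cloO: "closed (O1 \<union> O2 \<union> O3 \<union> O4)"
    unfolding O1_def O2_def O3_def O4_def
    by (intro closed_Un closed_Int cloZs cloA closed_cball closed_Collect_conj closed_Collect_disj closed_Collect_le
        continuous_intros cs cz)
  define Zout where "Zout = Zs - Zin"
  have "Zout = O1 \<union> O2 \<union> O3 \<union> O4"
  proof
    show "Zout \<subseteq> O1 \<union> O2 \<union> O3 \<union> O4"
    proof
      fix x assume x: "x \<in> Zout"
      then have xZ: "x \<in> Zs" "x \<notin> A" "x \<notin> In" by (auto simp: Zout_def Zin_def)
      show "x \<in> O1 \<union> O2 \<union> O3 \<union> O4"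
      proof (cases "s x \<ge> \<sigma>")
        case True
        show ?thesis
        proof (cases "dist x x0 \<ge> R \<or> fst x \<le> a \<or> fst x \<ge> b")
          case True
          then show ?thesis using \<open>s x \<ge> \<sigma>\<close> xZ by (auto simp: O2_def O3_def)
        next
          case False
          then have "G x = snd x - k x" using \<open>s x \<ge> \<sigma>\<close> by (intro G_in) auto
          then have "k x = snd x" using xZ by (simp add: Zs_def)
          then have "x \<in> Z1" using False \<open>s x \<ge> \<sigma>\<close> unfolding Z1 by (cases x) (auto simp: s_def)
          then show ?thesis using xZ False by (auto simp: O1_def dist_commute)
        qed
      next
        case False
        then show ?thesis using xZ by (auto simp: In_def O4_def)
      qed
    qed
    have sub: "x \<in> Zs" if "x \<in> O1" for x
    proof -
      have "x \<in> Z1" "dist x x0 \<le> R" using that by (auto simp: O1_def dist_commute)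
      then have "s x \<ge> \<sigma>" "fst x \<in> {a..b}" "k x = snd x" by (cases x; auto simp: Z1 s_def)+
      then show ?thesis using G_in[of x] \<open>dist x x0 \<le> R\<close> by (simp add: Zs_def)
    qed
    have slice': "x \<in> A \<longleftrightarrow> \<bar>fst x - l0\<bar> < \<rho> \<and> norm (z x) < \<sigma>" if "x \<in> Z1" "s x = \<sigma>" for x
      using slice[of "fst x" "snd x"] that by (simp add: s_def z_def)
    have "x \<notin> Zin" if x: "x \<in> O1 \<union> O2 \<union> O3 \<union> O4" for x
    proof
      assume "x \<in> Zin"
      then consider "x \<in> A" | "x \<in> In" by (auto simp: Zin_def)
      then show False
      proof cases
        case 1
        have "x \<in> O4" using x 1 A_props[OF 1] by (auto simp: O1_def O2_def O3_def)
        then have "s x = \<sigma>" "\<not> (\<bar>fst x - l0\<bar> < \<rho> \<and> norm (z x) < \<sigma>)" using A_props(1)[OF 1] by (auto simp: O4_def)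
        then show False using slice'[of x] 1 A(2) by auto
      next
        case 2
        note st = In_strict[OF 2]
        have sx: "s x \<le> \<sigma>" using 2 by (auto simp: In_def)
        have "x \<notin> O4" using st by (auto simp: O4_def)
        then have "x \<in> O1 \<union> O2 \<union> O3" using x by blast
        then have "s x \<ge> \<sigma>" by (auto simp: O1_def O2_def O3_def Z1 s_def)
        then have sx: "s x = \<sigma>" using sx by simp
        have "x \<notin> O3" using st ab by (auto simp: O3_def)
        moreover have "x \<notin> O2"
        proof -
          have "snd x = z x + \<sigma> *\<^sub>R \<phi>0" using sx by (simp add: z_def)
          then have "norm (snd x) \<le> norm (z x) + \<sigma>" using norm_triangle_ineq[of "z x" "\<sigma> *\<^sub>R \<phi>0"] n\<phi> pos by simp
          moreover have "dist x x0 \<le> \<bar>fst x - l0\<bar> + norm (snd x)"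
            unfolding dist_prod_def x0_def using sqrt_sum_squares_le_sum[of "dist (fst x) l0" "dist (snd x) 0"]
            by (simp add: dist_real_def)
          ultimately show ?thesis using st R(4) by (auto simp: O2_def)
        qed
        ultimately have "x \<in> O1" using \<open>x \<in> O1 \<union> O2 \<union> O3\<close> by blast
        then have "x \<in> Z1" "x \<notin> A" by (auto simp: O1_def)
        then show False using slice'[OF _ sx] st by blast
      qed
    qed
    moreover have "O2 \<subseteq> Zs" "O3 \<subseteq> Zs" "O4 \<subseteq> Zs" by (auto simp: O2_def O3_def O4_def)
    ultimately show "O1 \<union> O2 \<union> O3 \<union> O4 \<subseteq> Zout" using sub unfolding Zout_def by blast
  qed
  then have cloZout: "closed Zout" using cloO by simp

  \<comment> \<open>A scalar function separating the two parts\<close>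
  have A0_0: "A0 x = 0 \<longleftrightarrow> fst x = l0 \<and> z x = 0" for x
  proof
    assume 0: "A0 x = 0"
    then have "f (A0 x) = 0" by simp
    then have "\<sigma> * e * (fst x - l0) = 0" by (simp add: A0_def blinfun.add_right blinfun.scaleR_right sz f)
    then have "fst x = l0" using pos e by simp
    then show "fst x = l0 \<and> z x = 0" using 0 by (simp add: A0_def)
  qed (simp add: A0_def)
  have line: "s (l0, r *\<^sub>R \<phi>0) = r" "z (l0, r *\<^sub>R \<phi>0) = 0" "dist (l0, r *\<^sub>R \<phi>0) x0 = \<bar>r\<bar>" for r
    by (simp_all add: s_def z_def x0_def blinfun.scaleR_right f dist_prod_def n\<phi>)
  have lineZ: "(l0, r *\<^sub>R \<phi>0) \<in> Zs" if "\<bar>r\<bar> \<ge> R + 1" for r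
    using that G_out[of "(l0, r *\<^sub>R \<phi>0)"] A0_0[of "(l0, r *\<^sub>R \<phi>0)"] line[of r] by (simp add: Zs_def)
  \<comment> \<open>Far out on the line l = l0, z = 0 the model vanishes; the lower end lies in
    \<open>Zin\<close> and the upper end in \<open>Zout\<close>. Non-emptiness matters because
    \<open>infdist\<close> to the empty set is 0.\<close>
  have "(l0, (- R - 1) *\<^sub>R \<phi>0) \<in> Zin"
    using lineZ[of "- R - 1"] line[of "- R - 1"] R pos by (simp add: Zin_def In_def)
  then have neIn: "Zin \<noteq> {}" by blast
  have "(l0, (R + 1) *\<^sub>R \<phi>0) \<in> Zout"
    unfolding \<open>Zout = O1 \<union> O2 \<union> O3 \<union> O4\<close> using lineZ[of "R + 1"] line[of "R + 1"] R pos by (simp add: O2_def)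
  then have neOut: "Zout \<noteq> {}" by blast
  define g where "g x = max (-1) (min 1 (infdist x Zout - infdist x Zin))" for x
  \<comment> \<open>The fading starts only at radius R + 1, where G is already the model. Beyond it
    the zeros of G lie on the line l = l0, z = 0, and there R - s has the same sign as
    \<open>g\<close>.\<close>
  define \<theta> where "\<theta> x = max 0 (min 1 (R + 2 - dist x x0))" for x
  define \<tau> where "\<tau> x = \<theta> x * g x + (1 - \<theta> x) * (R - s x)" for x
  have cg: "continuous_on UNIV g" unfolding g_def by (intro continuous_intros)
  have c\<theta>: "continuous_on UNIV \<theta>" unfolding \<theta>_def by (intro continuous_intros)
  have \<theta>: "0 \<le> \<theta> x" "\<theta> x \<le> 1" for x by (auto simp: \<theta>_def)
  have comb_pos: "c * p + (1 - c) * q > 0" if "0 \<le> c" "c \<le> 1" "p > 0" "q > 0" for c p q :: real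
  proof (cases "c = 0")
    case False
    then have "c * p > 0" "(1 - c) * q \<ge> 0" using that by auto
    then show ?thesis by linarith
  qed (use that in simp)
  have no_zero: "\<not> (\<tau> x = 0 \<and> G x = 0)" for x
  proof
    assume "\<tau> x = 0 \<and> G x = 0"
    then have \<tau>0: "\<tau> x = 0" and xZ: "x \<in> Zs" by (auto simp: Zs_def)
    show False
    proof (cases "x \<in> Zin")
      case True
      then have "infdist x Zin = 0" "infdist x Zout > 0"
        using cloZout neOut by (auto simp: Zout_def infdist_pos_not_in_closed)
      then have gp: "g x > 0" by (simp add: g_def)
      have "\<theta> x = 1 \<or> R - s x > 0"
      proof (cases "x \<in> A")
        case xA: True
        then show ?thesis using A_props(4)[OF xA] by (simp add: \<theta>_def)
      next
        case False
        then have "s x \<le> \<sigma>" using True by (auto simp: Zin_def In_def)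
        then show ?thesis using R(1) by simp
      qed
      then have "\<tau> x > 0"
        unfolding \<tau>_def using gp comb_pos[OF \<theta>(1)[of x] \<theta>(2)[of x] gp, of "R - s x"] by auto
      then show False using \<tau>0 by simp
    next
      case False
      then have "x \<in> Zout" using xZ by (simp add: Zout_def)
      then have "infdist x Zout = 0" "infdist x Zin > 0"
        using cloZin neIn False by (auto simp: infdist_pos_not_in_closed)
      then have gn: "- g x > 0" by (simp add: g_def)
      have "\<theta> x = 1 \<or> - (R - s x) > 0"
      proof (cases "dist x x0 \<le> R + 1")
        case True
        then show ?thesis by (simp add: \<theta>_def)
      next
        case far: False
        then have "A0 x = 0" using G_out[of x] xZ by (simp add: Zs_def)
        then have x: "fst x = l0" "z x = 0" using A0_0 by auto
        then have xe: "x = (l0, s x *\<^sub>R \<phi>0)" by (auto simp: z_def prod_eq_iff)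
        have "x \<notin> In" using False by (simp add: Zin_def)
        then have "s x > \<sigma>" using xZ x pos by (simp add: In_def)
        moreover have "\<bar>s x\<bar> > R + 1" using far line(3)[of "s x"] xe by simp
        ultimately show ?thesis using pos by auto
      qed
      then have "- \<tau> x > 0"
      proof
        assume "\<theta> x = 1"
        then show ?thesis using gn by (simp add: \<tau>_def)
      next
        assume "- (R - s x) > 0"
        from comb_pos[OF \<theta>(1)[of x] \<theta>(2)[of x] gn this] show ?thesis
          unfolding \<tau>_def by (simp only: mult_minus_right)
      qed
      then show False using \<tau>0 by simp
    qed
  qed

  \<comment> \<open>Reduction to Schauder's theorem\<close>
  define W where "W x = (\<theta> x * (R - s x - g x), tt x *\<^sub>R ((\<sigma> * e * (fst x - l0) - max (s x) \<sigma>) *\<^sub>R \<phi>0 + \<kappa> x))" for x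
  \<comment> \<open>\<open>Ti\<close> inverts the affine map (R - s, A0), and \<open>W\<close> is
    the difference between that map and (\<tau>, G). The component z cancels in \<open>W\<close>,
    which leaves a compact map, and fixed points of \<open>Ti\<close> after \<open>W\<close> are
    common zeros of \<tau> and G.\<close>
  define Ti where "Ti y = (l0 + f (snd y) / (\<sigma> * e), snd y - f (snd y) *\<^sub>R \<phi>0 + (R - fst y) *\<^sub>R \<phi>0)" for y :: "real \<times> 'u"
  have W: "W x = (R - s x - \<tau> x, A0 x - G x)" for x
    by (simp add: W_def \<tau>_def G_def A0_def uh_def algebra_simps)
  have fix_zero: "\<tau> x = 0 \<and> G x = 0" if fixp: "Ti (W x) = x" for x
  proof -
    define p w where pw: "p = R - s x - \<tau> x" "w = A0 x - G x"
    have 1: "fst x = l0 + f w / (\<sigma> * e)" and 2: "snd x = w - f w *\<^sub>R \<phi>0 + (R - p) *\<^sub>R \<phi>0"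
      using fixp unfolding W Ti_def pw by (auto simp: prod_eq_iff)
    have sx: "s x = R - p"
      unfolding s_def by (subst 2) (simp add: blinfun.add_right blinfun.diff_right blinfun.scaleR_right f)
    have "z x = w - f w *\<^sub>R \<phi>0" unfolding z_def sx by (subst 2) simp
    moreover have "\<sigma> * e * (fst x - l0) = f w" using 1 pos e by simp
    ultimately have "A0 x = w" by (simp add: A0_def)
    then show ?thesis using sx pw by simp
  qed
  have cTi: "continuous_on UNIV Ti" unfolding Ti_def by (intro continuous_intros) (use pos e in auto)
  have cW: "continuous_on UNIV W" unfolding W_def by (intro continuous_intros c\<theta> cs cg ctt c\<kappa>)
  \<comment> \<open>M bounds s on the ball of radius R + 2, outside which \<open>W\<close> vanishes.
    The radius used for \<open>k\<close> comes from bounding norm (uh x) by norm u + \<bar>s\<bar> +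
    max s \<sigma>.\<close>
  define M where "M = norm f * (R + 2)"
  have M: "M \<ge> 0" using R by (simp add: M_def)
  obtain K where K: "compact K" "\<And>l u. l \<in> {a..b} \<Longrightarrow> norm u \<le> R + 2 + 2 * M + \<sigma> \<Longrightarrow> k (l, u) \<in> K"
    using compk[of "R + 2 + 2 * M + \<sigma>"] by blast
  define M1 where "M1 = R + M + 1"
  define M2 where "M2 = \<sigma> * \<bar>e\<bar> * (R + 2) + M + \<sigma>"
  \<comment> \<open>\<open>W\<close> factors through a compact product: its first component, the
    cutoff, the coefficient of \<phi>0 and the value of \<kappa>. The element 0 is added to K for
    points outside the ball, where \<open>W\<close> is 0.\<close>
  define h where "h y = (fst y, fst (snd y) *\<^sub>R (fst (snd (snd y)) *\<^sub>R \<phi>0 + snd (snd (snd y))))" for y :: "real \<times> real \<times> real \<times> 'u"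
  let ?D = "{-M1..M1} \<times> {0..1} \<times> {-M2..M2} \<times> insert 0 K"
  have "compact (h ` ?D)"
    unfolding h_def
    by (intro compact_continuous_image continuous_intros compact_Times compact_Icc) (use K(1) in auto)
  moreover have "W x \<in> h ` ?D" for x
  proof (cases "dist x x0 \<le> R + 2")
    case True
    have nl: "\<bar>fst x - l0\<bar> \<le> R + 2" and nu: "norm (snd x) \<le> R + 2"
      using True dist_fst_le[of x x0] dist_snd_le[of x x0] by (auto simp: x0_def dist_real_def)
    have ns: "\<bar>s x\<bar> \<le> M"
      using norm_blinfun[of f "snd x"] mult_left_mono[OF nu, of "norm f"] by (simp add: s_def M_def)
    have g1: "\<bar>g x\<bar> \<le> 1" by (auto simp: g_def)
    have "\<bar>R - s x - g x\<bar> \<le> M1" using ns g1 R by (auto simp: M1_def)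
    then have "\<bar>\<theta> x * (R - s x - g x)\<bar> \<le> M1"
      using mult_mono[of "\<bar>\<theta> x\<bar>" 1 "\<bar>R - s x - g x\<bar>" M1] \<theta>[of x] by (simp add: abs_mult)
    then have 1: "\<theta> x * (R - s x - g x) \<in> {-M1..M1}" by auto
    have "\<bar>\<sigma> * e * (fst x - l0)\<bar> \<le> \<sigma> * \<bar>e\<bar> * (R + 2)"
      using mult_left_mono[OF nl, of "\<sigma> * \<bar>e\<bar>"] pos by (simp add: abs_mult)
    moreover have "0 \<le> max (s x) \<sigma>" "max (s x) \<sigma> \<le> M + \<sigma>" using ns pos M by auto
    ultimately have 2: "\<sigma> * e * (fst x - l0) - max (s x) \<sigma> \<in> {-M2..M2}"
      unfolding M2_def atLeastAtMost_iff abs_le_iff by linarith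
    have "norm (uh x) \<le> norm (snd x) + \<bar>s x\<bar> + max (s x) \<sigma>"
    proof -
      have "norm (uh x) \<le> norm (z x) + norm (max (s x) \<sigma> *\<^sub>R \<phi>0)" unfolding uh_def by (rule norm_triangle_ineq)
      moreover have "norm (z x) \<le> norm (snd x) + norm (s x *\<^sub>R \<phi>0)" unfolding z_def by (rule norm_triangle_ineq4)
      ultimately show ?thesis using pos by (simp add: n\<phi>)
    qed
    also have "\<dots> \<le> R + 2 + 2 * M + \<sigma>"
      using nu ns \<open>max (s x) \<sigma> \<le> M + \<sigma>\<close> by linarith
    finally have "\<kappa> x \<in> K" unfolding \<kappa>_def by (rule K(2)[OF cl_in])
    then show ?thesis
      using 1 2 tt[of x]
      by (intro image_eqI[of _ _ "(\<theta> x * (R - s x - g x), tt x, \<sigma> * e * (fst x - l0) - max (s x) \<sigma>, \<kappa> x)"])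
        (simp_all add: W_def h_def)
  next
    case False
    then have "W x = (0, 0)" by (simp add: W_def \<theta>_def tt_def)
    moreover have "M1 \<ge> 0" "M2 \<ge> 0" using M R pos by (auto simp: M1_def M2_def)
    ultimately show ?thesis by (intro image_eqI[of _ _ "(0, 0, 0, 0)"]) (auto simp: h_def)
  qed
  ultimately have "compact (Ti ` h ` ?D)" "range (\<lambda>x. Ti (W x)) \<subseteq> Ti ` h ` ?D"
    using compact_continuous_image[OF continuous_on_subset[OF cTi]] by blast+
  moreover have "continuous_on UNIV (\<lambda>x. Ti (W x))"
    by (rule continuous_on_compose2[OF cTi cW]) auto
  ultimately obtain x where "Ti (W x) = x" using schauder_fixed_point by blast
  then show False using fix_zero no_zero by blast
qed

section \<open>Isolated branches of solutions\<close>

lemma linearization_remainder_uniform: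
  fixes F :: "real \<times> 'u::real_normed_vector \<Rightarrow> 'v::real_normed_vector"
  assumes C1: "C1_map F" and F1: "\<forall>l. F (l, 0) = 0" and "\<kappa> > 0" and "compact I"
  shows "\<exists>r>0. \<forall>l\<in>I. \<forall>u. norm u < r \<longrightarrow> norm (F (l, u) - blinfun_apply (linearization F l) u) \<le> \<kappa> * norm u"
proof -
  have "\<forall>l1. \<exists>r>0. \<forall>l u. \<bar>l - l1\<bar> < r \<and> norm u < r \<longrightarrow>
      norm (F (l, u) - blinfun_apply (linearization F l) u) \<le> \<kappa> * norm u"
    by (intro allI linearization_remainder[OF C1 F1 \<open>\<kappa> > 0\<close>])
  from choice[OF this] obtain r where r': "\<forall>l1. r l1 > 0 \<and> (\<forall>l u. \<bar>l - l1\<bar> < r l1 \<and> norm u < r l1 \<longrightarrow>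
      norm (F (l, u) - blinfun_apply (linearization F l) u) \<le> \<kappa> * norm u)" ..
  have r: "r l1 > 0" "\<bar>l - l1\<bar> < r l1 \<Longrightarrow> norm u < r l1 \<Longrightarrow>
      norm (F (l, u) - blinfun_apply (linearization F l) u) \<le> \<kappa> * norm u" for l1 l u
    using r'[rule_format, of l1] by auto
  have "I \<subseteq> (\<Union>l\<in>I. ball l (r l))" using r(1) by auto
  then obtain T where T: "finite T" "I \<subseteq> (\<Union>l\<in>T. ball l (r l))"
    by (rule compactE_image[OF \<open>compact I\<close>, rotated]) auto
  \<comment> \<open>The 1 keeps the minimum meaningful when \<open>T\<close> is empty.\<close>
  define r0 where "r0 = Min (insert 1 (r ` T))"
  have r0: "r0 > 0" "\<And>l. l \<in> T \<Longrightarrow> r0 \<le> r l" using T(1) r(1) by (auto simp: r0_def)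
  show ?thesis
  proof (intro exI[of _ r0] conjI ballI allI impI)
    fix l and u :: 'u assume "l \<in> I" "norm u < r0"
    then obtain l1 where "l1 \<in> T" "l \<in> ball l1 (r l1)" using T(2) by blast
    then have "l1 \<in> T" "\<bar>l - l1\<bar> < r l1" by (auto simp: dist_real_def)
    then show "norm (F (l, u) - blinfun_apply (linearization F l) u) \<le> \<kappa> * norm u"
      using r(2)[of l l1 u] r0(2)[of l1] \<open>norm u < r0\<close> by simp
  qed (rule r0(1))
qed

text \<open>On bounded sets J u ranges in a compact set, so N(l, J u) contributes compactly; with
  the compact remainder of the parametrix this makes u - P(l) F(l, u) completely continuous.\<close>

lemma parametrix_compact_perturbation:
  fixes F :: "real \<times> 'u::banach \<Rightarrow> 'v::banach" and J :: "'u \<Rightarrow>\<^sub>L 'v"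
  assumes P: "parametrix L a b P" and J: "compact_operator J" and N: "continuous_on UNIV N"
    and F: "\<And>l u. F (l, u) = blinfun_apply (L l) u + N (l, blinfun_apply J u)"
  shows "\<exists>K. compact K \<and> (\<forall>l\<in>{a..b}. \<forall>u. norm u \<le> R \<longrightarrow> u - P l (F (l, u)) \<in> K)"
proof -
  obtain K where K: "compact K" "\<And>l u. l \<in> {a..b} \<Longrightarrow> norm u \<le> 1 \<Longrightarrow> u - P l (L l u) \<in> K"
    and contP: "continuous_on {a..b} P"
    using P unfolding parametrix_def by blast
  \<comment> \<open>The parametrix property concerns the unit ball, so u is rescaled by r; the
    maximum with 1 makes r positive.\<close>
  define r where "r = max R 1"
  have r: "r > 0" "R \<le> r" by (auto simp: r_def)
  define KJ where "KJ = closure (J ` cball 0 r)"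
  have "compact KJ" using J unfolding compact_operator_def KJ_def by simp
  define KN where "KN = (\<lambda>x. P (fst x) (N x)) ` ({a..b} \<times> KJ)"
  have "continuous_on ({a..b} \<times> KJ) (\<lambda>x. P (fst x) (N x))"
    by (intro bounded_bilinear.continuous_on[OF bounded_bilinear_blinfun_apply] continuous_on_compose2[OF contP]
        continuous_on_fst continuous_on_id continuous_on_subset[OF N]) auto
  then have "compact KN" unfolding KN_def using \<open>compact KJ\<close> by (intro compact_continuous_image compact_Times) auto
  define K' where "K' = {x - y |x y. x \<in> (\<lambda>x. r *\<^sub>R x) ` K \<and> y \<in> KN}"
  have "compact K'"
    unfolding K'_def by (intro compact_differences compact_scaling K(1) \<open>compact KN\<close>)
  moreover have "u - P l (F (l, u)) \<in> K'" if l: "l \<in> {a..b}" and u: "norm u \<le> R" for l u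
  proof -
    define v where "v = (1 / r) *\<^sub>R u"
    have uv: "u = r *\<^sub>R v" using r by (simp add: v_def)
    have "norm v \<le> 1" using u r by (simp add: v_def)
    then have "v - P l (L l v) \<in> K" using K(2) l by blast
    moreover have "u - P l (L l u) = r *\<^sub>R (v - P l (L l v))"
      by (simp add: uv blinfun.scaleR_right algebra_simps)
    moreover have "J u \<in> KJ"
      unfolding KJ_def using u r by (intro subsetD[OF closure_subset] imageI) auto
    then have "P l (N (l, J u)) \<in> KN" unfolding KN_def using l by (intro image_eqI[of _ _ "(l, J u)"]) auto
    moreover have "u - P l (F (l, u)) = (u - P l (L l u)) - P l (N (l, J u))"
      by (simp add: F blinfun.add_right)
    ultimately show ?thesis unfolding K'_def by blast
  qed
  ultimately show ?thesis by blast
qed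

text \<open>Applied to s on a compact branch: a low enough slice meets the branch only close to (l0,
  0).\<close>

lemma positive_away_from_zero:
  fixes A :: "'a::metric_space set" and g :: "'a \<Rightarrow> real"
  assumes "compact A" "continuous_on A g" and pos: "\<And>x. x \<in> A \<Longrightarrow> x \<noteq> x0 \<Longrightarrow> g x > 0" and "r > 0"
  shows "\<exists>c>0. \<forall>x\<in>A. g x \<le> c \<longrightarrow> dist x x0 < r"
proof (cases "A - ball x0 r = {}")
  case True
  then show ?thesis by (intro exI[of _ 1]) (auto simp: dist_commute)
next
  case False
  have "compact (A - ball x0 r)" using assms by (simp add: compact_diff)
  then obtain x where x: "x \<in> A - ball x0 r" "\<And>y. y \<in> A - ball x0 r \<Longrightarrow> g x \<le> g y"
    using continuous_attains_inf[OF _ False, of g] continuous_on_subset[OF assms(2)] by (metis Diff_subset)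
  have "g x > 0" using x(1) \<open>r > 0\<close> by (intro pos) auto
  moreover have "dist y x0 < r" if "y \<in> A" "g y \<le> g x / 2" for y
    using x(2)[of y] that \<open>g x > 0\<close> by (force simp: dist_commute)
  ultimately show ?thesis by (intro exI[of _ "g x / 2"]) auto
qed

text \<open>A low slice meets the hypotheses of \<open>no_isolated_branch\<close>. After applying
  P(l) the equation is z + s q(l) + w = 0 with w small compared to u. Its f component s d(l) + f(w)
  has the sign of d on the sides l0 - \<rho> and l0 + \<rho> of the box; its component in ker f
  forces norm z < s, since the part y(l) of q(l) in ker f vanishes at l0. So the boundary of the box
  carries no zeros.\<close>

lemma no_isolated_compact_branch:
  fixes F :: "real \<times> 'u::banach \<Rightarrow> 'v::banach" and J :: "'u \<Rightarrow>\<^sub>L 'v" and f :: "'u \<Rightarrow>\<^sub>L real"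
  assumes J: "compact_operator J" and C1: "C1_map F" and F1: "\<forall>l. F (l, 0) = 0"
    and F2: "\<forall>l u. Du F l u \<in> Phi0"
    and F4: "\<exists>N :: real \<times> 'v \<Rightarrow> 'v. continuous_on UNIV N \<and>
               (\<forall>l u. N (l, blinfun_apply J u) = F (l, u) - blinfun_apply (Du F l 0) u)"
    and iso: "l0 isolated_in Spec (linearization F)"
    and null: "null_space (linearization F l0) = span {\<phi>0}" and n\<phi>: "norm \<phi>0 = 1"
    and f: "blinfun_apply f \<phi>0 = 1"
    and odd: "\<exists>\<rho>0>0. \<forall>\<rho>. 0 < \<rho> \<and> \<rho> < \<rho>0 \<longrightarrow>
          (\<forall>L\<omega>. real_analytic_on L\<omega> {l0 - \<rho>..l0 + \<rho>}
               \<and> A_homotopic (l0 - \<rho>) (l0 + \<rho>) L\<omega> (linearization F)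
             \<longrightarrow> odd (chi_interval L\<omega> (l0 - \<rho>) (l0 + \<rho>)))"
    and A: "compact A" "A \<subseteq> nontrivial_solutions F" "(l0, 0) \<in> A"
    and Apos: "\<And>x. x \<in> A \<Longrightarrow> x \<noteq> (l0, 0) \<Longrightarrow> f (snd x) > 0"
    and clo: "closed ({x \<in> nontrivial_solutions F. f (snd x) \<ge> 0} - A)"
  shows False
proof -
  let ?L = "linearization F" and ?S = "nontrivial_solutions F" and ?x0 = "(l0, 0::'u)"
  obtain N :: "real \<times> 'v \<Rightarrow> 'v" where N: "continuous_on UNIV N" "\<And>l u. N (l, J u) = F (l, u) - ?L l u"
    using F4 unfolding linearization_def by blast
  have contL: "continuous_on UNIV ?L" by (rule continuous_on_linearization[OF C1])
  have contF: "continuous_on UNIV F" by (rule C1_map_Du(3)[OF C1])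
  have LPhi: "?L l \<in> Phi0" for l using F2 by (simp add: linearization_def)
  have L\<phi>: "?L l0 \<phi>0 = 0" using null span_base[of \<phi>0 "{\<phi>0}"] by (auto simp: null_space_def)
  have "\<exists>B \<rho>1. continuous_on UNIV B \<and> \<rho>1 > 0 \<and> (\<forall>l. \<bar>l - l0\<bar> \<le> \<rho>1 \<longrightarrow> B l \<in> GL) \<and>
    (\<forall>l u. blinfun_apply (?L l) u = B l (u - f u *\<^sub>R \<phi>0) + f u *\<^sub>R ?L l \<phi>0) \<and>
    (\<forall>\<rho>. 0 < \<rho> \<and> \<rho> \<le> \<rho>1 \<longrightarrow>
      f (blinfun_inverse (B (l0 - \<rho>)) (?L (l0 - \<rho>) \<phi>0)) *
      f (blinfun_inverse (B (l0 + \<rho>)) (?L (l0 + \<rho>) \<phi>0)) < 0)"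
  proof (rule odd_multiplicity_sign_change[OF C1 F2 iso null f odd])
    fix B \<rho>1
    assume "continuous_on UNIV B" "\<rho>1 > 0" "\<And>l. \<bar>l - l0\<bar> \<le> \<rho>1 \<Longrightarrow> B l \<in> GL"
      "\<And>l u. blinfun_apply (?L l) u = B l (u - f u *\<^sub>R \<phi>0) + f u *\<^sub>R ?L l \<phi>0"
      "\<And>\<rho>. 0 < \<rho> \<Longrightarrow> \<rho> \<le> \<rho>1 \<Longrightarrow>
        f (blinfun_inverse (B (l0 - \<rho>)) (?L (l0 - \<rho>) \<phi>0)) *
        f (blinfun_inverse (B (l0 + \<rho>)) (?L (l0 + \<rho>) \<phi>0)) < 0"
    note * = this
    show ?thesis
      by (rule exI[of _ B], rule exI[of _ \<rho>1], intro conjI allI impI) (auto intro: *)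
  qed
  then obtain B \<rho>1 where contB: "continuous_on UNIV B" and \<rho>1: "\<rho>1 > 0"
    and BGL: "\<forall>l. \<bar>l - l0\<bar> \<le> \<rho>1 \<longrightarrow> B l \<in> GL"
    and LB: "\<forall>l u. blinfun_apply (?L l) u = B l (u - f u *\<^sub>R \<phi>0) + f u *\<^sub>R ?L l \<phi>0"
    and change: "\<forall>\<rho>. 0 < \<rho> \<and> \<rho> \<le> \<rho>1 \<longrightarrow>
      f (blinfun_inverse (B (l0 - \<rho>)) (?L (l0 - \<rho>) \<phi>0)) *
      f (blinfun_inverse (B (l0 + \<rho>)) (?L (l0 + \<rho>) \<phi>0)) < 0"
    by (elim exE conjE)
  obtain R0 where R0: "\<And>x. x \<in> A \<Longrightarrow> dist ?x0 x \<le> R0"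
    using compact_imp_bounded[OF A(1)] unfolding bounded_any_center[of A ?x0] by blast
  \<comment> \<open>The interval reaches past all parameters occurring in A and contains the one on
    which B is known to be invertible.\<close>
  define Ra where "Ra = max R0 \<rho>1 + 1"
  define a b where "a = l0 - Ra" and "b = l0 + Ra"
  have RaA: "\<bar>fst x - l0\<bar> < Ra" if "x \<in> A" for x
    using R0[OF that] dist_fst_le[of ?x0 x] by (simp add: Ra_def dist_real_def abs_minus_commute)
  have Ra: "Ra > \<rho>1" by (simp add: Ra_def)
  have "parametrix ?L (l0 - \<rho>1) (l0 + \<rho>1) (\<lambda>l. blinfun_inverse (B l))"
  proof (rule parametrix_of_reduction[OF _ _ _ LB[rule_format]])
    show "continuous_on {l0 - \<rho>1..l0 + \<rho>1} ?L" by (rule continuous_on_subset[OF contL]) simp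
    show "continuous_on {l0 - \<rho>1..l0 + \<rho>1} B" by (rule continuous_on_subset[OF contB]) simp
  qed (use BGL in auto)
  from parametrix_extension[OF contL LPhi this, of a b] obtain P where P: "parametrix ?L a b P"
    and PB: "\<And>l. l \<in> {l0 - \<rho>1..l0 + \<rho>1} \<Longrightarrow> P l = blinfun_inverse (B l)"
    using Ra \<rho>1 by (auto simp: a_def b_def)
  have contP: "continuous_on {a..b} P" and PGL: "\<And>l. l \<in> {a..b} \<Longrightarrow> P l \<in> GL"
    using P by (auto simp: parametrix_def)
  define q where "q l = P l (?L l \<phi>0)" for l
  define d where "d l = f (q l)" for l
  define y where "y l = q l - d l *\<^sub>R \<phi>0" for l
  have PL: "P l (?L l u) = u - f u *\<^sub>R \<phi>0 + f u *\<^sub>R q l" if "\<bar>l - l0\<bar> \<le> \<rho>1" for l u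
  proof -
    have l: "l \<in> {l0 - \<rho>1..l0 + \<rho>1}" using that by auto
    have "P l (?L l u) = P l (B l (u - f u *\<^sub>R \<phi>0)) + f u *\<^sub>R q l"
      using LB[rule_format, of l u] by (simp add: q_def blinfun.add_right blinfun.scaleR_right)
    then show ?thesis using BGL that PB[OF l] by simp
  qed
  have sub: "{l0 - \<rho>1..l0 + \<rho>1} \<subseteq> {a..b}" using Ra by (auto simp: a_def b_def)
  have contq: "continuous_on {l0 - \<rho>1..l0 + \<rho>1} q"
    unfolding q_def
    by (intro bounded_bilinear.continuous_on[OF bounded_bilinear_blinfun_apply] continuous_on_const
        continuous_on_subset[OF contP sub] continuous_on_subset[OF contL]) auto
  have conty: "continuous_on {l0 - \<rho>1..l0 + \<rho>1} y"
    unfolding y_def d_def by (intro continuous_intros contq)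
  have y0: "y l0 = 0" by (simp add: y_def d_def q_def L\<phi>)
  have fy: "f (y l) = 0" for l by (simp add: y_def d_def blinfun.diff_right blinfun.scaleR_right f)
  obtain r1 where r1: "r1 > 0" "\<And>l. l \<in> {l0 - \<rho>1..l0 + \<rho>1} \<Longrightarrow> dist l l0 < r1 \<Longrightarrow> norm (y l) < 1/2"
  proof -
    have "l0 \<in> {l0 - \<rho>1..l0 + \<rho>1}" "(1/2::real) > 0" using \<rho>1 by auto
    with conty obtain r1 where "r1 > 0" "\<forall>l\<in>{l0 - \<rho>1..l0 + \<rho>1}. dist l l0 < r1 \<longrightarrow> dist (y l) (y l0) < 1/2"
      unfolding continuous_on_iff by blast
    then show ?thesis using y0 by (intro that[of r1]) auto
  qed
  \<comment> \<open>The solutions with s \<ge> 0 outside A form a closed set missing (l0, 0), so all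
    solutions with s \<ge> 0 within some distance r2 belong to A.\<close>
  have "open (- ({x \<in> ?S. f (snd x) \<ge> 0} - A))" "?x0 \<in> - ({x \<in> ?S. f (snd x) \<ge> 0} - A)"
    using clo A(3) unfolding closed_def by simp_all
  then obtain r2 where r2: "r2 > 0" "\<And>x. dist x ?x0 < r2 \<Longrightarrow> x \<in> - ({x \<in> ?S. f (snd x) \<ge> 0} - A)"
    unfolding open_dist by blast
  \<comment> \<open>\<rho> < r1 gives norm (y l) \<le> 1/2; \<rho> < r2/2, together with 2 \<sigma>
    < r2/2 below, puts the box into the ball of radius r2.\<close>
  define \<rho> where "\<rho> = min \<rho>1 (min (r1 / 2) (r2 / 4))"
  have \<rho>: "\<rho> > 0" "\<rho> \<le> \<rho>1" "\<rho> < r1" "\<rho> < r2 / 2" using \<rho>1 r1(1) r2(1) by (auto simp: \<rho>_def)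
  have yle: "norm (y l) \<le> 1/2" if "\<bar>l - l0\<bar> \<le> \<rho>" for l
    using that \<rho> by (intro less_imp_le r1(2)) (auto simp: dist_real_def)
  have dd: "d (l0 - \<rho>) * d (l0 + \<rho>) < 0"
    using change \<rho>(1,2) PB[of "l0 - \<rho>"] PB[of "l0 + \<rho>"] \<rho>1 by (simp add: d_def q_def)
  define m where "m = min \<bar>d (l0 - \<rho>)\<bar> \<bar>d (l0 + \<rho>)\<bar>"
  have m: "m > 0" using dd by (auto simp: m_def)
  \<comment> \<open>\<mu> \<le> m lets d dominate the remainder at l0 - \<rho> and l0 + \<rho>;
    \<mu> \<le> 1/4 serves the estimate of z.\<close>
  define \<mu> where "\<mu> = min m (1/4)"
  have \<mu>: "\<mu> > 0" "\<mu> \<le> m" "\<mu> \<le> 1/4" using m by (auto simp: \<mu>_def)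
  have "bounded (P ` {a..b})" by (intro compact_imp_bounded compact_continuous_image contP) auto
  then obtain Mp where Mp: "Mp > 0" "\<And>l. l \<in> {a..b} \<Longrightarrow> norm (P l) \<le> Mp"
    unfolding bounded_pos by auto
  define c1 where "c1 = 1 + norm f"
  have c1: "c1 \<ge> 1" by (simp add: c1_def)
  have proj: "norm (w - f w *\<^sub>R \<phi>0) \<le> c1 * norm w" "\<bar>f w\<bar> \<le> c1 * norm w" for w
  proof -
    have fw: "\<bar>f w\<bar> \<le> norm f * norm w" using norm_blinfun[of f w] by simp
    have "norm (w - f w *\<^sub>R \<phi>0) \<le> norm w + \<bar>f w\<bar>" using norm_triangle_ineq4[of w "f w *\<^sub>R \<phi>0"] n\<phi> by simp
    then show "norm (w - f w *\<^sub>R \<phi>0) \<le> c1 * norm w" "\<bar>f w\<bar> \<le> c1 * norm w"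
      using fw by (auto simp: c1_def algebra_simps intro: order_trans)
  qed
  \<comment> \<open>Makes the remainder w, even after multiplication by c1, at most \<mu>/8 times
    norm u; c1 bounds both f and the projection onto ker f.\<close>
  define \<kappa> where "\<kappa> = \<mu> / (8 * c1 * Mp)"
  have \<kappa>: "\<kappa> > 0" using \<mu>(1) c1 Mp(1) by (simp add: \<kappa>_def)
  obtain r where r: "r > 0" "\<forall>l\<in>{l0 - \<rho>1..l0 + \<rho>1}. \<forall>u. norm u < r \<longrightarrow> norm (F (l, u) - ?L l u) \<le> \<kappa> * norm u"
    using linearization_remainder_uniform[OF C1 F1 \<kappa> compact_Icc[of "l0 - \<rho>1" "l0 + \<rho>1"]] by blast
  define w where "w l u = P l (F (l, u) - ?L l u)" for l u
  have w: "c1 * norm (w l u) \<le> \<mu> / 8 * norm u" if "\<bar>l - l0\<bar> \<le> \<rho>" "norm u < r" for l u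
  proof -
    have l: "l \<in> {l0 - \<rho>1..l0 + \<rho>1}" using that \<rho>(2) by auto
    have "norm (w l u) \<le> norm (P l) * norm (F (l, u) - ?L l u)" unfolding w_def by (rule norm_blinfun)
    also have "\<dots> \<le> Mp * (\<kappa> * norm u)"
      using r(2) l that(2) Mp(2) sub Mp(1) by (intro mult_mono) auto
    finally have "c1 * norm (w l u) \<le> c1 * (Mp * (\<kappa> * norm u))" using c1 by (intro mult_left_mono) auto
    also have "\<dots> = \<mu> / 8 * norm u" using c1 Mp(1) by (simp add: \<kappa>_def)
    finally show ?thesis .
  qed
  have PF: "P l (F (l, u)) = u - f u *\<^sub>R \<phi>0 + f u *\<^sub>R q l + w l u" if "\<bar>l - l0\<bar> \<le> \<rho>" for l u
    using PL[of l u] that \<rho>(2) by (simp add: w_def blinfun.diff_right)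
  \<comment> \<open>One estimate for all homotopy times t, where t = 1 covers true solutions: norm z
    \<le> \<sigma>/2 + (norm z + \<sigma>)/32.\<close>
  have zsmall: "norm z < \<sigma>"
    if z: "z + t *\<^sub>R (\<sigma> *\<^sub>R y l + (w l u - f (w l u) *\<^sub>R \<phi>0)) = 0" and t: "t \<in> {0..1}" and u: "u = z + \<sigma> *\<^sub>R \<phi>0"
      and l: "\<bar>l - l0\<bar> \<le> \<rho>" and ur: "norm u < r" and \<sigma>: "\<sigma> > 0" for z t \<sigma> l u
  proof -
    have nu: "norm u \<le> norm z + \<sigma>" using norm_triangle_ineq[of z "\<sigma> *\<^sub>R \<phi>0"] n\<phi> \<sigma> by (simp add: u)
    let ?v = "\<sigma> *\<^sub>R y l + (w l u - f (w l u) *\<^sub>R \<phi>0)"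
    have "z = - (t *\<^sub>R ?v)" using z by (simp add: eq_neg_iff_add_eq_0)
    then have "norm z = t * norm ?v" using t by simp
    also have "\<dots> \<le> 1 * norm ?v" using t by (intro mult_right_mono) auto
    also have "\<dots> \<le> norm (\<sigma> *\<^sub>R y l) + norm (w l u - f (w l u) *\<^sub>R \<phi>0)" unfolding mult_1 by (rule norm_triangle_ineq)
    also have "\<dots> \<le> \<sigma> * (1/2) + \<mu> / 8 * norm u"
    proof (rule add_mono)
      show "norm (\<sigma> *\<^sub>R y l) \<le> \<sigma> * (1/2)" using mult_left_mono[OF yle[OF l], of \<sigma>] \<sigma> by simp
      show "norm (w l u - f (w l u) *\<^sub>R \<phi>0) \<le> \<mu> / 8 * norm u"
        using proj(1)[of "w l u"] w[OF l ur] by (rule order_trans)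
    qed
    finally have "norm z \<le> \<sigma> * (1/2) + \<mu> / 8 * norm u" .
    moreover have "\<mu> / 8 * norm u \<le> 1 / 32 * (norm z + \<sigma>)"
      using \<mu> nu by (intro mult_mono) auto
    ultimately have "norm z \<le> \<sigma> * (1/2) + 1 / 32 * (norm z + \<sigma>)"
      by (meson add_left_mono order_trans)
    then show ?thesis using \<sigma> by (simp add: field_simps)
  qed
  have cA: "continuous_on A (\<lambda>x. f (snd x))" by (intro continuous_intros)
  have "\<exists>c>0. \<forall>x\<in>A. f (snd x) \<le> c \<longrightarrow> dist x ?x0 < min \<rho> r"
  proof (rule positive_away_from_zero[OF A(1) cA])
    show "f (snd x) > 0" if "x \<in> A" "x \<noteq> ?x0" for x using that by (rule Apos)
    show "min \<rho> r > 0" using \<rho>(1) r(1) by simp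
  qed
  then obtain \<sigma>1 where s1: "\<sigma>1 > 0" and s2: "\<forall>x\<in>A. f (snd x) \<le> \<sigma>1 \<longrightarrow> dist x ?x0 < min \<rho> r"
    by (elim exE conjE)
  note \<sigma>1 = s1 s2[rule_format]
  define \<sigma> where "\<sigma> = min \<sigma>1 (min (r / 4) (r2 / 8))"
  have \<sigma>: "\<sigma> > 0" "\<sigma> \<le> \<sigma>1" "2 * \<sigma> < r" "2 * \<sigma> < r2 / 2" using \<sigma>1(1) r(1) r2(1) by (auto simp: \<sigma>_def)
  define k where "k x = snd x - P (fst x) (F x)" for x
  define Z1 where "Z1 = {(l, u). l \<in> {a..b} \<and> f u \<ge> \<sigma> \<and> k (l, u) = u}"
  have Z1_iff: "(l, u) \<in> Z1 \<longleftrightarrow> l \<in> {a..b} \<and> f u \<ge> \<sigma> \<and> (l, u) \<in> ?S" for l u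
  proof -
    have "u \<noteq> 0" if "f u \<ge> \<sigma>" using that \<sigma>(1) by auto
    then show ?thesis
      using PGL[of l] by (auto simp: Z1_def k_def GL_eq_0_iff mem_nontrivial_solutions_iff[OF F1])
  qed
  define A' where "A' = A \<inter> {x. f (snd x) \<ge> \<sigma>}"
  have "closed {x::real \<times> 'u. f (snd x) \<ge> \<sigma>}" by (intro closed_Collect_le continuous_intros)
  then have "compact A'" unfolding A'_def using A(1) by (simp add: compact_Int_closed)
  show False
  \<comment> \<open>Thanks to the sign change, the slope d(l0 + \<rho>) gives the model the sign of
    d at both l0 - \<rho> and l0 + \<rho>.\<close>
  proof (rule no_isolated_branch[of a b k f \<phi>0 \<sigma> \<rho> "d (l0 + \<rho>)" l0 Z1 A'])
    show "continuous_on ({a..b} \<times> UNIV) k"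
      unfolding k_def
      by (intro continuous_on_diff continuous_on_snd continuous_on_id bounded_bilinear.continuous_on[OF bounded_bilinear_blinfun_apply]
          continuous_on_compose2[OF contP] continuous_on_fst continuous_on_subset[OF contF]) auto
    show "\<exists>K. compact K \<and> (\<forall>l\<in>{a..b}. \<forall>u. norm u \<le> R \<longrightarrow> k (l, u) \<in> K)" for R
      using parametrix_compact_perturbation[OF P J N(1), of F R] N(2) by (simp add: k_def)
    show "d (l0 + \<rho>) \<noteq> 0" using dd by auto
    show "a \<le> l0 - \<rho>" "l0 + \<rho> \<le> b" using Ra \<rho>(2) by (auto simp: a_def b_def)
    show "Z1 = {(l, u). l \<in> {a..b} \<and> f u \<ge> \<sigma> \<and> k (l, u) = u}" by (rule Z1_def)
    show "compact A'" by fact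
    show A'Z: "A' \<subseteq> Z1"
    proof
      fix x assume "x \<in> A'"
      then have "x \<in> A" "f (snd x) \<ge> \<sigma>" "x \<in> ?S" using A(2) by (auto simp: A'_def)
      then show "x \<in> Z1" using RaA[of x] Z1_iff[of "fst x" "snd x"] by (auto simp: a_def b_def)
    qed
    show "A' \<subseteq> {a<..<b} \<times> UNIV"
    proof
      fix x assume "x \<in> A'"
      then have "x \<in> A" by (simp add: A'_def)
      then show "x \<in> {a<..<b} \<times> UNIV" using RaA[of x] by (auto simp: a_def b_def mem_Times_iff)
    qed
    have "Z1 - A' = ({x \<in> ?S. f (snd x) \<ge> 0} - A) \<inter> {x. f (snd x) \<ge> \<sigma>} \<inter> ({a..b} \<times> UNIV)"
      using Z1_iff \<sigma>(1) by (auto simp: A'_def)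
    then show "closed (Z1 - A')"
      using clo \<open>closed {x::real \<times> 'u. f (snd x) \<ge> \<sigma>}\<close> by (simp add: closed_Int closed_Times)
    show "(l, u) \<in> A' \<longleftrightarrow> \<bar>l - l0\<bar> < \<rho> \<and> norm (u - \<sigma> *\<^sub>R \<phi>0) < \<sigma>" if lu: "(l, u) \<in> Z1" and fu: "f u = \<sigma>" for l u
    proof
      assume "(l, u) \<in> A'"
      then have "dist (l, u) ?x0 < min \<rho> r" using \<sigma>1(2)[of "(l, u)"] fu \<sigma>(2) by (auto simp: A'_def)
      then have l: "\<bar>l - l0\<bar> < \<rho>" and u: "norm u < r"
        using dist_fst_le[of "(l, u)" ?x0] dist_snd_le[of "(l, u)" ?x0] by (auto simp: dist_real_def)
      have "F (l, u) = 0" using lu Z1_iff mem_nontrivial_solutions_iff[OF F1] by blast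
      then have X: "(u - \<sigma> *\<^sub>R \<phi>0) + \<sigma> *\<^sub>R q l + w l u = 0" using PF[of l u] l fu by simp
      then have "f ((u - \<sigma> *\<^sub>R \<phi>0) + \<sigma> *\<^sub>R q l + w l u) = 0" by simp
      then have "\<sigma> * d l + f (w l u) = 0" by (simp add: blinfun.add_right blinfun.diff_right blinfun.scaleR_right f fu d_def)
      then have fw: "f (w l u) = - (\<sigma> * d l)" by simp
      have "norm (u - \<sigma> *\<^sub>R \<phi>0) < \<sigma>"
        by (rule zsmall[where t = 1 and l = l and u = u])
          (use X l u \<sigma>(1) in \<open>auto simp: fw y_def algebra_simps\<close>)
      then show "\<bar>l - l0\<bar> < \<rho> \<and> norm (u - \<sigma> *\<^sub>R \<phi>0) < \<sigma>" using l by simp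
    next
      assume near: "\<bar>l - l0\<bar> < \<rho> \<and> norm (u - \<sigma> *\<^sub>R \<phi>0) < \<sigma>"
      have "norm u \<le> norm (u - \<sigma> *\<^sub>R \<phi>0) + \<sigma>"
        using norm_triangle_ineq[of "u - \<sigma> *\<^sub>R \<phi>0" "\<sigma> *\<^sub>R \<phi>0"] n\<phi> \<sigma>(1) by simp
      moreover have "dist (l, u) ?x0 \<le> \<bar>l - l0\<bar> + norm u"
        unfolding dist_Pair_Pair using sqrt_sum_squares_le_sum[of "dist l l0" "dist u 0"] by (simp add: dist_real_def)
      ultimately have "dist (l, u) ?x0 < r2" using near \<rho>(4) \<sigma>(4) by linarith
      from r2(2)[OF this] show "(l, u) \<in> A'"
        using lu Z1_iff fu \<sigma>(1) by (auto simp: A'_def)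
    qed
    show "t *\<^sub>R (u - k (l, u)) + (1 - t) *\<^sub>R (u - \<sigma> *\<^sub>R \<phi>0 + (\<sigma> * d (l0 + \<rho>) * (l - l0)) *\<^sub>R \<phi>0) \<noteq> 0"
      if t: "t \<in> {0..1}" and fu: "f u = \<sigma>" and l: "\<bar>l - l0\<bar> \<le> \<rho>" and zu: "norm (u - \<sigma> *\<^sub>R \<phi>0) \<le> \<sigma>"
        and bd: "\<bar>l - l0\<bar> = \<rho> \<or> norm (u - \<sigma> *\<^sub>R \<phi>0) = \<sigma>" for t l u
    proof
      define z where "z = u - \<sigma> *\<^sub>R \<phi>0"
      define c where "c = \<sigma> * d (l0 + \<rho>) * (l - l0)"
      define p where "p = \<sigma> * d l + f (w l u)"
      have fz: "f z = 0" by (simp add: z_def blinfun.diff_right blinfun.scaleR_right f fu)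
      have "norm u \<le> norm z + \<sigma>"
        using norm_triangle_ineq[of z "\<sigma> *\<^sub>R \<phi>0"] n\<phi> \<sigma>(1) by (simp add: z_def)
      then have nu: "norm u \<le> 2 * \<sigma>" using zu by (simp add: z_def)
      then have ur: "norm u < r" using \<sigma>(3) by simp
      assume "t *\<^sub>R (u - k (l, u)) + (1 - t) *\<^sub>R (u - \<sigma> *\<^sub>R \<phi>0 + (\<sigma> * d (l0 + \<rho>) * (l - l0)) *\<^sub>R \<phi>0) = 0"
      moreover have "u - k (l, u) = z + \<sigma> *\<^sub>R q l + w l u"
        using PF[OF l, of u] by (simp add: k_def fu z_def)
      ultimately have X: "t *\<^sub>R (z + \<sigma> *\<^sub>R q l + w l u) + (1 - t) *\<^sub>R (z + c *\<^sub>R \<phi>0) = 0"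
        by (simp add: z_def c_def)
      then have "f (t *\<^sub>R (z + \<sigma> *\<^sub>R q l + w l u) + (1 - t) *\<^sub>R (z + c *\<^sub>R \<phi>0)) = 0" by simp
      then have fX: "t * p + (1 - t) * c = 0"
        by (simp add: blinfun.add_right blinfun.scaleR_right fz f p_def d_def)
      \<comment> \<open>Subtracting the f component, which vanishes, leaves the component in ker f,
        to which \<open>zsmall\<close> applies.\<close>
      have "z + t *\<^sub>R (\<sigma> *\<^sub>R y l + (w l u - f (w l u) *\<^sub>R \<phi>0)) =
        (t *\<^sub>R (z + \<sigma> *\<^sub>R q l + w l u) + (1 - t) *\<^sub>R (z + c *\<^sub>R \<phi>0)) - (t * p + (1 - t) * c) *\<^sub>R \<phi>0"
        by (simp add: y_def p_def algebra_simps)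
      also have "\<dots> = 0" by (simp add: X fX)
      finally have "norm z < \<sigma>"
        by (rule zsmall[OF _ t _ l ur \<sigma>(1)]) (simp add: z_def)
      then have lr: "\<bar>l - l0\<bar> = \<rho>" using bd by (simp add: z_def)
      have "\<bar>f (w l u)\<bar> \<le> \<mu> / 8 * norm u" using proj(2)[of "w l u"] w[OF l ur] by linarith
      also have "\<dots> \<le> \<mu> / 8 * (2 * \<sigma>)" using nu \<mu>(1) by (intro mult_left_mono) auto
      also have "\<dots> < \<sigma> * m"
      proof -
        have "\<mu> * \<sigma> \<le> m * \<sigma>" using \<mu>(2) \<sigma>(1) by (intro mult_right_mono) auto
        moreover have "\<mu> * \<sigma> > 0" using \<mu>(1) \<sigma>(1) by simp
        ultimately show ?thesis by (simp add: mult.commute)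
      qed
      finally have fw: "\<bar>f (w l u)\<bar> < \<sigma> * m" .
      \<comment> \<open>The two scalars combined by the homotopy have the same sign, so no convex
        combination of them vanishes.\<close>
      have "p * c > 0"
      proof -
        have dl: "\<bar>d l\<bar> \<ge> m" using lr by (auto simp: m_def abs_if split: if_splits)
        have pc: "p * d l > 0"
        proof -
          have "\<sigma> * m \<le> \<sigma> * \<bar>d l\<bar>" using dl \<sigma>(1) by (intro mult_left_mono) auto
          then have "\<bar>f (w l u)\<bar> < \<sigma> * \<bar>d l\<bar>" using fw by linarith
          moreover have "d l \<noteq> 0" using dl m by auto
          ultimately show ?thesis by (cases "d l > 0") (auto simp: p_def abs_if zero_less_mult_iff split: if_splits)
        qed
        have "c * d l > 0"
        proof -
          consider "l = l0 + \<rho>" | "l = l0 - \<rho>" using lr by linarith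
          then show ?thesis
          proof cases
            case 1
            then have eq: "c * d l = \<sigma> * \<rho> * (d l * d l)" by (simp add: c_def)
            have "d l \<noteq> 0" using dl m by auto
            then have "d l * d l > 0" by (auto simp: zero_less_mult_iff linorder_neq_iff)
            then show ?thesis unfolding eq by (rule mult_pos_pos[OF mult_pos_pos[OF \<sigma>(1) \<rho>(1)]])
          next
            case 2
            then have eq: "c * d l = \<sigma> * \<rho> * (- (d (l0 - \<rho>) * d (l0 + \<rho>)))" by (simp add: c_def)
            have "- (d (l0 - \<rho>) * d (l0 + \<rho>)) > 0" using dd by linarith
            then show ?thesis unfolding eq by (rule mult_pos_pos[OF mult_pos_pos[OF \<sigma>(1) \<rho>(1)]])
          qed
        qed
        then show ?thesis using pc by (auto simp: zero_less_mult_iff)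
      qed
      then have "(p > 0 \<and> c > 0) \<or> (p < 0 \<and> c < 0)" by (auto simp: zero_less_mult_iff)
      moreover have "t * p + (1 - t) * c > 0" if "p > 0" "c > 0" for p c :: real
        using that t by (cases "t = 0") (auto intro: add_pos_nonneg)
      ultimately show False using fX by (smt (verit) mult_minus_right)
    qed
  qed (use f n\<phi> \<sigma>(1) \<rho>(1) in auto)
qed

section \<open>Unilateral branches\<close>

text \<open>The continuum is found in E, the solutions with s > 0 together with (l0, 0); a component
  D of the punctured E is non-compact with (l0, 0) added. The unilateral component D2 is taken among
  all solutions and may be larger, but then s vanishes somewhere on it, which gives (ii) or (iii).
  Otherwise D2 = D.\<close>

lemma unilateral_branch:
  fixes F :: "real \<times> 'u::banach \<Rightarrow> 'v::banach" and J :: "'u \<Rightarrow>\<^sub>L 'v" and f :: "'u \<Rightarrow>\<^sub>L real"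
  assumes J: "compact_operator J" and C1: "C1_map F" and F1: "\<forall>l. F (l, 0) = 0"
    and F2: "\<forall>l u. Du F l u \<in> Phi0" and F3: "proper_on_closed_bounded F"
    and F4: "\<exists>N :: real \<times> 'v \<Rightarrow> 'v. continuous_on UNIV N \<and>
               (\<forall>l u. N (l, blinfun_apply J u) = F (l, u) - blinfun_apply (Du F l 0) u)"
    and iso: "l0 isolated_in Spec (linearization F)"
    and null: "null_space (linearization F l0) = span {\<phi>0}" and n\<phi>: "norm \<phi>0 = 1"
    and f: "blinfun_apply f \<phi>0 = 1"
    and odd: "\<exists>\<rho>0>0. \<forall>\<rho>. 0 < \<rho> \<and> \<rho> < \<rho>0 \<longrightarrow>
          (\<forall>L\<omega>. real_analytic_on L\<omega> {l0 - \<rho>..l0 + \<rho>}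
               \<and> A_homotopic (l0 - \<rho>) (l0 + \<rho>) L\<omega> (linearization F)
             \<longrightarrow> odd (chi_interval L\<omega> (l0 - \<rho>) (l0 + \<rho>)))"
    and \<delta>: "\<delta> > 0"
    and cone: "\<And>l u. (l, u) \<in> nontrivial_solutions F \<Longrightarrow> (l, u) \<in> cball (l0, 0) \<delta> \<Longrightarrow> (l, u) \<noteq> (l0, 0) \<Longrightarrow>
      f u > 0 \<Longrightarrow> (l, u) \<in> Q"
    and cone0: "\<And>l u. (l, u) \<in> nontrivial_solutions F \<Longrightarrow> (l, u) \<in> cball (l0, 0) \<delta> \<Longrightarrow> (l, u) \<noteq> (l0, 0) \<Longrightarrow> f u \<noteq> 0"
  shows "\<exists>K C. local_branch (nontrivial_solutions F) (l0, 0) \<delta> Q K \<and>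
    unilateral_component (nontrivial_solutions F) (l0, 0) K C \<and>
    (\<not> compact C \<or> (\<exists>l1. l1 \<noteq> l0 \<and> (l1, 0) \<in> C) \<or> (\<exists>l z. f z = 0 \<and> z \<noteq> 0 \<and> (l, z) \<in> C))"
proof -
  let ?S = "nontrivial_solutions F" and ?x0 = "(l0, 0::'u)"
  define s where "s x = f (snd x)" for x :: "real \<times> 'u"
  have cs: "continuous_on UNIV s" unfolding s_def by (intro continuous_intros)
  have cloS: "closed ?S" by (rule closed_nontrivial_solutions[OF C1 F1])
  have x0S: "?x0 \<in> ?S"
    using iso F1 by (auto simp: mem_nontrivial_solutions_iff isolated_in_def)
  have sne: "s x \<noteq> 0" if "x \<in> ?S" "dist ?x0 x \<le> \<delta>" "x \<noteq> ?x0" for x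
    using cone0[of "fst x" "snd x"] that by (simp add: s_def)
  define Sp where "Sp = ?S \<inter> {x. s x \<ge> 0}"
  have cloSp: "closed Sp" unfolding Sp_def by (intro closed_Int cloS closed_Collect_le continuous_on_const cs)
  define E where "E = ?S \<inter> ({x. s x > 0} \<union> {?x0})"
  have s0: "s ?x0 = 0" by (simp add: s_def)
  \<comment> \<open>Near (l0, 0), but off that point, s \<ge> 0 already implies s > 0 by
    \<open>cone0\<close>. So E is relatively open in the closed set \<open>Sp\<close>, whose
    intersections with closed balls are compact; this yields local compactness of E.\<close>
  have EE: "E = Sp \<inter> ({x. s x > 0} \<union> ball ?x0 \<delta>)"
  proof
    show "E \<subseteq> Sp \<inter> ({x. s x > 0} \<union> ball ?x0 \<delta>)" using s0 \<delta> by (auto simp: E_def Sp_def)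
    show "Sp \<inter> ({x. s x > 0} \<union> ball ?x0 \<delta>) \<subseteq> E"
    proof
      fix x assume x: "x \<in> Sp \<inter> ({x. s x > 0} \<union> ball ?x0 \<delta>)"
      then have "x \<in> ?S" "s x \<ge> 0" "s x > 0 \<or> dist ?x0 x < \<delta>" by (auto simp: Sp_def)
      then show "x \<in> E" using sne[of x] by (cases "x = ?x0") (auto simp: E_def)
    qed
  qed
  have opn: "open ({x. s x > 0} \<union> ball ?x0 \<delta>)"
    by (intro open_Un open_ball open_Collect_less continuous_on_const cs)
  have EinSp: "openin (top_of_set Sp) E" unfolding EE using opn by blast
  have compSp: "compact (Sp \<inter> cball x R)" for x R
  proof -
    have "Sp \<inter> cball x R = Sp \<inter> (?S \<inter> cball x R)" by (auto simp: Sp_def)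
    then show ?thesis
      using compact_nontrivial_solutions_Int_cball[OF C1 F1 F3, of x R] cloSp by (simp add: closed_Int_compact)
  qed
  have lc: "locally_compact_space (top_of_set E)"
  proof -
    have "\<exists>U K. openin (top_of_set E) U \<and> compactin (top_of_set E) K \<and> x \<in> U \<and> U \<subseteq> K" if x: "x \<in> E" for x
    proof -
      have "x \<in> {x. s x > 0} \<union> ball ?x0 \<delta>" using x EE by blast
      then obtain r where r: "r > 0" "cball x r \<subseteq> {x. s x > 0} \<union> ball ?x0 \<delta>"
        using opn open_contains_cball by blast
      have "openin (top_of_set E) (E \<inter> ball x r)" by blast
      moreover have "E \<inter> cball x r = Sp \<inter> cball x r" using r(2) EE by blast
      then have "compact (E \<inter> cball x r)" using compSp by simp
      then have "compactin (top_of_set E) (E \<inter> cball x r)" unfolding compactin_subtopology by auto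
      moreover have "E \<inter> ball x r \<subseteq> E \<inter> cball x r" by auto
      ultimately show ?thesis using x r(1) by (metis IntI centre_in_ball)
    qed
    then show ?thesis unfolding locally_compact_space_def by simp
  qed
  have x0E: "?x0 \<in> E" using x0S by (simp add: E_def)
  obtain D where D: "D \<in> components (E - {?x0})" "?x0 \<in> closure D" "\<not> compact (insert ?x0 D)"
  proof (rule noncompact_component_of_punctured_space[OF lc x0E])
    fix A assume A: "compact A" "A \<subseteq> E" "?x0 \<in> A" "openin (top_of_set E) A"
    have "openin (top_of_set Sp) A" using A(4) EinSp openin_trans by blast
    then have "closedin (top_of_set Sp) (Sp - A)" by (simp add: closedin_diff)
    then have "closed (Sp - A)" using cloSp closedin_closed_trans by blast
    moreover have "Sp - A = {x \<in> ?S. f (snd x) \<ge> 0} - A" by (auto simp: Sp_def s_def)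
    ultimately have clo: "closed ({x \<in> ?S. f (snd x) \<ge> 0} - A)" by simp
    show False
    proof (rule no_isolated_compact_branch[OF J C1 F1 F2 F4 iso null n\<phi> f odd A(1) _ A(3) _ clo])
      show "A \<subseteq> ?S" using A(2) by (auto simp: E_def)
      show "f (snd x) > 0" if "x \<in> A" "x \<noteq> ?x0" for x
      proof -
        have "x \<in> E" using that(1) A(2) by blast
        then show ?thesis using that(2) by (simp add: E_def s_def)
      qed
    qed
  qed
  have DE: "D \<subseteq> E - {?x0}" "connected D" "D \<noteq> {}"
    using D(1) in_components_subset in_components_connected in_components_nonempty by blast+
  have Dpos: "s x > 0" "x \<in> ?S" if "x \<in> D" for x using that DE(1) by (auto simp: E_def)
  define C1' where "C1' = insert ?x0 D"
  have C1': "connected C1'" "C1' \<subseteq> E" "C1' \<subseteq> ?S" "C1' \<subseteq> Sp"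
  proof -
    show "connected C1'"
      unfolding C1'_def by (rule connected_intermediate_closure[OF DE(2)]) (use D(2) closure_subset in auto)
    show "C1' \<subseteq> E" using DE(1) x0E by (auto simp: C1'_def)
    then show "C1' \<subseteq> ?S" "C1' \<subseteq> Sp" using EE by (auto simp: E_def)
  qed
  have cloC1': "closedin (top_of_set E) C1'"
  proof -
    have "closedin (top_of_set (E - {?x0})) D" using D(1) by (rule closedin_component)
    then obtain T where T: "closed T" "D = (E - {?x0}) \<inter> T" by (auto simp: closedin_closed)
    have "C1' = E \<inter> (insert ?x0 T)" using T(2) x0E by (auto simp: C1'_def)
    then show ?thesis using T(1) by (metis closed_insert closedin_closed_Int)
  qed
  define X where "X = C1' \<inter> cball ?x0 \<delta>"
  have EC: "E \<inter> cball ?x0 \<delta> = Sp \<inter> cball ?x0 \<delta>"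
  proof
    show "E \<inter> cball ?x0 \<delta> \<subseteq> Sp \<inter> cball ?x0 \<delta>" using EE by blast
    show "Sp \<inter> cball ?x0 \<delta> \<subseteq> E \<inter> cball ?x0 \<delta>"
    proof
      fix x assume x: "x \<in> Sp \<inter> cball ?x0 \<delta>"
      then have "x \<in> ?S" "s x \<ge> 0" "dist ?x0 x \<le> \<delta>" by (auto simp: Sp_def)
      then show "x \<in> E \<inter> cball ?x0 \<delta>" using sne[of x] by (cases "x = ?x0") (auto simp: E_def)
    qed
  qed
  have compX: "compact X"
  proof -
    obtain T where T: "closed T" "C1' = E \<inter> T" using cloC1' by (auto simp: closedin_closed)
    have "X = (E \<inter> cball ?x0 \<delta>) \<inter> T" using T(2) by (auto simp: X_def)
    also have "\<dots> = (Sp \<inter> cball ?x0 \<delta>) \<inter> T" unfolding EC by simp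
    finally show ?thesis using compSp T(1) by (simp add: compact_Int_closed)
  qed
  have x0X: "?x0 \<in> X" using \<delta> by (simp add: X_def C1'_def)
  define K where "K = connected_component_set X ?x0"
  have KX: "K \<subseteq> X" unfolding K_def by (rule connected_component_subset)
  have x0K: "?x0 \<in> K" unfolding K_def using x0X by simp
  have connK: "connected K" unfolding K_def by (rule connected_connected_component)
  have cloK: "closed K"
    unfolding K_def using compX compact_imp_closed closed_connected_component by blast
  \<comment> \<open>Boundary bumping: if K missed the sphere, some clopen part of X around (l0, 0)
    would lie in the open ball, hence be clopen in the connected set C1' and equal to it, making C1'
    compact.\<close>
  have sph: "K \<inter> sphere ?x0 \<delta> \<noteq> {}"
  proof
    assume no: "K \<inter> sphere ?x0 \<delta> = {}"
    let ?T = "top_of_set X"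
    have sepb: "separated_between ?T {?x0} (X \<inter> sphere ?x0 \<delta>)"
    proof (rule cut_wire_fence_theorem_gen)
      show "compact_space ?T" using compX by (simp add: compact_space_subtopology)
      show "Hausdorff_space ?T \<or> regular_space ?T \<or> normal_space ?T"
        by (simp add: Hausdorff_space_subtopology)
      show "compactin ?T {?x0}" using x0X by (simp add: compactin_subtopology)
      show "closedin ?T (X \<inter> sphere ?x0 \<delta>)"
        by (rule closedin_closed_Int) (auto simp: sphere_def intro!: closed_Collect_eq continuous_intros)
      fix C assume "connectedin ?T C"
      then have C: "connected C" "C \<subseteq> X" by (auto simp: connectedin_subtopology)
      show "disjnt C {?x0} \<or> disjnt C (X \<inter> sphere ?x0 \<delta>)"
      proof (cases "?x0 \<in> C")
        case True
        then have "C \<subseteq> K" unfolding K_def using C by (intro connected_component_maximal)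
        then show ?thesis using no by (auto simp: disjnt_def)
      qed (simp add: disjnt_def)
    qed
    then obtain U V where UV: "openin ?T U" "openin ?T V" "U \<union> V = X" "disjnt U V" "?x0 \<in> U" "X \<inter> sphere ?x0 \<delta> \<subseteq> V"
      unfolding separated_between_def by auto
    have "closedin ?T U"
    proof -
      have "U = X - V" using UV(3,4) by (auto simp: disjnt_def)
      then show ?thesis using UV(2) by (simp add: closedin_diff)
    qed
    then have "closed U" using compX compact_imp_closed closedin_closed_trans by blast
    have UX: "U \<subseteq> X" using UV(3) by blast
    have Uball: "U \<subseteq> ball ?x0 \<delta>"
    proof
      fix x assume "x \<in> U"
      then have "x \<in> X" "x \<notin> sphere ?x0 \<delta>" using UX UV(4,6) by (auto simp: disjnt_def)
      then show "x \<in> ball ?x0 \<delta>" by (auto simp: X_def)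
    qed
    have "openin (top_of_set C1') U"
    proof -
      obtain T where T: "open T" "U = X \<inter> T" using UV(1) by (auto simp: openin_open)
      have "U = C1' \<inter> (T \<inter> ball ?x0 \<delta>)"
        using T(2) Uball UX by (auto simp: X_def)
      then show ?thesis using T(1) by (metis open_Int open_ball openin_open_Int)
    qed
    moreover have "closedin (top_of_set C1') U"
      using \<open>closed U\<close> UX by (intro closed_subset) (auto simp: X_def)
    ultimately have "U = C1'" using C1'(1) UV(5) unfolding connected_clopen by blast
    then have "C1' = X" using UX by (auto simp: X_def)
    then show False using compX D(3) by (simp add: C1'_def)
  qed
  have KQ: "K \<subseteq> Q \<union> {?x0}"
  proof
    fix x assume "x \<in> K"
    then have x: "x \<in> C1'" "x \<in> cball ?x0 \<delta>" using KX by (auto simp: X_def)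
    show "x \<in> Q \<union> {?x0}"
    proof (cases "x = ?x0")
      case False
      then have "x \<in> D" using x by (simp add: C1'_def)
      then show ?thesis using cone[of "fst x" "snd x"] Dpos[of x] x False by (simp add: s_def)
    qed simp
  qed
  have branch: "local_branch ?S ?x0 \<delta> Q K"
    unfolding local_branch_def
  proof (intro conjI cloK connK KQ x0K sph)
    have "K \<subseteq> connected_component_set ?S ?x0"
      using x0K connK KX C1'(3) by (intro connected_component_maximal) (auto simp: X_def)
    then show "K \<subseteq> connected_component_set ?S ?x0 \<inter> cball ?x0 \<delta>" using KX by (auto simp: X_def)
  qed
  obtain x1 where x1: "x1 \<in> D" using DE(3) by blast
  define D2 where "D2 = connected_component_set (?S - {?x0}) x1"
  have "D \<subseteq> ?S - {?x0}" using DE(1) by (auto simp: E_def)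
  then have DD2: "D \<subseteq> D2" unfolding D2_def using x1 DE(2) by (intro connected_component_maximal)
  have D2c: "D2 \<in> components (?S - {?x0})"
    unfolding D2_def using x1 \<open>D \<subseteq> ?S - {?x0}\<close> by (intro componentsI) auto
  have D2S: "D2 \<subseteq> ?S - {?x0}" "connected D2"
    using D2c in_components_subset in_components_connected by blast+
  define C where "C = D2 \<union> {?x0}"
  have "unilateral_component ?S ?x0 K C"
    unfolding unilateral_component_def
  proof (intro bexI[of _ D2] conjI)
    show "K - {?x0} \<subseteq> D2" using KX DD2 by (auto simp: X_def C1'_def)
  qed (use D2c in \<open>auto simp: C_def\<close>)
  moreover have "\<not> compact C \<or> (\<exists>l1. l1 \<noteq> l0 \<and> (l1, 0) \<in> C) \<or> (\<exists>l z. f z = 0 \<and> z \<noteq> 0 \<and> (l, z) \<in> C)"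
  proof (cases "\<exists>x\<in>D2. s x = 0")
    case True
    then obtain l z where lz: "(l, z) \<in> D2" "f z = 0" by (auto simp: s_def)
    then have "(l, z) \<noteq> ?x0" "(l, z) \<in> C" using D2S by (auto simp: C_def)
    then show ?thesis using lz(2) by (cases "z = 0") auto
  next
    case False
    have "connected (s ` D2)" by (intro connected_continuous_image continuous_on_subset[OF cs] D2S) simp
    have "s x > 0" if x: "x \<in> D2" for x
    proof (rule ccontr)
      assume "\<not> s x > 0"
      moreover have "s x1 \<in> s ` D2" "s x \<in> s ` D2" using x x1 DD2 by auto
      ultimately have "0 \<in> s ` D2"
        using \<open>connected (s ` D2)\<close> Dpos(1)[OF x1] connectedD_interval[of "s ` D2" "s x" "s x1" 0] by simp
      then show False using False by force
    qed
    then have "D2 \<subseteq> E - {?x0}" using D2S(1) by (auto simp: E_def)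
    then have "D2 = D" using D(1) DD2 D2S(2) DE(3) components_maximal[of D "E - {?x0}" D2] by blast
    then have "C = insert ?x0 D" by (simp add: C_def)
    then show ?thesis using D(3) by simp
  qed
  ultimately show ?thesis using branch by blast
qed

theorem theorem9p4:
  fixes F :: "real \<times> 'u::banach \<Rightarrow> 'v::banach"
    and J :: "'u \<Rightarrow>\<^sub>L 'v"
    and l0 :: real and \<phi>0 :: 'u and Z :: "'u set" and \<phi>s :: "'u \<Rightarrow>\<^sub>L real"
    and \<psi> :: "'u \<Rightarrow> real" and C1 C2 \<eta> \<epsilon> \<delta> :: real
  assumes C: "inj (blinfun_apply J)" "compact_operator J"
    and smooth: "C1_map F"
    and F1: "\<forall>l. F (l, 0) = 0"
    and F2: "\<forall>l u. Du F l u \<in> Phi0"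
    and F3: "proper_on_closed_bounded F"
    and F4: "\<exists>N :: real \<times> 'v \<Rightarrow> 'v. continuous_on UNIV N \<and>
               (\<forall>l u. N (l, blinfun_apply J u) = F (l, u) - blinfun_apply (Du F l 0) u)"
    and F5: "l0 isolated_in Spec (linearization F)"
            "null_space (linearization F l0) = span {\<phi>0}" "norm \<phi>0 = 1"
    and odd_multiplicity: "\<exists>\<rho>0>0. \<forall>\<rho>. 0 < \<rho> \<and> \<rho> < \<rho>0 \<longrightarrow>
          (\<forall>L\<omega>. real_analytic_on L\<omega> {l0 - \<rho>..l0 + \<rho>}
               \<and> A_homotopic (l0 - \<rho>) (l0 + \<rho>) L\<omega> (linearization F)
             \<longrightarrow> odd (chi_interval L\<omega> (l0 - \<rho>) (l0 + \<rho>)))"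
    and Z: "closed Z" "complementary (null_space (linearization F l0)) Z"
           "Z = null_space \<phi>s" "blinfun_apply \<phi>s \<phi>0 = 1"
    and psi: "continuous_on UNIV \<psi>" "\<psi> 0 = 0"
             "\<forall>u. C1 * norm u \<le> \<psi> u \<and> \<psi> u \<le> C2 * norm u" "0 < C1" "C1 < C2"
    and eta: "0 < \<eta>" "\<eta> < 1 / C2"
    and small: "0 < \<epsilon>" "0 < \<delta>"
               "(nontrivial_solutions F - {(l0, 0)}) \<inter> cball (l0, 0) \<delta> \<subseteq> cone_both l0 \<phi>s \<psi> \<epsilon> \<eta>"
  shows "\<exists>Kp Km Cp Cm.
           local_branch (nontrivial_solutions F) (l0, 0) \<delta> (cone_plus l0 \<phi>s \<psi> \<epsilon> \<eta>) Kp
         \<and> local_branch (nontrivial_solutions F) (l0, 0) \<delta> (cone_minus l0 \<phi>s \<psi> \<epsilon> \<eta>) Km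
         \<and> Kp \<inter> Km = {(l0, 0)}
         \<and> unilateral_component (nontrivial_solutions F) (l0, 0) Kp Cp
         \<and> unilateral_component (nontrivial_solutions F) (l0, 0) Km Cm
         \<and> (\<forall>C \<in> {Cp, Cm}.
               \<not> compact C
             \<or> (\<exists>l1. l1 \<noteq> l0 \<and> (l1, 0) \<in> C)
             \<or> (\<exists>l. \<exists>z \<in> Z - {0}. (l, z) \<in> C))"
proof -
  let ?S = "nontrivial_solutions F" and ?x0 = "(l0, 0::'u)"
  have psi0: "\<psi> u \<ge> 0" for u
  proof -
    have "0 \<le> C1 * norm u" using psi(4) by simp
    also have "\<dots> \<le> \<psi> u" using psi(3) by simp
    finally show ?thesis .
  qed
  have cone: "\<bar>\<phi>s u\<bar> > \<eta> * \<psi> u" "\<bar>l - l0\<bar> < \<epsilon>" if "(l, u) \<in> ?S" "(l, u) \<in> cball ?x0 \<delta>" "(l, u) \<noteq> ?x0" for l u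
  proof -
    have "(l, u) \<in> cone_both l0 \<phi>s \<psi> \<epsilon> \<eta>" by (rule subsetD[OF small(3)]) (use that in simp)
    then show "\<bar>\<phi>s u\<bar> > \<eta> * \<psi> u" "\<bar>l - l0\<bar> < \<epsilon>" by (simp_all add: cone_both_def)
  qed
  have eta_psi: "\<eta> * \<psi> u \<ge> 0" for u using eta(1) psi0[of u] by simp
  have nz: "\<phi>s u \<noteq> 0" if "(l, u) \<in> ?S" "(l, u) \<in> cball ?x0 \<delta>" "(l, u) \<noteq> ?x0" for l u
    using cone(1)[OF that] eta_psi[of u] by auto
  have Z0: "z \<in> Z - {0} \<longleftrightarrow> \<phi>s z = 0 \<and> z \<noteq> 0" for z using Z(3) by (auto simp: null_space_def)
  have neg: "null_space (linearization F l0) = span {- \<phi>0}" "norm (- \<phi>0) = 1" "(- \<phi>s) (- \<phi>0) = 1"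
  proof -
    have "span {- \<phi>0} = span {\<phi>0}"
      unfolding span_eq
      using span_neg[OF span_base[of \<phi>0 "{\<phi>0}"]] span_neg[OF span_base[of "- \<phi>0" "{- \<phi>0}"]] by simp
    then show "null_space (linearization F l0) = span {- \<phi>0}" using F5(2) by simp
  qed (use F5(3) Z(4) in \<open>simp_all add: blinfun.minus_left blinfun.minus_right\<close>)
  \<comment> \<open>Within the closed ball, the two-sided cone condition and the sign of \<phi>s u
    together place a solution in a one-sided cone.\<close>
  have "\<exists>K C. local_branch ?S ?x0 \<delta> (cone_plus l0 \<phi>s \<psi> \<epsilon> \<eta>) K \<and> unilateral_component ?S ?x0 K C \<and>
    (\<not> compact C \<or> (\<exists>l1. l1 \<noteq> l0 \<and> (l1, 0) \<in> C) \<or> (\<exists>l z. \<phi>s z = 0 \<and> z \<noteq> 0 \<and> (l, z) \<in> C))"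
  proof (rule unilateral_branch[OF C(2) smooth F1 F2 F3 F4 F5 Z(4) odd_multiplicity small(2)])
    fix l u assume lu: "(l, u) \<in> ?S" "(l, u) \<in> cball ?x0 \<delta>" "(l, u) \<noteq> ?x0"
    show "\<phi>s u \<noteq> 0" by (rule nz[OF lu])
    assume "\<phi>s u > 0"
    then show "(l, u) \<in> cone_plus l0 \<phi>s \<psi> \<epsilon> \<eta>" using cone[OF lu] by (simp add: cone_plus_def)
  qed
  then obtain Kp Cp where p: "local_branch ?S ?x0 \<delta> (cone_plus l0 \<phi>s \<psi> \<epsilon> \<eta>) Kp" "unilateral_component ?S ?x0 Kp Cp"
    "\<not> compact Cp \<or> (\<exists>l1. l1 \<noteq> l0 \<and> (l1, 0) \<in> Cp) \<or> (\<exists>l z. \<phi>s z = 0 \<and> z \<noteq> 0 \<and> (l, z) \<in> Cp)"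
    by (elim exE conjE)
  have "\<exists>K C. local_branch ?S ?x0 \<delta> (cone_minus l0 \<phi>s \<psi> \<epsilon> \<eta>) K \<and> unilateral_component ?S ?x0 K C \<and>
    (\<not> compact C \<or> (\<exists>l1. l1 \<noteq> l0 \<and> (l1, 0) \<in> C) \<or> (\<exists>l z. (- \<phi>s) z = 0 \<and> z \<noteq> 0 \<and> (l, z) \<in> C))"
  proof (rule unilateral_branch[OF C(2) smooth F1 F2 F3 F4 F5(1) neg odd_multiplicity small(2)])
    fix l u assume lu: "(l, u) \<in> ?S" "(l, u) \<in> cball ?x0 \<delta>" "(l, u) \<noteq> ?x0"
    show "(- \<phi>s) u \<noteq> 0" using nz[OF lu] by (simp add: blinfun.minus_left)
    assume "(- \<phi>s) u > 0"
    then show "(l, u) \<in> cone_minus l0 \<phi>s \<psi> \<epsilon> \<eta>" using cone[OF lu] by (simp add: cone_minus_def blinfun.minus_left)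
  qed
  then obtain Km Cm where m: "local_branch ?S ?x0 \<delta> (cone_minus l0 \<phi>s \<psi> \<epsilon> \<eta>) Km" "unilateral_component ?S ?x0 Km Cm"
    "\<not> compact Cm \<or> (\<exists>l1. l1 \<noteq> l0 \<and> (l1, 0) \<in> Cm) \<or> (\<exists>l z. (- \<phi>s) z = 0 \<and> z \<noteq> 0 \<and> (l, z) \<in> Cm)"
    by (elim exE conjE)
  have "cone_plus l0 \<phi>s \<psi> \<epsilon> \<eta> \<inter> cone_minus l0 \<phi>s \<psi> \<epsilon> \<eta> = {}"
  proof -
    have "\<not> (\<phi>s u > \<eta> * \<psi> u \<and> \<phi>s u < - (\<eta> * \<psi> u))" for u using eta_psi[of u] by linarith
    then show ?thesis by (auto simp: cone_plus_def cone_minus_def)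
  qed
  moreover have "Kp \<subseteq> cone_plus l0 \<phi>s \<psi> \<epsilon> \<eta> \<union> {?x0}" "?x0 \<in> Kp"
    "Km \<subseteq> cone_minus l0 \<phi>s \<psi> \<epsilon> \<eta> \<union> {?x0}" "?x0 \<in> Km"
    using p(1) m(1) by (simp_all add: local_branch_def)
  ultimately have "Kp \<inter> Km = {?x0}" by blast
  moreover have "\<not> compact C \<or> (\<exists>l1. l1 \<noteq> l0 \<and> (l1, 0) \<in> C) \<or> (\<exists>l. \<exists>z \<in> Z - {0}. (l, z) \<in> C)" if "C \<in> {Cp, Cm}" for C
  proof -
    have "\<not> compact C \<or> (\<exists>l1. l1 \<noteq> l0 \<and> (l1, 0) \<in> C) \<or> (\<exists>l z. \<phi>s z = 0 \<and> z \<noteq> 0 \<and> (l, z) \<in> C)"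
      using that p(3) m(3) by (auto simp: blinfun.minus_left)
    then show ?thesis using Z0 by (elim disjE exE) auto
  qed
  ultimately show ?thesis
    by (intro exI[of _ Kp, OF exI[of _ Km, OF exI[of _ Cp, OF exI[of _ Cm]]]] conjI ballI p(1,2) m(1,2))
qed

end
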